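(* Let $M=\mathbb{R}^n$, let $(N,h)$ be a Riemannian manifold and let $(\phi,\psi)$ be a smooth Dirac-harmonic map with curvature term from $M$ to $N$, i.e. a smooth solution of $$\tau(\phi)=\tfrac12R^N(\psi,e_i\cdot\psi)d\phi(e_i)-\tfrac1{12}\langle(\nabla R^N)^\sharp(\psi,\psi)\psi,\psi\rangle,\qquad {D\!\!\!\!/\,}\psi=\tfrac13R^N(\psi,\psi)\psi.$$ Put $e_c(\phi,\psi):=|d\phi|^2+\frac16\langle R^N(\psi,\psi)\psi,\psi\rangle$. Let $B_R(x_0)$ be a geodesic ball around the point $x_0\in M$ and $0<R_1<R_2\leq R$. Then, with $B_r=B_r(x_0)$, $$R_1^{2-n}\int_{B_{R_1}}e_c(\phi,\psi)dx=R_2^{2-n}\int_{B_{R_2}}e_c(\phi,\psi)dx-\int_{R_1}^{R_2}\Big(r^{2-n}\int_{\partial B_r}\big(2\big|\tfrac{\partial\phi}{\partial r}\big|^2+\langle\psi,\partial_r\cdot\tilde\nabla_{\partial_r}\psi\rangle\big)d\sigma\Big)dr.$$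
   Context: $\Sigma M$ is the complex spinor bundle of $(M,g)$, with spin connection and hermitian metric. On $\Sigma M\otimes\phi^\ast TN$ (sections are vector spinors, locally $\psi=\psi^\alpha\otimes\partial_\alpha$) let $\tilde\nabla$ be the connection induced by $\Sigma M$ and $\phi^\ast TN$ (Levi-Civita on $N$), $\langle\cdot,\cdot\rangle$ the real part of the induced scalar product, and ${D\!\!\!\!/\,}=\sum_i e_i\cdot\tilde\nabla_{e_i}$ the twisted Dirac operator, $e_i$ a local orthonormal frame of $TM$ (repeated indices are summed); Clifford multiplication satisfies $X\cdot Y+Y\cdot X=-2g(X,Y)$; $\tau(\phi)$ is the tension field of $\phi$. Curvature conventions: $R^N(X,Y)=[\nabla_X,\nabla_Y]-\nabla_{[X,Y]}$, and $R_{\alpha\beta\gamma\delta}$ is normalized so that $R_{\alpha\beta\alpha\beta}>0$ in an orthonormal frame means positive sectional curvature. Set $$\langle R^N(\psi,\psi)\psi,\psi\rangle=R_{\alpha\beta\gamma\delta}\langle\psi^\alpha,\psi^\gamma\rangle\langle\psi^\beta,\psi^\delta\rangle,\qquad R^N(\psi,\psi)\psi=R^{\alpha}{}_{\beta\gamma\delta}\langle\psi^\beta,\psi^\delta\rangle\psi^\gamma\otimes\partial_\alpha,$$ where $\langle\psi^\alpha,\psi^\gamma\rangle$ is the hermitian product on $\Sigma M$ and the first expression is real. Further, $R^N(\psi,e_i\cdot\psi)d\phi(e_i)=\langle\psi^\alpha,e_i\cdot\psi^\beta\rangle R^N(\partial_\alpha,\partial_\beta)d\phi(e_i)$, and $\langle(\nabla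 R^N)^\sharp(\psi,\psi)\psi,\psi\rangle\in\Gamma(\phi^\ast TN)$ is the section whose inner product with $V$ is $(\nabla_VR)_{\alpha\beta\gamma\delta}\langle\psi^\alpha,\psi^\gamma\rangle\langle\psi^\beta,\psi^\delta\rangle$. (The system is the Euler–Lagrange system of $E_c(\phi,\psi)=\frac12\int_M(|d\phi|^2+\langle\psi,{D\!\!\!\!/\,}\psi\rangle-\frac16\langle R^N(\psi,\psi)\psi,\psi\rangle)d\mathrm{vol}_g$.) Here $r$ is the distance to $x_0$, $\partial_r$ the unit radial vector field, $\frac{\partial\phi}{\partial r}=d\phi(\partial_r)$, and $d\sigma$ the induced measure on $\partial B_r$. *)

theory Defs
  imports "HOL-Analysis.Analysis"
begin

section \<open>Smooth functions on open sets\<close>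

text \<open>Only used for open \<open>S\<close>. Derivatives are iterated through all directional derivatives, because
  the type of the \<open>k\<close>-th Frechet derivative depends on \<open>k\<close>.\<close>

primrec Ck_on :: "nat \<Rightarrow> ('a::real_normed_vector \<Rightarrow> 'b::real_normed_vector) \<Rightarrow> 'a set \<Rightarrow> bool" where
  "Ck_on 0 f S \<longleftrightarrow> continuous_on S f"
| "Ck_on (Suc k) f S \<longleftrightarrow>
     (\<forall>x\<in>S. f differentiable (at x)) \<and> (\<forall>v. Ck_on k (\<lambda>x. frechet_derivative f (at x) v) S)"

definition smooth_on :: "'a::real_normed_vector set \<Rightarrow> ('a \<Rightarrow> 'b::real_normed_vector) \<Rightarrow> bool" where
  "smooth_on S f \<longleftrightarrow> (\<forall>k. Ck_on k f S)"


section \<open>Riemannian manifolds\<close>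

text \<open>A manifold is a topological space with an atlas of coordinate charts, labelled by the elements of
  \<open>charts\<close>: the chart \<open>c\<close> is the map \<open>cmap c\<close> on the open set \<open>cdom c\<close>. Tensor fields are given by their
  components in the charts; the metric in the chart \<open>c\<close> is the matrix function \<open>metric c\<close> on the coordinate
  domain \<open>cmap c ` cdom c\<close>. Values outside these domains carry no meaning.\<close>

record ('p, 'c, 'm::finite) riem_data =
  mtop :: "'p topology"
  charts :: "'c set"
  cdom :: "'c \<Rightarrow> 'p set"
  cmap :: "'c \<Rightarrow> 'p \<Rightarrow> real^'m"
  metric :: "'c \<Rightarrow> real^'m \<Rightarrow> real^'m^'m"

definition transition :: "('p, 'c, 'm::finite) riem_data \<Rightarrow> 'c \<Rightarrow> 'c \<Rightarrow> real^'m \<Rightarrow> real^'m" where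
  "transition N c c' = cmap N c' \<circ> inv_into (cdom N c) (cmap N c)"

definition riemannian_manifold :: "('p, 'c, 'm::finite) riem_data \<Rightarrow> bool" where
  "riemannian_manifold N \<longleftrightarrow>
     Hausdorff_space (mtop N) \<and> second_countable (mtop N) \<and>
     topspace (mtop N) = (\<Union>c\<in>charts N. cdom N c) \<and>
     (\<forall>c\<in>charts N.
        openin (mtop N) (cdom N c) \<and> open (cmap N c ` cdom N c) \<and>
        homeomorphic_map (subtopology (mtop N) (cdom N c))
          (subtopology euclidean (cmap N c ` cdom N c)) (cmap N c)) \<and>
     (\<forall>c\<in>charts N. \<forall>c'\<in>charts N.
        smooth_on (cmap N c ` (cdom N c \<inter> cdom N c')) (transition N c c')) \<and>
     (\<forall>c\<in>charts N.
        smooth_on (cmap N c ` cdom N c) (metric N c) \<and>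
        (\<forall>y\<in>cmap N c ` cdom N c.
           transpose (metric N c y) = metric N c y \<and>
           (\<forall>v. v \<noteq> 0 \<longrightarrow> v \<bullet> (metric N c y *v v) > 0))) \<and>
     (\<forall>c\<in>charts N. \<forall>c'\<in>charts N. \<forall>y\<in>cmap N c ` (cdom N c \<inter> cdom N c').
        metric N c y =
          transpose (jacobian (transition N c c') (at y))
            ** metric N c' (transition N c c' y) ** jacobian (transition N c c') (at y))"

definition chart_at :: "('p, 'c, 'm::finite) riem_data \<Rightarrow> 'p \<Rightarrow> 'c" where
  "chart_at N p = (SOME c. c \<in> charts N \<and> p \<in> cdom N c)"


section \<open>Levi-Civita connection and curvature in coordinates\<close>

definition pderiv_at :: "'m::finite \<Rightarrow> (real^'m \<Rightarrow> real) \<Rightarrow> real^'m \<Rightarrow> real" where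
  "pderiv_at a f y = frechet_derivative f (at y) (axis a 1)"

text \<open>\<open>christoffel h y a b c\<close> is $\Gamma^a_{bc}(y)$.\<close>

definition christoffel :: "(real^'m::finite \<Rightarrow> real^'m^'m) \<Rightarrow> real^'m \<Rightarrow> 'm \<Rightarrow> 'm \<Rightarrow> 'm \<Rightarrow> real" where
  "christoffel h y a b c =
     1/2 * (\<Sum>d\<in>UNIV. matrix_inv (h y) $ a $ d *
       (pderiv_at b (\<lambda>z. h z $ c $ d) y + pderiv_at c (\<lambda>z. h z $ b $ d) y
         - pderiv_at d (\<lambda>z. h z $ b $ c) y))"

text \<open>\<open>curv_op h y e d a b\<close> is the \<open>e\<close>-th component of $R(\partial_a,\partial_b)\partial_d$, where
  $R(X,Y)=[\nabla_X,\nabla_Y]-\nabla_{[X,Y]}$.\<close>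

definition curv_op :: "(real^'m::finite \<Rightarrow> real^'m^'m) \<Rightarrow> real^'m \<Rightarrow> 'm \<Rightarrow> 'm \<Rightarrow> 'm \<Rightarrow> 'm \<Rightarrow> real" where
  "curv_op h y e d a b =
     pderiv_at a (\<lambda>z. christoffel h z e b d) y - pderiv_at b (\<lambda>z. christoffel h z e a d) y
     + (\<Sum>m\<in>UNIV. christoffel h y e a m * christoffel h y m b d
                 - christoffel h y e b m * christoffel h y m a d)"

text \<open>$R_{abcd}=h(R(\partial_a,\partial_b)\partial_d,\partial_c)$; thus $R_{abab}$ is the sectional
  curvature in an orthonormal frame.\<close>

definition riem :: "(real^'m::finite \<Rightarrow> real^'m^'m) \<Rightarrow> real^'m \<Rightarrow> 'm \<Rightarrow> 'm \<Rightarrow> 'm \<Rightarrow> 'm \<Rightarrow> real" where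
  "riem h y a b c d = (\<Sum>e\<in>UNIV. h y $ c $ e * curv_op h y e d a b)"

text \<open>$R^a{}_{bcd}$: the first index raised.\<close>

definition riem_up :: "(real^'m::finite \<Rightarrow> real^'m^'m) \<Rightarrow> real^'m \<Rightarrow> 'm \<Rightarrow> 'm \<Rightarrow> 'm \<Rightarrow> 'm \<Rightarrow> real" where
  "riem_up h y a b c d = (\<Sum>e\<in>UNIV. matrix_inv (h y) $ a $ e * riem h y e b c d)"

text \<open>$(\nabla_{\partial_v}R)_{abcd}$.\<close>

definition nabla_riem ::
    "(real^'m::finite \<Rightarrow> real^'m^'m) \<Rightarrow> real^'m \<Rightarrow> 'm \<Rightarrow> 'm \<Rightarrow> 'm \<Rightarrow> 'm \<Rightarrow> 'm \<Rightarrow> real" where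
  "nabla_riem h y v a b c d =
     pderiv_at v (\<lambda>z. riem h z a b c d) y
     - (\<Sum>m\<in>UNIV. christoffel h y m v a * riem h y m b c d + christoffel h y m v b * riem h y a m c d
                 + christoffel h y m v c * riem h y a b m d + christoffel h y m v d * riem h y a b c m)"


section \<open>Spinors on Euclidean space\<close>

text \<open>Conjugate-linear in the first argument. This is the convention for which
  $\langle R(\psi,\psi)\psi,\psi\rangle$, as defined by the index formula, is the inner product of
  $R(\psi,\psi)\psi$ with $\psi$.\<close>

definition herm :: "complex^'s::finite \<Rightarrow> complex^'s \<Rightarrow> complex" where
  "herm u v = (\<Sum>s\<in>UNIV. cnj (u $ s) * v $ s)"

text \<open>Clifford multiplication of $\mathbb{R}^n$ on its complex spinor space, of dimension
  $2^{\lfloor n/2\rfloor}$. A complex Clifford module of this dimension is irreducible, so it is the spinor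
  module (one of the two, if \<open>n\<close> is odd). The spinor bundle of flat $\mathbb{R}^n$ is trivialised by parallel
  spinors: spinors are functions into \<open>complex^'s\<close>, the spin connection is the ordinary derivative, and
  Clifford multiplication is the same at every point.\<close>

definition spinor_module :: "(real^'n::finite \<Rightarrow> complex^'s::finite \<Rightarrow> complex^'s) \<Rightarrow> bool" where
  "spinor_module cl \<longleftrightarrow>
     CARD('s) = 2 ^ (CARD('n) div 2) \<and>
     (\<forall>u. linear (\<lambda>X. cl X u)) \<and>
     (\<forall>X. Vector_Spaces.linear (*s) (*s) (cl X)) \<and>
     (\<forall>X Y u. cl X (cl Y u) + cl Y (cl X u) = (- 2 * (X \<bullet> Y)) *\<^sub>R u) \<and>
     (\<forall>X u v. herm (cl X u) v = - herm u (cl X v))"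


section \<open>Maps and vector spinors\<close>

definition smooth_map ::
    "('p, 'c, 'm::finite) riem_data \<Rightarrow> (real^'n::finite \<Rightarrow> 'p) \<Rightarrow> bool" where
  "smooth_map N \<phi> \<longleftrightarrow>
     continuous_map euclidean (mtop N) \<phi> \<and>
     (\<forall>c\<in>charts N. smooth_on (\<phi> -` cdom N c) (cmap N c \<circ> \<phi>))"

text \<open>A section $\psi=\psi^\alpha\otimes\partial_\alpha$ of $\Sigma M\otimes\phi^*TN$ is given by its
  components: \<open>\<psi> c x $ a\<close> is $\psi^a(x)$ with respect to the chart \<open>c\<close>, for \<open>x\<close> with \<open>\<phi> x \<in> cdom N c\<close>.\<close>

definition smooth_vector_spinor ::
    "('p, 'c, 'm::finite) riem_data \<Rightarrow> (real^'n::finite \<Rightarrow> 'p) \<Rightarrow>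
     ('c \<Rightarrow> real^'n \<Rightarrow> complex^'s::finite^'m) \<Rightarrow> bool" where
  "smooth_vector_spinor N \<phi> \<psi> \<longleftrightarrow>
     (\<forall>c\<in>charts N. smooth_on (\<phi> -` cdom N c) (\<psi> c)) \<and>
     (\<forall>c\<in>charts N. \<forall>c'\<in>charts N. \<forall>x. \<phi> x \<in> cdom N c \<inter> cdom N c' \<longrightarrow>
        (\<forall>a. \<psi> c' x $ a =
          (\<Sum>b\<in>UNIV. jacobian (transition N c c') (at (cmap N c (\<phi> x))) $ a $ b *\<^sub>R \<psi> c x $ b)))"

text \<open>In the remaining definitions \<open>c\<close> is a chart around \<open>\<phi> x\<close>, and elements of $T_{\phi(x)}N$ and
  $\Sigma_xM\otimes T_{\phi(x)}N$ are given by their components in that chart.\<close>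

definition met :: "('p, 'c, 'm::finite) riem_data \<Rightarrow> (real^'n::finite \<Rightarrow> 'p) \<Rightarrow> 'c \<Rightarrow> real^'n \<Rightarrow> real^'m^'m" where
  "met N \<phi> c x = metric N c (cmap N c (\<phi> x))"

definition tinner :: "('p, 'c, 'm::finite) riem_data \<Rightarrow> (real^'n::finite \<Rightarrow> 'p) \<Rightarrow> 'c \<Rightarrow> real^'n \<Rightarrow>
    real^'m \<Rightarrow> real^'m \<Rightarrow> real" where
  "tinner N \<phi> c x V W = (\<Sum>a\<in>UNIV. \<Sum>b\<in>UNIV. met N \<phi> c x $ a $ b * V $ a * W $ b)"

definition vsinner :: "('p, 'c, 'm::finite) riem_data \<Rightarrow> (real^'n::finite \<Rightarrow> 'p) \<Rightarrow> 'c \<Rightarrow> real^'n \<Rightarrow>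
    complex^'s::finite^'m \<Rightarrow> complex^'s^'m \<Rightarrow> real" where
  "vsinner N \<phi> c x \<psi> \<xi> =
     Re (\<Sum>a\<in>UNIV. \<Sum>b\<in>UNIV. of_real (met N \<phi> c x $ a $ b) * herm (\<psi> $ a) (\<xi> $ b))"

definition dmap :: "('p, 'c, 'm::finite) riem_data \<Rightarrow> (real^'n::finite \<Rightarrow> 'p) \<Rightarrow> 'c \<Rightarrow> real^'n \<Rightarrow> real^'n \<Rightarrow> real^'m" where
  "dmap N \<phi> c x v = frechet_derivative (cmap N c \<circ> \<phi>) (at x) v"

text \<open>The pulled-back Levi-Civita connection in direction \<open>v\<close>. It acts both on sections of $\phi^*TN$
  (\<open>'b = real\<close>) and, the spin connection being trivial, on vector spinors (\<open>'b = complex^'s\<close>).\<close>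

definition cov_deriv :: "('p, 'c, 'm::finite) riem_data \<Rightarrow> (real^'n::finite \<Rightarrow> 'p) \<Rightarrow> 'c \<Rightarrow>
    (real^'n \<Rightarrow> 'b::real_normed_vector^'m) \<Rightarrow> real^'n \<Rightarrow> real^'n \<Rightarrow> 'b^'m" where
  "cov_deriv N \<phi> c W x v = frechet_derivative W (at x) v +
     (\<chi> a. \<Sum>b\<in>UNIV. \<Sum>d\<in>UNIV.
        (christoffel (metric N c) (cmap N c (\<phi> x)) a b d * dmap N \<phi> c x v $ b) *\<^sub>R W x $ d)"

text \<open>The trace of $\nabla d\phi$ in the standard frame $e_i$ (\<open>axis i 1\<close>), which is parallel.\<close>

definition tension :: "('p, 'c, 'm::finite) riem_data \<Rightarrow> (real^'n::finite \<Rightarrow> 'p) \<Rightarrow> 'c \<Rightarrow> real^'n \<Rightarrow> real^'m" where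
  "tension N \<phi> c x = (\<Sum>i\<in>UNIV. cov_deriv N \<phi> c (\<lambda>y. dmap N \<phi> c y (axis i 1)) x (axis i 1))"

definition vs_cliff :: "(real^'n::finite \<Rightarrow> complex^'s::finite \<Rightarrow> complex^'s) \<Rightarrow>
    real^'n \<Rightarrow> complex^'s^'m::finite \<Rightarrow> complex^'s^'m" where
  "vs_cliff cl X \<psi> = (\<chi> a. cl X (\<psi> $ a))"

definition dirac :: "(real^'n::finite \<Rightarrow> complex^'s::finite \<Rightarrow> complex^'s) \<Rightarrow>
    ('p, 'c, 'm::finite) riem_data \<Rightarrow> (real^'n \<Rightarrow> 'p) \<Rightarrow> 'c \<Rightarrow>
    (real^'n \<Rightarrow> complex^'s^'m) \<Rightarrow> real^'n \<Rightarrow> complex^'s^'m" where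
  "dirac cl N \<phi> c \<psi> x = (\<Sum>i\<in>UNIV. vs_cliff cl (axis i 1) (cov_deriv N \<phi> c \<psi> x (axis i 1)))"


section \<open>Curvature terms\<close>

text \<open>The sums to which \<open>Re\<close> is applied in this section are real: in the first and third because
  $R_{abcd}=R_{cdab}$, and in the second because $R(\partial_a,\partial_b)$ is antisymmetric in \<open>a\<close>, \<open>b\<close>
  while $\langle\psi^b,e_i\cdot\psi^a\rangle=-\overline{\langle\psi^a,e_i\cdot\psi^b\rangle}$.\<close>

text \<open>$\langle R^N(\psi,\psi)\psi,\psi\rangle$.\<close>

definition curv_quartic :: "('p, 'c, 'm::finite) riem_data \<Rightarrow> (real^'n::finite \<Rightarrow> 'p) \<Rightarrow> 'c \<Rightarrow> real^'n \<Rightarrow>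
    complex^'s::finite^'m \<Rightarrow> real" where
  "curv_quartic N \<phi> c x \<psi> =
     Re (\<Sum>a\<in>UNIV. \<Sum>b\<in>UNIV. \<Sum>d\<in>UNIV. \<Sum>e\<in>UNIV.
       of_real (riem (metric N c) (cmap N c (\<phi> x)) a b d e) * herm (\<psi> $ a) (\<psi> $ d) * herm (\<psi> $ b) (\<psi> $ e))"

text \<open>$R^N(\psi,e_i\cdot\psi)d\phi(e_i)$, summed over \<open>i\<close>.\<close>

definition curv_dmap :: "(real^'n::finite \<Rightarrow> complex^'s::finite \<Rightarrow> complex^'s) \<Rightarrow>
    ('p, 'c, 'm::finite) riem_data \<Rightarrow> (real^'n \<Rightarrow> 'p) \<Rightarrow> 'c \<Rightarrow> real^'n \<Rightarrow> complex^'s^'m \<Rightarrow> real^'m" where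
  "curv_dmap cl N \<phi> c x \<psi> =
     (\<chi> e. Re (\<Sum>i\<in>UNIV. \<Sum>a\<in>UNIV. \<Sum>b\<in>UNIV. herm (\<psi> $ a) (cl (axis i 1) (\<psi> $ b)) *
        of_real (\<Sum>d\<in>UNIV. curv_op (metric N c) (cmap N c (\<phi> x)) e d a b * dmap N \<phi> c x (axis i 1) $ d)))"

text \<open>$\langle(\nabla R^N)^\sharp(\psi,\psi)\psi,\psi\rangle$.\<close>

definition nabla_curv_sharp :: "('p, 'c, 'm::finite) riem_data \<Rightarrow> (real^'n::finite \<Rightarrow> 'p) \<Rightarrow> 'c \<Rightarrow> real^'n \<Rightarrow>
    complex^'s::finite^'m \<Rightarrow> real^'m" where
  "nabla_curv_sharp N \<phi> c x \<psi> =
     matrix_inv (met N \<phi> c x) *v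
     (\<chi> v. Re (\<Sum>a\<in>UNIV. \<Sum>b\<in>UNIV. \<Sum>d\<in>UNIV. \<Sum>e\<in>UNIV.
        of_real (nabla_riem (metric N c) (cmap N c (\<phi> x)) v a b d e)
          * herm (\<psi> $ a) (\<psi> $ d) * herm (\<psi> $ b) (\<psi> $ e)))"

text \<open>$R^N(\psi,\psi)\psi$.\<close>

definition curv_cubic :: "('p, 'c, 'm::finite) riem_data \<Rightarrow> (real^'n::finite \<Rightarrow> 'p) \<Rightarrow> 'c \<Rightarrow> real^'n \<Rightarrow>
    complex^'s::finite^'m \<Rightarrow> complex^'s^'m" where
  "curv_cubic N \<phi> c x \<psi> =
     (\<chi> a. \<Sum>b\<in>UNIV. \<Sum>d\<in>UNIV. \<Sum>e\<in>UNIV.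
        (of_real (riem_up (metric N c) (cmap N c (\<phi> x)) a b d e) * herm (\<psi> $ b) (\<psi> $ e)) *s (\<psi> $ d))"


section \<open>Dirac-harmonic maps with curvature term\<close>

definition dirac_harmonic_curv :: "(real^'n::finite \<Rightarrow> complex^'s::finite \<Rightarrow> complex^'s) \<Rightarrow>
    ('p, 'c, 'm::finite) riem_data \<Rightarrow> (real^'n \<Rightarrow> 'p) \<Rightarrow>
    ('c \<Rightarrow> real^'n \<Rightarrow> complex^'s^'m) \<Rightarrow> bool" where
  "dirac_harmonic_curv cl N \<phi> \<psi> \<longleftrightarrow>
     smooth_map N \<phi> \<and> smooth_vector_spinor N \<phi> \<psi> \<and>
     (\<forall>c\<in>charts N. \<forall>x. \<phi> x \<in> cdom N c \<longrightarrow>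
        tension N \<phi> c x =
          (1/2) *\<^sub>R curv_dmap cl N \<phi> c x (\<psi> c x) - (1/12) *\<^sub>R nabla_curv_sharp N \<phi> c x (\<psi> c x) \<and>
        dirac cl N \<phi> c (\<psi> c) x = (1/3) *\<^sub>R curv_cubic N \<phi> c x (\<psi> c x))"

text \<open>The following two functions are scalars, so their value at \<open>x\<close> may be computed in any chart around
  \<open>\<phi> x\<close>. The first is $e_c(\phi,\psi)$.\<close>

definition energy_density :: "('p, 'c, 'm::finite) riem_data \<Rightarrow> (real^'n::finite \<Rightarrow> 'p) \<Rightarrow>
    ('c \<Rightarrow> real^'n \<Rightarrow> complex^'s::finite^'m) \<Rightarrow> real^'n \<Rightarrow> real" where
  "energy_density N \<phi> \<psi> x = (let c = chart_at N (\<phi> x) in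
     (\<Sum>i\<in>UNIV. tinner N \<phi> c x (dmap N \<phi> c x (axis i 1)) (dmap N \<phi> c x (axis i 1)))
     + 1/6 * curv_quartic N \<phi> c x (\<psi> c x))"

text \<open>$2|d\phi(v)|^2+\langle\psi,v\cdot\tilde\nabla_v\psi\rangle$ at \<open>x\<close>.\<close>

definition directional_density :: "(real^'n::finite \<Rightarrow> complex^'s::finite \<Rightarrow> complex^'s) \<Rightarrow>
    ('p, 'c, 'm::finite) riem_data \<Rightarrow> (real^'n \<Rightarrow> 'p) \<Rightarrow>
    ('c \<Rightarrow> real^'n \<Rightarrow> complex^'s^'m) \<Rightarrow> real^'n \<Rightarrow> real^'n \<Rightarrow> real" where
  "directional_density cl N \<phi> \<psi> x v = (let c = chart_at N (\<phi> x) in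
     2 * tinner N \<phi> c x (dmap N \<phi> c x v) (dmap N \<phi> c x v)
     + vsinner N \<phi> c x (\<psi> c x) (vs_cliff cl v (cov_deriv N \<phi> c (\<psi> c) x v)))"

definition radial :: "real^'n::finite \<Rightarrow> real^'n \<Rightarrow> real^'n" where
  "radial x0 x = (1 / norm (x - x0)) *\<^sub>R (x - x0)"


section \<open>The induced measure on a sphere\<close>

text \<open>The open half spheres on either side of the hyperplanes $x_k=(x_0)_k$ are the graphs of
  $x_k=(x_0)_k+s\,\sqrt{r^2-\sum_{i\ne k}(y_i-(x_0)_i)^2}$ with \<open>s = 1\<close> or \<open>s = -1\<close>, where \<open>y\<close> ranges over the
  coordinates other than \<open>k\<close>. The volume element of the induced metric on a graph is
  $\sqrt{1+|\nabla u|^2}\,dy$. These \<open>2n\<close> charts cover the sphere, and the functions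
  $((x-x_0)_k/r)^2$, restricted to the two half spheres with index \<open>k\<close> and extended by 0, form a partition
  of unity for them, by which the measure is put together.\<close>

definition off_sq :: "real^'n::finite \<Rightarrow> 'n \<Rightarrow> ('n \<Rightarrow> real) \<Rightarrow> real" where
  "off_sq x0 k y = (\<Sum>i\<in>-{k}. (y i - x0 $ i)\<^sup>2)"

definition graph_pt :: "real^'n::finite \<Rightarrow> real \<Rightarrow> 'n \<Rightarrow> real \<Rightarrow> ('n \<Rightarrow> real) \<Rightarrow> real^'n" where
  "graph_pt x0 r k s y = (\<chi> i. if i = k then x0 $ k + s * sqrt (r\<^sup>2 - off_sq x0 k y) else y i)"

definition graph_area_element :: "real^'n::finite \<Rightarrow> real \<Rightarrow> 'n \<Rightarrow> ('n \<Rightarrow> real) \<Rightarrow> real" where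
  "graph_area_element x0 r k y =
     sqrt (1 + (\<Sum>i\<in>-{k}. ((y i - x0 $ i) / sqrt (r\<^sup>2 - off_sq x0 k y))\<^sup>2))"

definition sphere_measure :: "real^'n::finite \<Rightarrow> real \<Rightarrow> (real^'n) measure" where
  "sphere_measure x0 r = measure_of UNIV (sets borel)
     (\<lambda>A. \<Sum>k\<in>UNIV. \<Sum>s\<in>{-1, 1}.
        \<integral>\<^sup>+ y. indicator {y. off_sq x0 k y < r\<^sup>2} y * indicator A (graph_pt x0 r k s y) *
               ennreal (((graph_pt x0 r k s y - x0) $ k / r)\<^sup>2 * graph_area_element x0 r k y)
          \<partial>(\<Pi>\<^sub>M i\<in>-{k}. lborel))"

lemma off_sq_measurable [measurable]:
  "off_sq x0 k \<in> borel_measurable (\<Pi>\<^sub>M i\<in>-{k}. lborel)"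
  unfolding off_sq_def by measurable

lemma graph_pt_measurable [measurable]:
  "graph_pt x0 r k s \<in> borel_measurable (\<Pi>\<^sub>M i\<in>-{k}. lborel)"
proof (rule borel_measurable_euclidean_space[THEN iffD2], intro ballI)
  fix b :: "real^'a" assume "b \<in> Basis"
  then obtain j where b: "b = axis j 1"
    by (auto simp: Basis_vec_def)
  show "(\<lambda>y. graph_pt x0 r k s y \<bullet> b) \<in> borel_measurable (\<Pi>\<^sub>M i\<in>-{k}. lborel)"
  proof (cases "j = k")
    case True
    then have eq: "(\<lambda>y. graph_pt x0 r k s y \<bullet> b) = (\<lambda>y. x0 $ k + s * sqrt (r\<^sup>2 - off_sq x0 k y))"
      by (simp add: b graph_pt_def inner_axis)
    show ?thesis unfolding eq by measurable
  next
    case False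
    then have eq: "(\<lambda>y. graph_pt x0 r k s y \<bullet> b) = (\<lambda>y. y j)"
      by (simp add: b graph_pt_def inner_axis)
    show ?thesis unfolding eq
      using measurable_component_singleton[of j "-{k}" "\<lambda>_. lborel"] False by simp
  qed
qed

lemma graph_area_element_measurable [measurable]:
  "graph_area_element x0 r k \<in> borel_measurable (\<Pi>\<^sub>M i\<in>-{k}. lborel)"
  unfolding graph_area_element_def by measurable

lemma graph_pt_nth_measurable [measurable]:
  "(\<lambda>y. (graph_pt x0 r k s y - x0) $ k) \<in> borel_measurable (\<Pi>\<^sub>M i\<in>-{k}. lborel)"
  unfolding graph_pt_def by simp

lemma sets_sphere_measure [simp, measurable_cong]: "sets (sphere_measure x0 r) = sets borel"
  unfolding sphere_measure_def
  by (simp add: sets_measure_of sets.sigma_sets_eq[of borel, unfolded space_borel])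

lemma space_sphere_measure [simp]: "space (sphere_measure x0 r) = UNIV"
  unfolding sphere_measure_def by (simp add: space_measure_of_conv)

lemma emeasure_sphere_measure:
  assumes A: "A \<in> sets borel"
  shows "emeasure (sphere_measure x0 r) A =
     (\<Sum>k\<in>UNIV. \<Sum>s\<in>{-1, 1}.
        \<integral>\<^sup>+ y. indicator {y. off_sq x0 k y < r\<^sup>2} y * indicator A (graph_pt x0 r k s y) *
               ennreal (((graph_pt x0 r k s y - x0) $ k / r)\<^sup>2 * graph_area_element x0 r k y)
          \<partial>(\<Pi>\<^sub>M i\<in>-{k}. lborel))"
proof -
  define F where "F k s A = (\<integral>\<^sup>+ y. indicator {y. off_sq x0 k y < r\<^sup>2} y * indicator A (graph_pt x0 r k s y) *
               ennreal (((graph_pt x0 r k s y - x0) $ k / r)\<^sup>2 * graph_area_element x0 r k y)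
          \<partial>(\<Pi>\<^sub>M i\<in>-{k}. lborel))" for k s A
  have ca: "(\<Sum>i. F k s (B i)) = F k s (\<Union>i. B i)"
    if B: "range B \<subseteq> sets borel" "disjoint_family B" for k s and B :: "nat \<Rightarrow> (real^'a) set"
  proof -
    have [measurable]: "B i \<in> sets borel" for i using B by auto
    have ind: "(indicator (\<Union>i. B i) p :: ennreal) = (\<Sum>i. indicator (B i) p)" for p
      using suminf_indicator[OF B(2)] by metis
    let ?M = "\<Pi>\<^sub>M i\<in>-{k}. lborel :: real measure"
    have 1: "(\<lambda>y. indicator {y. off_sq x0 k y < r\<^sup>2} y :: ennreal) \<in> borel_measurable ?M"
    proof -
      have "(\<lambda>y. indicator {..<r\<^sup>2} (off_sq x0 k y) :: ennreal) \<in> borel_measurable ?M"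
        by (rule measurable_compose[OF off_sq_measurable]) simp
      then show ?thesis by (simp add: indicator_def)
    qed
    have 2: "(\<lambda>y. indicator (B i) (graph_pt x0 r k s y) :: ennreal) \<in> borel_measurable ?M" for i
      by (rule measurable_compose[OF graph_pt_measurable]) simp
    have 3: "(\<lambda>y. ennreal (((graph_pt x0 r k s y - x0) $ k / r)\<^sup>2 * graph_area_element x0 r k y))
        \<in> borel_measurable ?M"
      by (intro measurable_compose[OF _ measurable_ennreal] borel_measurable_times
          borel_measurable_power borel_measurable_divide borel_measurable_const
          graph_area_element_measurable graph_pt_nth_measurable)
    show ?thesis
      unfolding F_def ind
      by (subst nn_integral_suminf[symmetric])
         (auto intro!: borel_measurable_times_ennreal 1 2 3[simplified])
  qed
  have "countably_additive (sets borel) (\<lambda>A. \<Sum>k\<in>UNIV. \<Sum>s\<in>{-1, 1}. F k s A)"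
    unfolding countably_additive_def
    by (auto simp add: suminf_sum ca simp del: sum.insert sum.empty)
  moreover have "positive (sets borel) (\<lambda>A. \<Sum>k\<in>UNIV. \<Sum>s\<in>{-1, 1}. F k s A)"
    by (simp add: positive_def F_def)
  ultimately show ?thesis
    unfolding sphere_measure_def F_def[symmetric]
    by (intro emeasure_measure_of_sigma A)
       (use sets.sigma_algebra_axioms[of "borel :: (real^'a) measure"] in auto)
qed

end

(* The unsymmetrised stress tensor S_ij = A_ij - delta_ij e_c, where
   A_ij = 2 <dphi(e_i), dphi(e_j)> + <psi, e_i . nabla_j psi>, is divergence free in i by the field equations,
   and its trace is (2 - n) e_c because <psi, D psi> = <R(psi,psi)psi,psi> / 3. The vector field
   V_i = S_ij (x - x0)_j therefore has divergence (2 - n) e_c, and V . (x - x0) is |x - x0|^2 times the radial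
   density minus e_c. Testing with a radial Lipschitz cutoff whose slope is r^(1-n) on [R1, R2] gives the formula
   with an integral over the annulus, which polar coordinates turn into the iterated integral.

   The energy density is chart independent although only the connection has been transformed: the Dirac
   equation expresses the quartic term through <psi, e_i . nabla_i psi>. *)

theory Submission
  imports Defs
begin

section \<open>Smooth functions\<close>

text \<open>Conservation depends on the balance of the constants 1/2, 1/12 and 1/3. The derivative
  of the quartic term in a direction c has a part \<open>NR\<close> falling on the curvature tensor
  and four parts falling on the spinor slots, all equal to one \<open>Z\<close> by the symmetries of
  R; with the Dirac equation, 3 times the derivative of <psi, D psi> is \<open>NR + 4 * Z\<close>.
  Commuting covariant derivatives in the divergence of <psi, e_i . nabla_c psi> costs a curvature
  term \<open>RT\<close>, and skewness of Clifford multiplication leaves -2/3 of \<open>Z\<close>.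
  By pair symmetry the tension equation contributes \<open>- RT - 1/6 * NR\<close>, and what remains
  is exactly the derivative of half the trace of A. No normal coordinates are used: in a fixed chart
  the Koszul formula replaces the index expression of the Christoffel symbols, and all tensors
  become multilinear forms on coordinate vectors. The cutoff test avoids boundary integrals over
  balls. Its price is a test function that is not differentiable on two spheres, which is harmless
  because a line meets a sphere in at most two points.\<close>

abbreviation fderiv :: "('a::real_normed_vector \<Rightarrow> 'b::real_normed_vector) \<Rightarrow> 'a \<Rightarrow> 'a \<Rightarrow> 'b" where
  "fderiv f x \<equiv> frechet_derivative f (at x)"

lemma fderiv_eqI:
  "(f has_derivative f') (at x) \<Longrightarrow> fderiv f x = f'"
  using frechet_derivative_at by metis

lemma has_fderiv:
  "f differentiable (at x) \<Longrightarrow> (f has_derivative fderiv f x) (at x)"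
  using frechet_derivative_works by blast

lemma fderiv_cong_open:
  assumes "open S" "x \<in> S" "\<And>y. y \<in> S \<Longrightarrow> f y = g y"
  shows "fderiv f x = fderiv g x"
proof -
  have "(f has_derivative f') (at x) \<longleftrightarrow> (g has_derivative f') (at x)" for f'
    using has_derivative_transform_within_open[OF _ assms(1,2)] assms(3) by metis
  then show ?thesis
    unfolding frechet_derivative_def by simp
qed

lemma differentiable_cong_open:
  assumes "open S" "x \<in> S" "\<And>y. y \<in> S \<Longrightarrow> f y = g y"
  shows "f differentiable (at x) \<longleftrightarrow> g differentiable (at x)"
proof -
  have "(f has_derivative f') (at x) \<longleftrightarrow> (g has_derivative f') (at x)" for f'
    using has_derivative_transform_within_open[OF _ assms(1,2)] assms(3) by metis
  then show ?thesis
    unfolding differentiable_def by simp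
qed

lemma Ck_on_cong:
  assumes "open S" "\<And>x. x \<in> S \<Longrightarrow> f x = g x"
  shows "Ck_on k f S = Ck_on k g S"
  using assms(2)
proof (induction k arbitrary: f g)
  case 0
  then show ?case by (simp cong: continuous_on_cong)
next
  case (Suc k)
  have "Ck_on k (\<lambda>x. fderiv f x v) S = Ck_on k (\<lambda>x. fderiv g x v) S" for v
  proof (rule Suc.IH)
    show "fderiv f x v = fderiv g x v" if "x \<in> S" for x
      by (subst fderiv_cong_open[OF assms(1) that Suc.prems]) simp_all
  qed
  then show ?case
    using differentiable_cong_open[OF assms(1) _ Suc.prems] by simp
qed

lemma Ck_on_subset: "Ck_on k f S \<Longrightarrow> T \<subseteq> S \<Longrightarrow> Ck_on k f T"
  by (induction k arbitrary: f) (auto intro: continuous_on_subset)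

lemma Ck_on_SucD: "Ck_on (Suc k) f S \<Longrightarrow> Ck_on k f S"
proof (induction k arbitrary: f)
  case 0
  then show ?case
    by (auto intro!: continuous_at_imp_continuous_on differentiable_imp_continuous_within)
next
  case (Suc k)
  then show ?case by simp
qed

text \<open>Derivatives are unique, so any explicit formula may stand in for
  \<open>frechet_derivative\<close>. Openness of S lets the equality of the two survive further
  differentiation.\<close>

lemma Ck_on_SucI:
  assumes "open S" "\<And>x. x \<in> S \<Longrightarrow> (f has_derivative f' x) (at x)"
    and "\<And>v. Ck_on k (\<lambda>x. f' x v) S"
  shows "Ck_on (Suc k) f S"
proof -
  have "Ck_on k (\<lambda>x. fderiv f x v) S" for v
    using Ck_on_cong[OF assms(1), of "\<lambda>x. fderiv f x v" "\<lambda>x. f' x v" k]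
      fderiv_eqI[OF assms(2)] assms(3) by simp
  then show ?thesis
    using assms(2) by (auto simp: differentiable_def)
qed

lemma Ck_on_const: "Ck_on k (\<lambda>x. c) S"
  by (induction k arbitrary: c) auto

lemma Ck_on_linear:
  assumes "open S" "bounded_linear L" "Ck_on k f S"
  shows "Ck_on k (\<lambda>x. L (f x)) S"
  using assms(3)
proof (induction k arbitrary: f)
  case 0
  then show ?case
    using bounded_linear.continuous_on[OF assms(2)] by auto
next
  case (Suc k)
  show ?case
    by (rule Ck_on_SucI[OF assms(1), where f' = "\<lambda>x v. L (fderiv f x v)"])
       (use Suc in \<open>auto intro!: bounded_linear.has_derivative[OF assms(2)] has_fderiv\<close>)
qed

lemma Ck_on_add:
  assumes "open S" "Ck_on k f S" "Ck_on k g S"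
  shows "Ck_on k (\<lambda>x. f x + g x) S"
  using assms(2,3)
proof (induction k arbitrary: f g)
  case 0
  then show ?case by (auto intro!: continuous_intros)
next
  case (Suc k)
  show ?case
    by (rule Ck_on_SucI[OF assms(1),
        where f' = "\<lambda>x v. fderiv f x v + fderiv g x v"])
       (use Suc in \<open>auto intro!: has_derivative_add has_fderiv\<close>)
qed

lemma Ck_on_bilinear:
  assumes "open S" "bounded_bilinear p" "Ck_on k f S" "Ck_on k g S"
  shows "Ck_on k (\<lambda>x. p (f x) (g x)) S"
  using assms(3,4)
proof (induction k arbitrary: f g)
  case 0
  then show ?case
    using bounded_bilinear.continuous_on[OF assms(2)] by auto
next
  case (Suc k)
  have "Ck_on k f S" "Ck_on k g S"
    using Suc.prems by (auto intro: Ck_on_SucD)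
  then show ?case
    by (intro Ck_on_SucI[OF assms(1), where f' =
        "\<lambda>x v. p (f x) (fderiv g x v) + p (fderiv f x v) (g x)"])
       (use Suc in \<open>auto intro!: bounded_bilinear.FDERIV[OF assms(2)] has_fderiv Ck_on_add assms\<close>)
qed

lemma Ck_on_sum:
  assumes "open S" "\<And>i. i \<in> I \<Longrightarrow> Ck_on k (f i) S"
  shows "Ck_on k (\<lambda>x. \<Sum>i\<in>I. f i x) S"
  using assms(2)
  by (induction I rule: infinite_finite_induct) (auto intro!: Ck_on_const Ck_on_add assms(1))

lemma Ck_on_prod:
  fixes f :: "'i \<Rightarrow> 'a::real_normed_vector \<Rightarrow> real"
  assumes "open S" "\<And>i. i \<in> I \<Longrightarrow> Ck_on k (f i) S"
  shows "Ck_on k (\<lambda>x. \<Prod>i\<in>I. f i x) S"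
  using assms(2)
  by (induction I rule: infinite_finite_induct)
     (auto intro!: Ck_on_const Ck_on_bilinear[OF _ bounded_bilinear_mult] assms(1))

lemma linear_eq_sum_Basis:
  fixes f :: "'b::euclidean_space \<Rightarrow> 'c::real_vector"
  assumes "linear f"
  shows "f w = (\<Sum>b\<in>Basis. (w \<bullet> b) *\<^sub>R f b)"
proof -
  have "f (\<Sum>b\<in>Basis. (w \<bullet> b) *\<^sub>R b) = (\<Sum>b\<in>Basis. (w \<bullet> b) *\<^sub>R f b)"
    by (simp add: linear_sum[OF assms] linear_cmul[OF assms])
  then show ?thesis by (simp add: euclidean_representation)
qed

text \<open>In the chain rule the direction \<open>fderiv g x v\<close> moves with x, whereas
  \<open>Ck_on\<close> differentiates in fixed directions. Expanding it in \<open>Basis\<close>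
  leaves sums of products with \<open>fderiv f (g x) b\<close>, and the induction hypothesis,
  general in f, covers these.\<close>

lemma Ck_on_compose:
  fixes f :: "'b::euclidean_space \<Rightarrow> 'c::real_normed_vector"
  assumes "open S" "open T" "g ` S \<subseteq> T" "Ck_on k g S" "Ck_on k f T"
  shows "Ck_on k (\<lambda>x. f (g x)) S"
  using assms(4,5)
proof (induction k arbitrary: f)
  case 0
  then show ?case
    using assms(3) by (auto intro: continuous_on_compose2)
next
  case (Suc k)
  have g: "Ck_on k g S"
    using Suc.prems by (auto intro: Ck_on_SucD)
  show ?case
  proof (rule Ck_on_SucI[OF assms(1)])
    fix x assume x: "x \<in> S"
    then have "g x \<in> T" using assms(3) by auto
    then have fd: "(f has_derivative fderiv f (g x)) (at (g x))"
      and gd: "(g has_derivative fderiv g x) (at x)"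
      using Suc.prems x by (auto intro!: has_fderiv)
    have lin: "linear (fderiv f (g x))"
      using fd has_derivative_linear by blast
    have "((\<lambda>x. f (g x)) has_derivative (\<lambda>v. fderiv f (g x) (fderiv g x v))) (at x)"
      using diff_chain_at[OF gd fd] by (simp add: o_def)
    then show "((\<lambda>x. f (g x)) has_derivative
        (\<lambda>v. \<Sum>b\<in>Basis. (fderiv g x v \<bullet> b) *\<^sub>R fderiv f (g x) b)) (at x)"
      by (rule has_derivative_eq_rhs) (rule ext, rule linear_eq_sum_Basis[OF lin])
  next
    fix v
    show "Ck_on k (\<lambda>x. \<Sum>b\<in>Basis. (fderiv g x v \<bullet> b) *\<^sub>R fderiv f (g x) b) S"
    proof (intro Ck_on_sum[OF assms(1)] Ck_on_bilinear[OF assms(1) bounded_bilinear_scaleR])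
      fix b :: 'b assume "b \<in> Basis"
      show "Ck_on k (\<lambda>x. fderiv g x v \<bullet> b) S"
        using Suc.prems by (intro Ck_on_linear[OF assms(1) bounded_linear_inner_left]) simp
      show "Ck_on k (\<lambda>x. fderiv f (g x) b) S"
        using Suc.prems g by (intro Suc.IH) auto
    qed
  qed
qed

text \<open>The derivative is again a product of \<open>inverse (f x)\<close> and a derivative of f,
  so the order of smoothness rises by one at each induction step.\<close>

lemma Ck_on_inverse:
  fixes f :: "'a::real_normed_vector \<Rightarrow> real"
  assumes "open S" "Ck_on k f S" "\<And>x. x \<in> S \<Longrightarrow> f x \<noteq> 0"
  shows "Ck_on k (\<lambda>x. inverse (f x)) S"
  using assms(2)
proof (induction k)
  case 0
  then show ?case using assms(3) by (auto intro!: continuous_intros)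
next
  case (Suc k)
  have f: "Ck_on k (\<lambda>x. inverse (f x)) S"
    by (rule Suc.IH[OF Ck_on_SucD[OF Suc.prems]])
  show ?case
  proof (rule Ck_on_SucI[OF assms(1)])
    fix x assume "x \<in> S"
    then show "((\<lambda>x. inverse (f x)) has_derivative
       (\<lambda>v. - (inverse (f x) * fderiv f x v * inverse (f x)))) (at x)"
      using Suc.prems by (intro Deriv.has_derivative_inverse assms(3) has_fderiv) auto
  next
    fix v
    show "Ck_on k (\<lambda>x. - (inverse (f x) * fderiv f x v * inverse (f x))) S"
      using Suc.prems f
      by (intro Ck_on_linear[OF assms(1), where L = uminus]
         Ck_on_bilinear[OF assms(1) bounded_bilinear_mult] bounded_linear_minus bounded_linear_ident) auto
  qed
qed

lemma smooth_onD:
  assumes "smooth_on S f"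
  shows smooth_on_differentiable: "x \<in> S \<Longrightarrow> f differentiable (at x)"
    and smooth_on_has_derivative: "x \<in> S \<Longrightarrow> (f has_derivative fderiv f x) (at x)"
    and smooth_on_derivative: "smooth_on S (\<lambda>x. fderiv f x v)"
    and smooth_on_continuous: "continuous_on S f"
proof -
  have Ck: "Ck_on (Suc k) f S" "Ck_on k f S" for k using assms by (auto simp: smooth_on_def)
  show "x \<in> S \<Longrightarrow> f differentiable (at x)" using Ck(1)[of 0] by auto
  then show "x \<in> S \<Longrightarrow> (f has_derivative fderiv f x) (at x)"
    by (rule has_fderiv)
  show "smooth_on S (\<lambda>x. fderiv f x v)"
    using Ck(1) by (auto simp: smooth_on_def)
  show "continuous_on S f" using Ck(2)[of 0] by simp
qed

lemma smooth_on_cong: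
  assumes "open S" "\<And>x. x \<in> S \<Longrightarrow> f x = g x"
  shows "smooth_on S f = smooth_on S g"
  using Ck_on_cong[OF assms] by (simp add: smooth_on_def)

lemma smooth_on_subset: "smooth_on S f \<Longrightarrow> T \<subseteq> S \<Longrightarrow> smooth_on T f"
  unfolding smooth_on_def by (blast intro: Ck_on_subset)

lemma smooth_on_const [simp]: "smooth_on S (\<lambda>x. c)"
  by (simp add: smooth_on_def Ck_on_const)

lemma smooth_on_ident: "smooth_on S (\<lambda>x. x)"
proof -
  have "Ck_on k (\<lambda>x. x) S" for k
    by (cases k) (auto simp: Ck_on_const intro!: continuous_intros)
  then show ?thesis by (simp add: smooth_on_def)
qed

lemma smooth_on_linear:
  "open S \<Longrightarrow> bounded_linear L \<Longrightarrow> smooth_on S f \<Longrightarrow> smooth_on S (\<lambda>x. L (f x))"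
  by (simp add: smooth_on_def Ck_on_linear)

lemma smooth_on_add: "open S \<Longrightarrow> smooth_on S f \<Longrightarrow> smooth_on S g \<Longrightarrow> smooth_on S (\<lambda>x. f x + g x)"
  by (simp add: smooth_on_def Ck_on_add)

lemma smooth_on_minus: "open S \<Longrightarrow> smooth_on S f \<Longrightarrow> smooth_on S (\<lambda>x. - f x)"
  using smooth_on_linear[of S uminus f] bounded_linear_minus[OF bounded_linear_ident] by simp

lemma smooth_on_diff: "open S \<Longrightarrow> smooth_on S f \<Longrightarrow> smooth_on S g \<Longrightarrow> smooth_on S (\<lambda>x. f x - g x)"
  using smooth_on_add[OF _ _ smooth_on_minus] by force

lemma smooth_on_bilinear:
  "open S \<Longrightarrow> bounded_bilinear p \<Longrightarrow> smooth_on S f \<Longrightarrow> smooth_on S g \<Longrightarrow> smooth_on S (\<lambda>x. p (f x) (g x))"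
  by (simp add: smooth_on_def Ck_on_bilinear)

lemmas smooth_on_mult = smooth_on_bilinear[OF _ bounded_bilinear_mult]
lemmas smooth_on_scaleR = smooth_on_bilinear[OF _ bounded_bilinear_scaleR]
lemmas smooth_on_inner = smooth_on_bilinear[OF _ bounded_bilinear_inner]

lemma smooth_on_sum:
  "open S \<Longrightarrow> (\<And>i. i \<in> I \<Longrightarrow> smooth_on S (f i)) \<Longrightarrow> smooth_on S (\<lambda>x. \<Sum>i\<in>I. f i x)"
  by (simp add: smooth_on_def Ck_on_sum)

lemma smooth_on_prod:
  fixes f :: "'i \<Rightarrow> 'a::real_normed_vector \<Rightarrow> real"
  shows "open S \<Longrightarrow> (\<And>i. i \<in> I \<Longrightarrow> smooth_on S (f i)) \<Longrightarrow> smooth_on S (\<lambda>x. \<Prod>i\<in>I. f i x)"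
  by (simp add: smooth_on_def Ck_on_prod)

lemma smooth_on_compose:
  fixes f :: "'b::euclidean_space \<Rightarrow> 'c::real_normed_vector"
  shows "open S \<Longrightarrow> open T \<Longrightarrow> g ` S \<subseteq> T \<Longrightarrow> smooth_on S g \<Longrightarrow> smooth_on T f \<Longrightarrow> smooth_on S (\<lambda>x. f (g x))"
  by (simp add: smooth_on_def Ck_on_compose)

lemma smooth_on_inverse:
  fixes f :: "'a::real_normed_vector \<Rightarrow> real"
  shows "open S \<Longrightarrow> smooth_on S f \<Longrightarrow> (\<And>x. x \<in> S \<Longrightarrow> f x \<noteq> 0) \<Longrightarrow> smooth_on S (\<lambda>x. inverse (f x))"
  by (simp add: smooth_on_def Ck_on_inverse)

lemma smooth_on_nth: "open S \<Longrightarrow> smooth_on S f \<Longrightarrow> smooth_on S (\<lambda>x. f x $ i)"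
  by (rule smooth_on_linear[OF _ bounded_linear_vec_nth])

lemma smooth_on_vec_lambda:
  fixes f :: "'i::finite \<Rightarrow> 'a::real_normed_vector \<Rightarrow> 'b::euclidean_space"
  assumes "open S" "\<And>i. smooth_on S (f i)"
  shows "smooth_on S (\<lambda>x. \<chi> i. f i x)"
proof -
  have "bounded_linear (axis i :: 'b \<Rightarrow> 'b^'i)" for i
    by (intro linear_conv_bounded_linear[THEN iffD1] linearI) (auto simp: vec_eq_iff axis_def)
  then have "smooth_on S (\<lambda>x. \<Sum>i\<in>UNIV. axis i (f i x))"
    using assms by (auto intro!: smooth_on_sum smooth_on_linear[where L = "axis _"])
  moreover have "(\<Sum>i\<in>UNIV. axis i (f i x)) = (\<chi> i. f i x)" for x
    by (simp add: vec_eq_iff axis_def)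
  ultimately show ?thesis by simp
qed

section \<open>Inverses of matrix-valued functions\<close>

lemma matrix_mult_matrix_inv:
  fixes A :: "real^'m::finite^'m"
  assumes "det A \<noteq> 0"
  shows "A ** matrix_inv A = mat 1"
proof -
  have "\<exists>B. A ** B = mat 1 \<and> B ** A = mat 1"
    using assms by (simp add: invertible_det_nz[symmetric] invertible_def)
  from someI_ex[OF this] show ?thesis
    by (simp add: matrix_inv_def)
qed

text \<open>Cramer's rule: an entry of the inverse is a quotient of two determinants, and
  determinants are polynomials in the entries.\<close>

lemma smooth_on_matrix_inv:
  fixes A :: "'a::real_normed_vector \<Rightarrow> real^'m::finite^'m"
  assumes S: "open S" and A: "smooth_on S A" and nz: "\<And>x. x \<in> S \<Longrightarrow> det (A x) \<noteq> 0"
  shows "smooth_on S (\<lambda>x. matrix_inv (A x))"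
proof -
  have det: "smooth_on S (\<lambda>x. det (B x))" if "\<And>i j. smooth_on S (\<lambda>x. B x $ i $ j)"
    for B :: "'a \<Rightarrow> real^'m^'m"
    unfolding det_def
    by (intro smooth_on_sum smooth_on_mult smooth_on_prod smooth_on_const S that)
  define C where "C = (\<lambda>x i j. inverse (det (A x)) *
      det (\<chi> r l. if l = i then (axis j 1 :: real^'m) $ r else A x $ r $ l))"
  have "matrix_inv (A x) = (\<chi> i j. C x i j)" if x: "x \<in> S" for x
  proof -
    have inv: "A x ** matrix_inv (A x) = mat 1"
      using matrix_mult_matrix_inv[OF nz[OF x]] .
    have "matrix_inv (A x) $ i $ j = C x i j" for i j
    proof -
      have "A x *v (matrix_inv (A x) *v axis j 1) = axis j 1"
        by (simp add: matrix_vector_mul_assoc inv)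
      then have "(matrix_inv (A x) *v axis j 1) $ i = C x i j"
        unfolding cramer[OF nz[OF x]] by (simp add: C_def field_simps)
      then show ?thesis
        by (simp add: matrix_vector_mult_basis column_def)
    qed
    then show ?thesis by (simp add: vec_eq_iff)
  qed
  moreover have "smooth_on S (\<lambda>x. C x i j)" for i j
  proof -
    have "smooth_on S (\<lambda>x. det (\<chi> r l. if l = i then (axis j 1 :: real^'m) $ r else A x $ r $ l))"
    proof (rule det)
      show "smooth_on S (\<lambda>x. (\<chi> r l. if l = i then (axis j 1 :: real^'m) $ r else A x $ r $ l) $ r $ l)" for r l
        by (cases "l = i") (simp_all add: smooth_on_nth S A)
    qed
    then show ?thesis
      unfolding C_def using smooth_on_inverse[OF S det[OF smooth_on_nth[OF S smooth_on_nth[OF S A]]] nz]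
      by (auto intro!: smooth_on_mult S)
  qed
  then have "smooth_on S (\<lambda>x. \<chi> i j. C x i j)"
    by (intro smooth_on_vec_lambda S)
  ultimately show ?thesis
    by (simp add: smooth_on_cong[OF S, of "\<lambda>x. matrix_inv (A x)"])
qed

section \<open>Symmetry of second derivatives\<close>

lemma second_difference_mvt:
  fixes f :: "'a::real_normed_vector \<Rightarrow> real"
  assumes S: "open S" and f: "smooth_on S f" and r: "ball x r \<subseteq> S"
    and h: "0 < h" "h * (norm u + norm v) < r"
  obtains y where "dist y x \<le> h * (norm u + norm v)"
    and "f (x + h *\<^sub>R u + h *\<^sub>R v) - f (x + h *\<^sub>R u) - f (x + h *\<^sub>R v) + f x =
      h\<^sup>2 * fderiv (\<lambda>x. fderiv f x u) y v"
proof -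
  define Du where "Du = (\<lambda>x. fderiv f x u)"
  have near: "dist (x + s *\<^sub>R u + t *\<^sub>R v) x \<le> h * (norm u + norm v)"
    if "0 \<le> s" "s \<le> h" "0 \<le> t" "t \<le> h" for s t
  proof -
    have "norm (s *\<^sub>R u + t *\<^sub>R v) \<le> s * norm u + t * norm v"
      using norm_triangle_ineq[of "s *\<^sub>R u" "t *\<^sub>R v"] that by simp
    also have "\<dots> \<le> h * norm u + h * norm v"
      using that by (intro add_mono mult_right_mono) auto
    finally show ?thesis by (simp add: dist_norm add.assoc distrib_left)
  qed
  then have inS: "x + s *\<^sub>R u + t *\<^sub>R v \<in> S"
    if "0 \<le> s" "s \<le> h" "0 \<le> t" "t \<le> h" for s t
    using r h(2) that by (force simp: dist_commute)
  have d: "((\<lambda>s. g (x + s *\<^sub>R u + t *\<^sub>R v)) has_derivative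
        (\<lambda>c. c * fderiv g (x + s *\<^sub>R u + t *\<^sub>R v) u)) (at s within A)"
     "((\<lambda>t. g (x + s *\<^sub>R u + t *\<^sub>R v)) has_derivative
        (\<lambda>c. c * fderiv g (x + s *\<^sub>R u + t *\<^sub>R v) v)) (at t within A)"
    if st: "0 \<le> s" "s \<le> h" "0 \<le> t" "t \<le> h" and g: "smooth_on S g" for s t A and g :: "'a \<Rightarrow> real"
  proof -
    let ?p = "x + s *\<^sub>R u + t *\<^sub>R v"
    have gd: "(g has_derivative fderiv g ?p) (at ?p)"
      using smooth_on_has_derivative[OF g inS[OF st]] .
    have lin: "linear (fderiv g ?p)"
      using gd has_derivative_linear by blast
    have "((\<lambda>s. x + s *\<^sub>R u + t *\<^sub>R v) has_derivative (\<lambda>c. c *\<^sub>R u)) (at s within A)"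
      by (auto intro!: derivative_eq_intros)
    from has_derivative_compose[OF this gd]
    show "((\<lambda>s. g (x + s *\<^sub>R u + t *\<^sub>R v)) has_derivative
        (\<lambda>c. c * fderiv g ?p u)) (at s within A)"
      by (simp add: linear_cmul[OF lin])
    have "((\<lambda>t. x + s *\<^sub>R u + t *\<^sub>R v) has_derivative (\<lambda>c. c *\<^sub>R v)) (at t within A)"
      by (auto intro!: derivative_eq_intros)
    from has_derivative_compose[OF this gd]
    show "((\<lambda>t. g (x + s *\<^sub>R u + t *\<^sub>R v)) has_derivative
        (\<lambda>c. c * fderiv g ?p v)) (at t within A)"
      by (simp add: linear_cmul[OF lin])
  qed
  \<comment> \<open>Mean value theorem in s for the increment of f across the whole step in
    direction v; a second application, in t, then treats the increment of \<open>Du\<close>. The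
    zero multiples are written out so that every term has the shape covered by
    \<open>d\<close>.\<close>
  have "\<exists>s\<in>{0<..<h}. (f (x + h *\<^sub>R u + h *\<^sub>R v) - f (x + h *\<^sub>R u + 0 *\<^sub>R v)) -
      (f (x + 0 *\<^sub>R u + h *\<^sub>R v) - f (x + 0 *\<^sub>R u + 0 *\<^sub>R v)) =
      (\<lambda>c. c * Du (x + s *\<^sub>R u + h *\<^sub>R v) - c * Du (x + s *\<^sub>R u + 0 *\<^sub>R v)) (h - 0)"
    unfolding Du_def using h(1)
    by (intro mvt_simple[where f = "\<lambda>s. f (x + s *\<^sub>R u + h *\<^sub>R v) - f (x + s *\<^sub>R u + 0 *\<^sub>R v)"]
       has_derivative_diff d f) auto
  then obtain s where s: "0 < s" "s < h"
    and 1: "(f (x + h *\<^sub>R u + h *\<^sub>R v) - f (x + h *\<^sub>R u + 0 *\<^sub>R v)) -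
      (f (x + 0 *\<^sub>R u + h *\<^sub>R v) - f (x + 0 *\<^sub>R u + 0 *\<^sub>R v)) =
      h * Du (x + s *\<^sub>R u + h *\<^sub>R v) - h * Du (x + s *\<^sub>R u + 0 *\<^sub>R v)"
    by auto
  have "\<exists>t\<in>{0<..<h}. Du (x + s *\<^sub>R u + h *\<^sub>R v) - Du (x + s *\<^sub>R u + 0 *\<^sub>R v) =
      (\<lambda>c. c * fderiv Du (x + s *\<^sub>R u + t *\<^sub>R v) v) (h - 0)"
    using h(1) s smooth_on_derivative[OF f, of u]
    by (intro mvt_simple[where f = "\<lambda>t. Du (x + s *\<^sub>R u + t *\<^sub>R v)"] d(2)) (auto simp: Du_def)
  then obtain t where t: "0 < t" "t < h"
    and 2: "Du (x + s *\<^sub>R u + h *\<^sub>R v) - Du (x + s *\<^sub>R u + 0 *\<^sub>R v) =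
      h * fderiv Du (x + s *\<^sub>R u + t *\<^sub>R v) v"
    by auto
  show thesis
  proof
    show "dist (x + s *\<^sub>R u + t *\<^sub>R v) x \<le> h * (norm u + norm v)"
      using near s t by simp
    show "f (x + h *\<^sub>R u + h *\<^sub>R v) - f (x + h *\<^sub>R u) - f (x + h *\<^sub>R v) + f x =
      h\<^sup>2 * fderiv (\<lambda>x. fderiv f x u) (x + s *\<^sub>R u + t *\<^sub>R v) v"
      using 1 2 unfolding Du_def[symmetric]
      by (simp add: power2_eq_square right_diff_distrib[symmetric])
  qed
qed

text \<open>The second difference quotient \<open>D u v\<close> is symmetric in u and v. It equals a
  second derivative at a point that tends to x, so by continuity its limit is the second derivative
  at x taken in either order.\<close>

lemma fderiv_symmetric_real:
  fixes f :: "'a::real_normed_vector \<Rightarrow> real"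
  assumes S: "open S" and f: "smooth_on S f" and x: "x \<in> S"
  shows "fderiv (\<lambda>x. fderiv f x u) x v =
         fderiv (\<lambda>x. fderiv f x v) x u"
proof -
  define F where "F u v y = fderiv (\<lambda>x. fderiv f x u) y v" for u v y
  define h where "h n = inverse (real (Suc n))" for n
  define D where "D u v n = (f (x + h n *\<^sub>R u + h n *\<^sub>R v) - f (x + h n *\<^sub>R u) - f (x + h n *\<^sub>R v) + f x) / (h n)\<^sup>2"
    for u v n
  obtain r where r: "r > 0" "ball x r \<subseteq> S"
    using S x open_contains_ball by blast
  have hpos: "h n > 0" for n by (simp add: h_def)
  have h0: "h \<longlonglongrightarrow> 0" unfolding h_def by (rule LIMSEQ_inverse_real_of_nat)
  have lim: "D u v \<longlonglongrightarrow> F u v x" for u v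
  proof -
    have hl: "(\<lambda>n. h n * (norm u + norm v)) \<longlonglongrightarrow> 0"
      using tendsto_mult[OF h0 tendsto_const] by simp
    \<comment> \<open>With the smallness condition as a premise inside, a point exists for every n
      and a whole sequence can be chosen; the condition holds for almost all n.\<close>
    have "\<exists>y. h n * (norm u + norm v) < r \<longrightarrow>
        dist y x \<le> h n * (norm u + norm v) \<and> D u v n = F u v y" for n
    proof (cases "h n * (norm u + norm v) < r")
      case True
      from second_difference_mvt[OF S f r(2) hpos this] hpos[of n]
      show ?thesis unfolding D_def F_def by (metis nonzero_mult_div_cancel_left power_not_zero less_irrefl)
    qed auto
    then obtain y where y: "\<And>n. h n * (norm u + norm v) < r \<Longrightarrow>
        dist (y n) x \<le> h n * (norm u + norm v) \<and> D u v n = F u v (y n)"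
      by metis
    have ev: "\<forall>\<^sub>F n in sequentially. h n * (norm u + norm v) < r"
      using order_tendstoD(2)[OF hl r(1)] .
    have "(\<lambda>n. dist (y n) x) \<longlonglongrightarrow> 0"
      by (rule tendsto_sandwich[OF _ _ tendsto_const hl]) (use ev y in \<open>auto elim!: eventually_mono\<close>)
    then have "y \<longlonglongrightarrow> x" by (rule tendsto_dist_iff[THEN iffD2])
    moreover have "isCont (F u v) x"
      using smooth_on_continuous[OF smooth_on_derivative[OF smooth_on_derivative[OF f, of u], of v]]
        continuous_on_eq_continuous_at[OF S] x by (auto simp: F_def[abs_def])
    ultimately have "(\<lambda>n. F u v (y n)) \<longlonglongrightarrow> F u v x"
      by (rule isCont_tendsto_compose[rotated])
    then show ?thesis
      by (rule Lim_transform_eventually) (use ev y in \<open>auto elim!: eventually_mono\<close>)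
  qed
  have "D u v = D v u"
    unfolding D_def by (auto simp: add_ac)
  then show ?thesis
    using LIMSEQ_unique[OF lim[of u v]] lim[of v u] unfolding F_def by metis
qed

lemma fderiv_linear:
  assumes "bounded_linear L" "f differentiable (at x)"
  shows "fderiv (\<lambda>x. L (f x)) x v = L (fderiv f x v)"
  using fderiv_eqI[OF bounded_linear.has_derivative[OF assms(1) has_fderiv[OF assms(2)]]]
  by simp

lemma fderiv_symmetric:
  fixes f :: "'a::real_normed_vector \<Rightarrow> 'b::euclidean_space"
  assumes S: "open S" and f: "smooth_on S f" and x: "x \<in> S"
  shows "fderiv (\<lambda>x. fderiv f x u) x v =
         fderiv (\<lambda>x. fderiv f x v) x u"
proof (rule euclidean_eqI)
  fix b :: 'b assume "b \<in> Basis"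
  define g where "g = (\<lambda>x. f x \<bullet> b)"
  have L: "bounded_linear (\<lambda>y. y \<bullet> b)" by (rule bounded_linear_inner_left)
  have g: "smooth_on S g" unfolding g_def by (rule smooth_on_linear[OF S L f])
  have 1: "fderiv g y w = fderiv f y w \<bullet> b" if "y \<in> S" for y w
    unfolding g_def by (rule fderiv_linear[OF L smooth_on_differentiable[OF f that]])
  have 2: "fderiv (\<lambda>x. fderiv g x w) x z =
      fderiv (\<lambda>x. fderiv f x w) x z \<bullet> b" for w z
    by (subst fderiv_cong_open[OF S x, where g = "\<lambda>x. fderiv f x w \<bullet> b"])
       (use 1 in \<open>auto intro!: fderiv_linear[OF L] smooth_on_differentiable[OF smooth_on_derivative[OF f] x]\<close>)
  show "fderiv (\<lambda>x. fderiv f x u) x v \<bullet> b =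
        fderiv (\<lambda>x. fderiv f x v) x u \<bullet> b"
    using fderiv_symmetric_real[OF S g x, of u v] unfolding 2 .
qed

section \<open>The Levi-Civita connection in a chart\<close>

lemma linear_eq_axis:
  fixes f g :: "real^'m::finite \<Rightarrow> 'b::real_vector"
  assumes "linear f" "linear g" "\<And>i. f (axis i 1) = g (axis i 1)"
  shows "f x = g x"
proof -
  have "f b = g b" if "b \<in> Basis" for b
    using that assms(3) by (auto simp: Basis_vec_def)
  then show ?thesis
    using linear_eq_stdbasis[OF assms(1,2)] by simp
qed

lemma linear_axis_sum:
  fixes f :: "real^'m::finite \<Rightarrow> 'b::real_vector"
  assumes "linear f"
  shows "f x = (\<Sum>i\<in>UNIV. x $ i *\<^sub>R f (axis i 1))"
proof -
  have "x = (\<Sum>i\<in>UNIV. x $ i *\<^sub>R axis i 1)"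
    by (simp add: vec_eq_iff axis_def if_distrib cong: if_cong)
  then have "f x = f (\<Sum>i\<in>UNIV. x $ i *\<^sub>R axis i 1)" by simp
  then show ?thesis
    by (simp add: linear_sum[OF assms] linear_cmul[OF assms])
qed

text \<open>Only the partial maps with a fixed argument X are known to be differentiable. Expanding
  V in \<open>Basis\<close> reduces the claim to a sum of ordinary products. Since
  \<open>T z\<close> is linear for z in A only, the expansion is valid merely near x.\<close>

lemma has_derivative_linear_field:
  fixes T :: "'y::real_normed_vector \<Rightarrow> 'a::euclidean_space \<Rightarrow> 'b::real_normed_vector"
  assumes f: "(f has_derivative f') (at x)" and V: "(V has_derivative V') (at x)"
    and lin: "\<And>z. z \<in> A \<Longrightarrow> linear (T z)" and A: "open A" "f x \<in> A"
    and T: "\<And>X. (\<lambda>z. T z X) differentiable at (f x)"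
  shows "((\<lambda>x. T (f x) (V x)) has_derivative
    (\<lambda>v. fderiv (\<lambda>z. T z (V x)) (f x) (f' v) + T (f x) (V' v))) (at x)"
proof -
  have rep: "(\<Sum>b\<in>Basis. (X \<bullet> b) *\<^sub>R T z b) = T z X" if "z \<in> A" for z X
    using linear_eq_sum_Basis[OF lin[OF that], of X] by (rule sym)
  have fc: "isCont f x" using has_derivative_continuous[OF f] .
  have "\<forall>\<^sub>F x' in at x. f x' \<in> A"
    using topological_tendstoD[OF fc[unfolded isCont_def] A] .
  then have ev: "\<forall>\<^sub>F x' in at x. (\<Sum>b\<in>Basis. (V x' \<bullet> b) *\<^sub>R T (f x') b) = T (f x') (V x')"
    by eventually_elim (rule rep)
  have 1: "((\<lambda>x. T (f x) b) has_derivative (\<lambda>v. fderiv (\<lambda>z. T z b) (f x) (f' v))) (at x)" for b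
    using has_derivative_compose[OF f has_fderiv[OF T]] .
  have 2: "((\<lambda>z. \<Sum>b\<in>Basis. (X \<bullet> b) *\<^sub>R T z b) has_derivative
      (\<lambda>w. \<Sum>b\<in>Basis. (X \<bullet> b) *\<^sub>R fderiv (\<lambda>z. T z b) (f x) w)) (at (f x))" for X
    by (intro has_derivative_sum has_derivative_scaleR_right has_fderiv T)
  have 3: "(\<Sum>b\<in>Basis. (X \<bullet> b) *\<^sub>R fderiv (\<lambda>z. T z b) (f x) w) =
      fderiv (\<lambda>z. T z X) (f x) w" for X w
    by (subst fderiv_cong_open[OF A, where f = "\<lambda>z. T z X"], rule rep[symmetric], assumption)
       (simp add: fderiv_eqI[OF 2])
  have "((\<lambda>x. \<Sum>b\<in>Basis. (V x \<bullet> b) *\<^sub>R T (f x) b) has_derivative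
     (\<lambda>v. \<Sum>b\<in>Basis. (V x \<bullet> b) *\<^sub>R fderiv (\<lambda>z. T z b) (f x) (f' v) + (V' v \<bullet> b) *\<^sub>R T (f x) b)) (at x)"
    by (intro has_derivative_sum has_derivative_scaleR 1 has_derivative_inner_left V)
  then have "((\<lambda>x. T (f x) (V x)) has_derivative
     (\<lambda>v. \<Sum>b\<in>Basis. (V x \<bullet> b) *\<^sub>R fderiv (\<lambda>z. T z b) (f x) (f' v) + (V' v \<bullet> b) *\<^sub>R T (f x) b)) (at x)"
    by (rule has_derivative_transform_eventually[OF _ ev]) (simp_all add: rep[OF A(2)])
  then show ?thesis
    by (simp add: sum.distrib 3 rep[OF A(2)])
qed

text \<open>Two uses of the linear case: first V moves while the other slot is frozen, then
  \<open>T (f x) (V x)\<close> is regarded as a field of linear maps over x itself, with the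
  identity as base map.\<close>

lemma has_derivative_bilinear_field:
  fixes T :: "'y::real_normed_vector \<Rightarrow> 'a::euclidean_space \<Rightarrow> 'a \<Rightarrow> 'b::real_normed_vector"
  assumes f: "(f has_derivative f') (at x)" and V: "(V has_derivative V') (at x)"
    and W: "(W has_derivative W') (at x)" and S: "open S" "x \<in> S" "f ` S \<subseteq> A" and A: "open A"
    and lin: "\<And>z Y. z \<in> A \<Longrightarrow> linear (\<lambda>X. T z X Y)" "\<And>z X. z \<in> A \<Longrightarrow> linear (\<lambda>Y. T z X Y)"
    and T: "\<And>X Y. (\<lambda>z. T z X Y) differentiable at (f x)"
  shows "((\<lambda>x. T (f x) (V x) (W x)) has_derivative
    (\<lambda>v. fderiv (\<lambda>z. T z (V x) (W x)) (f x) (f' v)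
      + T (f x) (V' v) (W x) + T (f x) (V x) (W' v))) (at x)"
proof -
  have 1: "((\<lambda>x. T (f x) (V x) Y) has_derivative
    (\<lambda>v. fderiv (\<lambda>z. T z (V x) Y) (f x) (f' v) + T (f x) (V' v) Y)) (at x)" for Y
    using has_derivative_linear_field[OF f V, where T = "\<lambda>z X. T z X Y", OF lin(1) A _ T] S by blast
  show ?thesis
    using has_derivative_linear_field[OF has_derivative_ident W, where T = "\<lambda>x. T (f x) (V x)", OF lin(2) S(1,2)]
      1 S(3) fderiv_eqI[OF 1] by (auto simp: differentiable_def)
qed

lemma has_derivative_quadrilinear_field:
  fixes T :: "'y::real_normed_vector \<Rightarrow> 'a::euclidean_space \<Rightarrow> 'a \<Rightarrow> 'a \<Rightarrow> 'a \<Rightarrow> 'b::real_normed_vector"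
  assumes f: "(f has_derivative f') (at x)"
    and V: "(V1 has_derivative V1') (at x)" "(V2 has_derivative V2') (at x)"
      "(V3 has_derivative V3') (at x)" "(V4 has_derivative V4') (at x)"
    and S: "open S" "x \<in> S" "f ` S \<subseteq> A" and A: "open A"
    and lin: "\<And>z X Y Z. z \<in> A \<Longrightarrow> linear (\<lambda>W. T z W X Y Z)" "\<And>z X Y Z. z \<in> A \<Longrightarrow> linear (\<lambda>W. T z X W Y Z)"
      "\<And>z X Y Z. z \<in> A \<Longrightarrow> linear (\<lambda>W. T z X Y W Z)" "\<And>z X Y Z. z \<in> A \<Longrightarrow> linear (\<lambda>W. T z X Y Z W)"
    and T: "\<And>W X Y Z. (\<lambda>z. T z W X Y Z) differentiable at (f x)"
  shows "((\<lambda>x. T (f x) (V1 x) (V2 x) (V3 x) (V4 x)) has_derivative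
    (\<lambda>v. fderiv (\<lambda>z. T z (V1 x) (V2 x) (V3 x) (V4 x)) (f x) (f' v)
      + T (f x) (V1' v) (V2 x) (V3 x) (V4 x) + T (f x) (V1 x) (V2' v) (V3 x) (V4 x)
      + T (f x) (V1 x) (V2 x) (V3' v) (V4 x) + T (f x) (V1 x) (V2 x) (V3 x) (V4' v))) (at x)"
proof -
  have 1: "((\<lambda>x. T (f x) (V1 x) (V2 x) Y Z) has_derivative
    (\<lambda>v. fderiv (\<lambda>z. T z (V1 x) (V2 x) Y Z) (f x) (f' v)
      + T (f x) (V1' v) (V2 x) Y Z + T (f x) (V1 x) (V2' v) Y Z)) (at x)" for Y Z
    by (rule has_derivative_bilinear_field[OF f V(1,2) S A, where T = "\<lambda>z W X. T z W X Y Z"])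
       (simp_all add: lin T)
  have "((\<lambda>x. T (f x) (V1 x) (V2 x) (V3 x) (V4 x)) has_derivative
    (\<lambda>v. fderiv (\<lambda>z. T (f z) (V1 z) (V2 z) (V3 x) (V4 x)) x v
      + T (f x) (V1 x) (V2 x) (V3' v) (V4 x) + T (f x) (V1 x) (V2 x) (V3 x) (V4' v))) (at x)"
    by (rule has_derivative_bilinear_field[OF has_derivative_ident V(3,4) S(1,2) _ S(1),
        where T = "\<lambda>x. T (f x) (V1 x) (V2 x)"])
       (use lin(3,4) differentiableI[OF 1] S(3) in \<open>auto simp: image_subset_iff\<close>)
  then show ?thesis
    unfolding fderiv_eqI[OF 1] by (simp add: add_ac)
qed

lemma fderiv_linear_family:
  fixes T :: "'y::real_normed_vector \<Rightarrow> 'a::real_vector \<Rightarrow> 'b::real_normed_vector"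
  assumes A: "open A" "y \<in> A" and lin: "\<And>z. z \<in> A \<Longrightarrow> linear (T z)"
    and T: "\<And>X. (\<lambda>z. T z X) differentiable at y"
  shows "linear (\<lambda>X. fderiv (\<lambda>z. T z X) y u)"
proof (rule linearI)
  fix X X'
  have "fderiv (\<lambda>z. T z (X + X')) y = fderiv (\<lambda>z. T z X + T z X') y"
    by (rule fderiv_cong_open[OF A]) (simp add: linear_add[OF lin])
  then show "fderiv (\<lambda>z. T z (X + X')) y u =
      fderiv (\<lambda>z. T z X) y u + fderiv (\<lambda>z. T z X') y u"
    by (simp add: fderiv_eqI[OF has_derivative_add[OF has_fderiv[OF T] has_fderiv[OF T]]])
next
  fix r X
  have "fderiv (\<lambda>z. T z (r *\<^sub>R X)) y = fderiv (\<lambda>z. r *\<^sub>R T z X) y"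
    by (rule fderiv_cong_open[OF A]) (simp add: linear_cmul[OF lin])
  then show "fderiv (\<lambda>z. T z (r *\<^sub>R X)) y u = r *\<^sub>R fderiv (\<lambda>z. T z X) y u"
    by (simp add: fderiv_eqI[OF has_derivative_scaleR_right[OF has_fderiv[OF T]]])
qed

text \<open>The coordinate-free counterparts of the index expressions for a metric \<open>h\<close> given in a chart:
  $h(X,Y)$, $(\partial_uh)(X,Y)$, $\Gamma(X,Y)$ and $(\partial_u\Gamma)(X,Y)$. Here \<open>Rform h y X Y Z W\<close> is
  $h(R(X,Y)W,Z)$, in the index order of \<open>riem\<close>.\<close>

definition hform :: "(real^'m \<Rightarrow> real^'m^'m) \<Rightarrow> real^'m \<Rightarrow> real^'m \<Rightarrow> real^'m::finite \<Rightarrow> real" where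
  "hform h y X Y = X \<bullet> (h y *v Y)"

definition dform :: "(real^'m \<Rightarrow> real^'m^'m) \<Rightarrow> real^'m \<Rightarrow> real^'m \<Rightarrow> real^'m \<Rightarrow> real^'m::finite \<Rightarrow> real" where
  "dform h y u X Y = X \<bullet> (fderiv h y u *v Y)"

definition chr :: "(real^'m \<Rightarrow> real^'m^'m) \<Rightarrow> real^'m \<Rightarrow> real^'m \<Rightarrow> real^'m \<Rightarrow> real^'m::finite" where
  "chr h y X Y = (\<chi> a. \<Sum>b\<in>UNIV. \<Sum>d\<in>UNIV. christoffel h y a b d * X $ b * Y $ d)"

definition dchr :: "(real^'m \<Rightarrow> real^'m^'m) \<Rightarrow> real^'m \<Rightarrow> real^'m \<Rightarrow> real^'m \<Rightarrow> real^'m \<Rightarrow> real^'m::finite" where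
  "dchr h y u X Y = fderiv (\<lambda>z. chr h z X Y) y u"

definition Rop :: "(real^'m \<Rightarrow> real^'m^'m) \<Rightarrow> real^'m \<Rightarrow> real^'m \<Rightarrow> real^'m \<Rightarrow> real^'m \<Rightarrow> real^'m::finite" where
  "Rop h y X Y Z = dchr h y X Y Z - dchr h y Y X Z + chr h y X (chr h y Y Z) - chr h y Y (chr h y X Z)"

definition Rform :: "(real^'m \<Rightarrow> real^'m^'m) \<Rightarrow> real^'m \<Rightarrow> real^'m \<Rightarrow> real^'m \<Rightarrow> real^'m \<Rightarrow> real^'m::finite \<Rightarrow> real" where
  "Rform h y X Y Z W = hform h y Z (Rop h y X Y W)"

definition nabla_Rform ::
    "(real^'m \<Rightarrow> real^'m^'m) \<Rightarrow> real^'m \<Rightarrow> real^'m \<Rightarrow> real^'m \<Rightarrow> real^'m \<Rightarrow> real^'m \<Rightarrow> real^'m::finite \<Rightarrow> real" where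
  "nabla_Rform h y u X Y Z W = fderiv (\<lambda>z. Rform h z X Y Z W) y u
     - Rform h y (chr h y u X) Y Z W - Rform h y X (chr h y u Y) Z W
     - Rform h y X Y (chr h y u Z) W - Rform h y X Y Z (chr h y u W)"

lemma hform_linear:
  "hform h y (X + X') Y = hform h y X Y + hform h y X' Y"
  "hform h y X (Y + Y') = hform h y X Y + hform h y X Y'"
  "hform h y (X - X') Y = hform h y X Y - hform h y X' Y"
  "hform h y X (Y - Y') = hform h y X Y - hform h y X Y'"
  "hform h y (c *\<^sub>R X) Y = c * hform h y X Y"
  "hform h y X (c *\<^sub>R Y) = c * hform h y X Y"
  by (simp_all add: hform_def inner_add_left inner_add_right inner_diff_left inner_diff_right
      matrix_vector_right_distrib matrix_vector_mult_diff_distrib matrix_vector_mult_scaleR)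

lemma chr_linear:
  "chr h y (X + X') Y = chr h y X Y + chr h y X' Y"
  "chr h y X (Y + Y') = chr h y X Y + chr h y X Y'"
  "chr h y (c *\<^sub>R X) Y = c *\<^sub>R chr h y X Y"
  "chr h y X (c *\<^sub>R Y) = c *\<^sub>R chr h y X Y"
  by (simp_all add: chr_def vec_eq_iff algebra_simps sum.distrib sum_distrib_left)

lemma linear_hform: "linear (hform h y X)" "linear (\<lambda>X. hform h y X Y)"
  by (auto intro!: linearI simp: hform_linear)

lemma linear_chr: "linear (chr h y X)" "linear (\<lambda>X. chr h y X Y)"
  by (auto intro!: linearI simp: chr_linear)

lemma chr_axis: "chr h y (axis b 1) (axis d 1) = (\<chi> a. christoffel h y a b d)"
proof -
  have "(\<Sum>b'\<in>UNIV. \<Sum>d'\<in>UNIV. christoffel h y a b' d' * axis b 1 $ b' * axis d 1 $ d') =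
     (\<Sum>b'\<in>UNIV. \<Sum>d'\<in>UNIV. if d' = d then (if b' = b then christoffel h y a b' d' else 0) else 0)" for a
    by (intro sum.cong refl) (auto simp: axis_def)
  then show ?thesis by (simp add: chr_def)
qed

lemma hform_axis: "hform h y (axis c 1) W = (\<Sum>e\<in>UNIV. h y $ c $ e * W $ e)"
  by (simp add: hform_def inner_axis' matrix_vector_mult_def)

section \<open>Connection and curvature of a metric on one coordinate domain\<close>

locale chart_metric =
  fixes U :: "(real^'m::finite) set" and h :: "real^'m \<Rightarrow> real^'m^'m"
  assumes open_U: "open U" and smooth_metric: "smooth_on U h"
    and metric_sym: "\<And>y. y \<in> U \<Longrightarrow> transpose (h y) = h y"
    and metric_pos: "\<And>y v. y \<in> U \<Longrightarrow> v \<noteq> 0 \<Longrightarrow> v \<bullet> (h y *v v) > 0"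
begin

lemma det_metric: assumes "y \<in> U" shows "det (h y) \<noteq> 0"
proof -
  have "x = 0" if "h y *v x = 0" for x
    using metric_pos[OF assms, of x] that by force
  then show ?thesis
    using invertible_det_nz[of "h y"] matrix_left_invertible_ker[of "h y"] invertible_left_inverse[of "h y"]
    by blast
qed

lemma hform_sym: "y \<in> U \<Longrightarrow> hform h y X Y = hform h y Y X"
  using metric_sym[of y] by (metis hform_def dot_lmul_matrix inner_commute transpose_matrix_vector)

lemma hform_nondegenerate:
  assumes "y \<in> U" "\<And>Z. hform h y Z X = hform h y Z Y" shows "X = Y"
proof (rule ccontr)
  assume "X \<noteq> Y"
  then have "hform h y (X - Y) (X - Y) > 0"
    using metric_pos[OF assms(1), of "X - Y"] by (simp add: hform_def)
  moreover have "hform h y (X - Y) (X - Y) = 0"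
    using assms(2)[of "X - Y"] by (simp add: hform_linear(4))
  ultimately show False by simp
qed

lemma hform_eq_sum: "hform h y X Y = (\<Sum>a\<in>UNIV. \<Sum>b\<in>UNIV. X $ a * (h y $ a $ b * Y $ b))"
  by (simp add: hform_def inner_vec_def matrix_vector_mult_def sum_distrib_left)

lemma hform_has_derivative:
  assumes "y \<in> U"
  shows "((\<lambda>z. hform h z X Y) has_derivative (\<lambda>u. dform h y u X Y)) (at y)"
proof -
  have "bounded_linear (\<lambda>A::real^'m^'m. X \<bullet> (A *v Y))"
    by (intro linear_conv_bounded_linear[THEN iffD1] linearI)
       (simp_all add: matrix_vector_mult_add_rdistrib inner_add_right scaleR_matrix_vector_assoc[symmetric])
  then show ?thesis
    unfolding hform_def dform_def
    by (rule bounded_linear.has_derivative) (rule smooth_on_has_derivative[OF smooth_metric assms])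
qed

lemma smooth_on_metric_nth: "smooth_on U (\<lambda>z. h z $ a $ b)"
  by (intro smooth_on_nth open_U smooth_metric)

lemma smooth_hform: "smooth_on U (\<lambda>z. hform h z X Y)"
  unfolding hform_eq_sum
  by (intro smooth_on_sum smooth_on_mult smooth_on_const smooth_on_metric_nth open_U)

lemma dform_eq: "y \<in> U \<Longrightarrow> fderiv (\<lambda>z. hform h z X Y) y u = dform h y u X Y"
  by (simp add: fderiv_eqI[OF hform_has_derivative])

lemma dform_linear:
  assumes "y \<in> U"
  shows "linear (\<lambda>u. dform h y u X Y)" "linear (\<lambda>X. dform h y u X Y)" "linear (\<lambda>Y. dform h y u X Y)"
proof -
  show "linear (\<lambda>u. dform h y u X Y)"
    using has_derivative_linear[OF hform_has_derivative[OF assms]] .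
qed (auto intro!: linearI simp: dform_def inner_add_left matrix_vector_right_distrib inner_add_right
      matrix_vector_mult_scaleR)

lemma dform_sym:
  assumes "y \<in> U" shows "dform h y u X Y = dform h y u Y X"
  unfolding dform_eq[OF assms, symmetric]
  by (subst fderiv_cong_open[OF open_U assms, where g = "\<lambda>z. hform h z Y X"])
     (auto simp: hform_sym)

lemma pderiv_metric: assumes "y \<in> U" shows "pderiv_at v (\<lambda>z. h z $ c $ d) y = dform h y (axis v 1) (axis c 1) (axis d 1)"
proof -
  have "hform h z (axis c 1) (axis d 1) = h z $ c $ d" for z
    unfolding hform_axis by (simp add: axis_def if_distrib cong: if_cong)
  then show ?thesis
    unfolding pderiv_at_def dform_eq[OF assms, symmetric] by simp
qed

text \<open>On coordinate vectors this is the definition of the Christoffel symbols after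
  multiplication by h, which removes the inverse metric. The general case follows by linearity in Y,
  then in X, then in Z.\<close>

lemma koszul:
  assumes y: "y \<in> U"
  shows "hform h y Z (chr h y X Y) = 1/2 * (dform h y X Y Z + dform h y Y X Z - dform h y Z X Y)"
proof -
  note lin = linear_add[OF dform_linear(1)[OF y]] linear_add[OF dform_linear(2)[OF y]]
    linear_add[OF dform_linear(3)[OF y]] linear_cmul[OF dform_linear(1)[OF y]]
    linear_cmul[OF dform_linear(2)[OF y]] linear_cmul[OF dform_linear(3)[OF y]]
  have axis: "hform h y (axis c 1) (chr h y (axis b 1) (axis d 1)) =
     1/2 * (dform h y (axis b 1) (axis d 1) (axis c 1) + dform h y (axis d 1) (axis b 1) (axis c 1)
        - dform h y (axis c 1) (axis b 1) (axis d 1))" for b c d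
  proof -
    define q where "q e = 1/2 * (dform h y (axis b 1) (axis d 1) (axis e 1)
       + dform h y (axis d 1) (axis b 1) (axis e 1) - dform h y (axis e 1) (axis b 1) (axis d 1))" for e
    have "chr h y (axis b 1) (axis d 1) = matrix_inv (h y) *v (\<chi> e. q e)"
      by (simp add: chr_axis christoffel_def pderiv_metric[OF y] q_def vec_eq_iff
          matrix_vector_mult_def sum_distrib_left mult.left_commute)
    then have "h y *v chr h y (axis b 1) (axis d 1) = (\<chi> e. q e)"
      by (simp add: matrix_vector_mul_assoc matrix_mult_matrix_inv[OF det_metric[OF y]])
    then show ?thesis by (simp add: hform_def inner_axis' q_def)
  qed
  have 1: "hform h y (axis c 1) (chr h y (axis b 1) Y) =
     1/2 * (dform h y (axis b 1) Y (axis c 1) + dform h y Y (axis b 1) (axis c 1)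
        - dform h y (axis c 1) (axis b 1) Y)" for b c
    by (rule linear_eq_axis[of "\<lambda>Y. hform h y (axis c 1) (chr h y (axis b 1) Y)"])
       (auto intro!: linearI simp: axis lin chr_linear hform_linear field_simps)
  have 2: "hform h y (axis c 1) (chr h y X Y) =
     1/2 * (dform h y X Y (axis c 1) + dform h y Y X (axis c 1) - dform h y (axis c 1) X Y)" for c
    by (rule linear_eq_axis[of "\<lambda>X. hform h y (axis c 1) (chr h y X Y)"])
       (auto intro!: linearI simp: 1 lin chr_linear hform_linear field_simps)
  show ?thesis
    by (rule linear_eq_axis[of "\<lambda>Z. hform h y Z (chr h y X Y)"])
       (auto intro!: linearI simp: 2 lin hform_linear field_simps)
qed

lemma chr_sym:
  assumes y: "y \<in> U" shows "chr h y X Y = chr h y Y X"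
  using hform_nondegenerate[OF y] koszul[OF y] dform_sym[OF y] by (metis add.commute)

text \<open>Metric compatibility: in the sum of the two Koszul formulas the derivatives in the
  directions X and Y cancel by symmetry of h.\<close>

lemma dform_compat:
  assumes y: "y \<in> U"
  shows "dform h y u X Y = hform h y (chr h y u X) Y + hform h y X (chr h y u Y)"
  unfolding hform_sym[OF y, of "chr h y u X"] koszul[OF y]
  using dform_sym[OF y] by (simp add: field_simps)

lemma smooth_christoffel: "smooth_on U (\<lambda>z. christoffel h z a b d)"
proof -
  have [intro]: "smooth_on U (\<lambda>z. matrix_inv (h z) $ a $ b)" for a b
    by (intro smooth_on_nth smooth_on_matrix_inv open_U smooth_metric det_metric)
  have [intro]: "smooth_on U (pderiv_at b (\<lambda>z. h z $ c $ d))" for b c d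
    unfolding pderiv_at_def by (intro smooth_on_derivative smooth_on_metric_nth)
  show ?thesis
    unfolding christoffel_def
    by (intro smooth_on_mult smooth_on_sum smooth_on_const smooth_on_add smooth_on_diff open_U) auto
qed

lemma smooth_chr: "smooth_on U (\<lambda>z. chr h z X Y)"
  unfolding chr_def
  by (intro smooth_on_vec_lambda smooth_on_sum smooth_on_mult smooth_on_const smooth_christoffel open_U)

lemma chr_has_derivative:
  "y \<in> U \<Longrightarrow> ((\<lambda>z. chr h z X Y) has_derivative (\<lambda>u. dchr h y u X Y)) (at y)"
  unfolding dchr_def by (rule smooth_on_has_derivative[OF smooth_chr])

lemma dchr_linear:
  assumes y: "y \<in> U"
  shows "linear (\<lambda>u. dchr h y u X Y)" "linear (\<lambda>X. dchr h y u X Y)" "linear (\<lambda>Y. dchr h y u X Y)"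
  unfolding dchr_def
  by (rule linear_frechet_derivative[OF smooth_on_differentiable[OF smooth_chr y]]
      fderiv_linear_family[OF open_U y linear_chr(1) smooth_on_differentiable[OF smooth_chr y]]
      fderiv_linear_family[OF open_U y linear_chr(2) smooth_on_differentiable[OF smooth_chr y]])+

lemma dchr_sym:
  assumes "y \<in> U" shows "dchr h y u X Y = dchr h y u Y X"
  unfolding dchr_def
  by (subst fderiv_cong_open[OF open_U assms, where g = "\<lambda>z. chr h z Y X"])
     (auto simp: chr_sym)

lemma linear_Rop:
  assumes y: "y \<in> U"
  shows "linear (\<lambda>X. Rop h y X Y Z)" "linear (\<lambda>Y. Rop h y X Y Z)" "linear (\<lambda>Z. Rop h y X Y Z)"
  unfolding Rop_def
  using linear_add[OF dchr_linear(1)[OF y]] linear_add[OF dchr_linear(2)[OF y]]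
    linear_add[OF dchr_linear(3)[OF y]] linear_cmul[OF dchr_linear(1)[OF y]]
    linear_cmul[OF dchr_linear(2)[OF y]] linear_cmul[OF dchr_linear(3)[OF y]]
  by (auto intro!: linearI simp: chr_linear algebra_simps)

lemma linear_Rform:
  assumes y: "y \<in> U"
  shows "linear (\<lambda>A. Rform h y A B C D)" "linear (\<lambda>B. Rform h y A B C D)"
    "linear (\<lambda>C. Rform h y A B C D)" "linear (\<lambda>D. Rform h y A B C D)"
  unfolding Rform_def
  using linear_add[OF linear_Rop(1)[OF y]] linear_add[OF linear_Rop(2)[OF y]]
    linear_add[OF linear_Rop(3)[OF y]] linear_cmul[OF linear_Rop(1)[OF y]]
    linear_cmul[OF linear_Rop(2)[OF y]] linear_cmul[OF linear_Rop(3)[OF y]]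
  by (auto intro!: linearI simp: hform_linear)

lemma Rform_antisym12: "Rform h y B A C D = - Rform h y A B C D"
proof -
  have "hform h y C (Rop h y B A D) = hform h y C ((- 1) *\<^sub>R Rop h y A B D)"
    by (simp add: Rop_def algebra_simps)
  then show ?thesis unfolding Rform_def hform_linear(6) by simp
qed

text \<open>In the cyclic sum of \<open>Rop\<close> the terms cancel in pairs, because the
  Christoffel map and its derivatives are symmetric in the last two arguments.\<close>

lemma Rform_bianchi:
  assumes y: "y \<in> U"
  shows "Rform h y A B C D + Rform h y B D C A + Rform h y D A C B = 0"
proof -
  have "Rop h y A B D + Rop h y B D A + Rop h y D A B = 0"
    by (simp add: Rop_def dchr_sym[OF y, of _ D] dchr_sym[OF y, of _ B A]
      chr_sym[OF y, of D] chr_sym[OF y, of B A])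
  then have "hform h y C (Rop h y A B D + Rop h y B D A + Rop h y D A B) = 0"
    by (simp add: hform_def)
  then show ?thesis unfolding Rform_def by (simp add: hform_linear)
qed

text \<open>Second derivatives of the function h(C,D), for constant C and D, commute. After
  expansion by metric compatibility the mixed terms are symmetric in the two directions, and what is
  left says that R(A,B) is skew for h.\<close>

lemma Rform_antisym34:
  assumes y: "y \<in> U"
  shows "Rform h y A B D C = - Rform h y A B C D"
proof -
  have d: "fderiv (\<lambda>z. fderiv (\<lambda>z. hform h z C D) z Y) y X =
      hform h y (chr h y X (chr h y Y C)) D + hform h y (chr h y Y C) (chr h y X D)
      + hform h y (dchr h y X Y C) D
      + (hform h y (chr h y X C) (chr h y Y D) + hform h y C (chr h y X (chr h y Y D))
      + hform h y C (dchr h y X Y D))" for X Y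
  proof -
    have id: "((\<lambda>z. z) has_derivative (\<lambda>v. v)) (at y)" by (rule has_derivative_ident)
    have 1: "((\<lambda>z. hform h z (chr h z Y C) D) has_derivative
       (\<lambda>v. dform h y v (chr h y Y C) D + hform h y (dchr h y v Y C) D)) (at y)"
      using has_derivative_linear_field[OF id chr_has_derivative[OF y],
          where T = "\<lambda>z W. hform h z W D", OF linear_hform(2) open_U y
            smooth_on_differentiable[OF smooth_hform y]] dform_eq[OF y] by simp
    have 2: "((\<lambda>z. hform h z C (chr h z Y D)) has_derivative
       (\<lambda>v. dform h y v C (chr h y Y D) + hform h y C (dchr h y v Y D))) (at y)"
      using has_derivative_linear_field[OF id chr_has_derivative[OF y],
          where T = "\<lambda>z W. hform h z C W", OF linear_hform(1) open_U y
            smooth_on_differentiable[OF smooth_hform y]] dform_eq[OF y] by simp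
    have "fderiv (\<lambda>z. fderiv (\<lambda>z. hform h z C D) z Y) y X =
      fderiv (\<lambda>z. hform h z (chr h z Y C) D + hform h z C (chr h z Y D)) y X"
      by (subst fderiv_cong_open[OF open_U y]) (auto simp: dform_eq dform_compat)
    then show ?thesis
      by (simp add: fderiv_eqI[OF has_derivative_add[OF 1 2]] dform_compat[OF y])
  qed
  have "Rform h y A B C D + hform h y (Rop h y A B C) D = 0"
    using fderiv_symmetric[OF open_U smooth_hform y, of C D B A]
    unfolding d Rform_def Rop_def by (simp add: hform_linear)
  then show ?thesis
    unfolding hform_sym[OF y, of "Rop h y A B C"] by (simp add: Rform_def)
qed

text \<open>Linear algebra in the values of R on permutations of A, B, C, D: the Bianchi identity
  for several arrangements, together with skewness in either pair, forces the symmetry.\<close>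

lemma Rform_pair_sym:
  assumes y: "y \<in> U"
  shows "Rform h y C D A B = Rform h y A B C D"
  using Rform_bianchi[OF y, of A B C D] Rform_bianchi[OF y, of B C A D]
    Rform_bianchi[OF y, of C D A B] Rform_bianchi[OF y, of D A B C]
    Rform_bianchi[OF y, of B C D A] Rform_bianchi[OF y, of D A C B]
    Rform_antisym12 Rform_antisym34[OF y]
  by (smt (verit, ccfv_threshold))

lemma smooth_dchr: "smooth_on U (\<lambda>z. dchr h z u X Y)"
  unfolding dchr_def by (rule smooth_on_derivative[OF smooth_chr])

lemma smooth_on_hform:
  assumes S: "open S" and f: "smooth_on S f" "f ` S \<subseteq> U" and V: "smooth_on S V" "smooth_on S W"
  shows "smooth_on S (\<lambda>x. hform h (f x) (V x) (W x))"
  unfolding hform_eq_sum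
  by (intro smooth_on_sum smooth_on_mult smooth_on_nth V S
      smooth_on_compose[OF S open_U f(2,1) smooth_on_metric_nth])

lemma smooth_on_chr:
  assumes S: "open S" and f: "smooth_on S f" "f ` S \<subseteq> U" and V: "smooth_on S V" "smooth_on S W"
  shows "smooth_on S (\<lambda>x. chr h (f x) (V x) (W x))"
  unfolding chr_def
  by (intro smooth_on_vec_lambda smooth_on_sum smooth_on_mult smooth_on_nth V S
      smooth_on_compose[OF S open_U f(2,1) smooth_christoffel])

lemma smooth_Rform: "smooth_on U (\<lambda>z. Rform h z A B C D)"
  unfolding Rform_def Rop_def
  by (intro smooth_on_hform smooth_on_chr smooth_on_add smooth_on_diff smooth_on_const
      smooth_dchr smooth_chr smooth_on_ident open_U) auto

end

section \<open>The Levi-Civita connection along a map\<close>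

definition covd :: "(real^'m::finite \<Rightarrow> real^'m^'m) \<Rightarrow> ('x::real_normed_vector \<Rightarrow> real^'m) \<Rightarrow> ('x \<Rightarrow> real^'m) \<Rightarrow> 'x \<Rightarrow> 'x \<Rightarrow> real^'m" where
  "covd h f V x v = fderiv V x v + chr h (f x) (fderiv f x v) (V x)"

locale chart_map = chart_metric U h for U :: "(real^'m::finite) set" and h +
  fixes S :: "'x::euclidean_space set" and f :: "'x \<Rightarrow> real^'m"
  assumes open_S: "open S" and smooth_f: "smooth_on S f" and f_image: "f ` S \<subseteq> U"
begin

lemma f_in: "x \<in> S \<Longrightarrow> f x \<in> U"
  using f_image by auto

lemma hform_pull_derivative:
  assumes x: "x \<in> S" and V: "smooth_on S V" "smooth_on S W"
  shows "((\<lambda>x. hform h (f x) (V x) (W x)) has_derivative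
    (\<lambda>v. hform h (f x) (covd h f V x v) (W x) + hform h (f x) (V x) (covd h f W x v))) (at x)"
proof -
  have "((\<lambda>x. hform h (f x) (V x) (W x)) has_derivative
    (\<lambda>v. fderiv (\<lambda>z. hform h z (V x) (W x)) (f x) (fderiv f x v)
      + hform h (f x) (fderiv V x v) (W x) + hform h (f x) (V x) (fderiv W x v))) (at x)"
    by (rule has_derivative_bilinear_field[OF smooth_on_has_derivative[OF smooth_f x]
          smooth_on_has_derivative[OF V(1) x] smooth_on_has_derivative[OF V(2) x] open_S x f_image open_U])
       (auto intro!: linear_hform smooth_on_differentiable[OF smooth_hform] f_in x)
  then show ?thesis
    by (rule has_derivative_eq_rhs)
       (auto simp: fun_eq_iff dform_eq[OF f_in[OF x]] dform_compat[OF f_in[OF x]] covd_def hform_linear)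
qed

lemma smooth_df: "smooth_on S (\<lambda>x. fderiv f x v)"
  by (rule smooth_on_derivative[OF smooth_f])

lemma smooth_covd: "smooth_on S V \<Longrightarrow> smooth_on S (\<lambda>x. covd h f V x v)"
  unfolding covd_def
  by (intro smooth_on_add smooth_on_chr smooth_on_derivative open_S smooth_f f_image)

text \<open>Symmetry of the second fundamental form of f; the directions are constant fields, so
  there is no bracket.\<close>

lemma covd_torsion_free:
  assumes x: "x \<in> S"
  shows "covd h f (\<lambda>x. fderiv f x v) x w = covd h f (\<lambda>x. fderiv f x w) x v"
  unfolding covd_def
  using fderiv_symmetric[OF open_S smooth_f x] chr_sym[OF f_in[OF x]] by metis

text \<open>In the expansion \<open>eq\<close> of the iterated derivative, every term is symmetric
  in v and w except the derivative of the Christoffel map and its square; these antisymmetrise to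
  the curvature. Constant directions commute, hence no bracket term.\<close>

lemma covd_commutator:
  assumes x: "x \<in> S" and V: "smooth_on S V"
  shows "covd h f (\<lambda>x. covd h f V x w) x v = covd h f (\<lambda>x. covd h f V x v) x w
    + Rop h (f x) (fderiv f x v) (fderiv f x w) (V x)"
proof -
  let ?D = "\<lambda>V v. fderiv V x v"
  have "covd h f (\<lambda>x. covd h f V x w) x v =
      ?D (\<lambda>x. fderiv V x w) v + dchr h (f x) (?D f v) (?D f w) (V x)
      + chr h (f x) (?D (\<lambda>x. fderiv f x w) v) (V x) + chr h (f x) (?D f w) (?D V v)
      + chr h (f x) (?D f v) (?D V w) + chr h (f x) (?D f v) (chr h (f x) (?D f w) (V x))" for v w
  proof -
    have "((\<lambda>x. chr h (f x) (fderiv f x w) (V x)) has_derivative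
      (\<lambda>v. fderiv (\<lambda>z. chr h z (?D f w) (V x)) (f x) (?D f v)
        + chr h (f x) (?D (\<lambda>x. fderiv f x w) v) (V x) + chr h (f x) (?D f w) (?D V v))) (at x)"
      by (rule has_derivative_bilinear_field[OF smooth_on_has_derivative[OF smooth_f x]
            smooth_on_has_derivative[OF smooth_df x] smooth_on_has_derivative[OF V x] open_S x f_image open_U])
         (auto intro!: linear_chr smooth_on_differentiable[OF smooth_chr] f_in x)
    note this[folded dchr_def]
    from fderiv_eqI[OF has_derivative_add[OF
        smooth_on_has_derivative[OF smooth_on_derivative[OF V] x, of w] this]]
    show ?thesis by (simp add: covd_def chr_linear)
  qed
  note eq = this
  show ?thesis
    unfolding eq[of w v] eq[of v w] Rop_def
    using fderiv_symmetric[OF open_S smooth_f x, of w v]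
      fderiv_symmetric[OF open_S V x, of w v] by simp
qed

lemma Rform_pull_derivative:
  assumes x: "x \<in> S" and V: "smooth_on S A" "smooth_on S B" "smooth_on S C" "smooth_on S D"
  shows "((\<lambda>x. Rform h (f x) (A x) (B x) (C x) (D x)) has_derivative
    (\<lambda>v. nabla_Rform h (f x) (fderiv f x v) (A x) (B x) (C x) (D x)
      + Rform h (f x) (covd h f A x v) (B x) (C x) (D x) + Rform h (f x) (A x) (covd h f B x v) (C x) (D x)
      + Rform h (f x) (A x) (B x) (covd h f C x v) (D x) + Rform h (f x) (A x) (B x) (C x) (covd h f D x v))) (at x)"
proof -
  note lin = linear_Rform[OF f_in[OF x]]
  have "((\<lambda>x. Rform h (f x) (A x) (B x) (C x) (D x)) has_derivative
    (\<lambda>v. fderiv (\<lambda>z. Rform h z (A x) (B x) (C x) (D x)) (f x) (fderiv f x v)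
      + Rform h (f x) (fderiv A x v) (B x) (C x) (D x)
      + Rform h (f x) (A x) (fderiv B x v) (C x) (D x)
      + Rform h (f x) (A x) (B x) (fderiv C x v) (D x)
      + Rform h (f x) (A x) (B x) (C x) (fderiv D x v))) (at x)"
    by (rule has_derivative_quadrilinear_field[OF smooth_on_has_derivative[OF smooth_f x]
          smooth_on_has_derivative[OF V(1) x] smooth_on_has_derivative[OF V(2) x]
          smooth_on_has_derivative[OF V(3) x] smooth_on_has_derivative[OF V(4) x] open_S x f_image open_U])
       (auto intro!: linear_Rform smooth_on_differentiable[OF smooth_Rform] f_in x)
  then show ?thesis
    by (rule has_derivative_eq_rhs)
       (simp add: fun_eq_iff nabla_Rform_def covd_def linear_add[OF lin(1)] linear_add[OF lin(2)]
          linear_add[OF lin(3)] linear_add[OF lin(4)])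
qed

end

section \<open>The divergence of the stress tensor\<close>

text \<open>The two index permutations that match the symmetries of R and of the coefficients k
  below. Composed, they carry any of the four slots to the first place.\<close>

lemma sum4_swap:
  "(\<Sum>i\<in>I. \<Sum>j\<in>I. \<Sum>p\<in>I. \<Sum>q\<in>I. g i j p q) = (\<Sum>i\<in>I. \<Sum>j\<in>I. \<Sum>p\<in>I. \<Sum>q\<in>I. g j i q p)"
  "(\<Sum>i\<in>I. \<Sum>j\<in>I. \<Sum>p\<in>I. \<Sum>q\<in>I. g i j p q) = (\<Sum>i\<in>I. \<Sum>j\<in>I. \<Sum>p\<in>I. \<Sum>q\<in>I. g p q i j)"
proof -
  show "(\<Sum>i\<in>I. \<Sum>j\<in>I. \<Sum>p\<in>I. \<Sum>q\<in>I. g i j p q) = (\<Sum>i\<in>I. \<Sum>j\<in>I. \<Sum>p\<in>I. \<Sum>q\<in>I. g j i q p)"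
    by (subst sum.swap) (intro sum.cong refl sum.swap)
  show "(\<Sum>i\<in>I. \<Sum>j\<in>I. \<Sum>p\<in>I. \<Sum>q\<in>I. g i j p q) = (\<Sum>i\<in>I. \<Sum>j\<in>I. \<Sum>p\<in>I. \<Sum>q\<in>I. g p q i j)"
  proof -
    have "(\<Sum>i\<in>I. \<Sum>j\<in>I. \<Sum>p\<in>I. \<Sum>q\<in>I. g p q i j) = (\<Sum>i\<in>I. \<Sum>p\<in>I. \<Sum>j\<in>I. \<Sum>q\<in>I. g p q i j)"
      by (rule sum.cong[OF refl], rule sum.swap)
    also have "\<dots> = (\<Sum>p\<in>I. \<Sum>i\<in>I. \<Sum>j\<in>I. \<Sum>q\<in>I. g p q i j)"
      by (rule sum.swap)
    also have "\<dots> = (\<Sum>p\<in>I. \<Sum>i\<in>I. \<Sum>q\<in>I. \<Sum>j\<in>I. g p q i j)"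
      by (rule sum.cong[OF refl], rule sum.cong[OF refl], rule sum.swap)
    also have "\<dots> = (\<Sum>p\<in>I. \<Sum>q\<in>I. \<Sum>i\<in>I. \<Sum>j\<in>I. g p q i j)"
      by (rule sum.cong[OF refl], rule sum.swap)
    finally show ?thesis ..
  qed
qed

context chart_map
begin

text \<open>A spinor field along \<open>f\<close> is split into its real components \<open>w i\<close>, vector fields along \<open>f\<close>
  on which the connection acts diagonally. The Clifford action of \<open>b\<close> is then the matrix \<open>m b\<close>, and
  \<open>k\<close> holds the coefficients of the quartic and cubic curvature terms.\<close>

theorem stress_divergence:
  fixes I :: "'i set" and w :: "'i \<Rightarrow> 'x \<Rightarrow> real^'m" and m :: "'x \<Rightarrow> 'i \<Rightarrow> 'i \<Rightarrow> real" and k :: "'i \<Rightarrow> 'i \<Rightarrow> 'i \<Rightarrow> 'i \<Rightarrow> real"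
  defines "\<phi> \<equiv> \<lambda>v x. fderiv f x v"
  defines "\<tau> \<equiv> \<lambda>x. \<Sum>b\<in>Basis. covd h f (\<phi> b) x b"
  defines "P \<equiv> \<lambda>b c x. hform h (f x) (\<phi> b x) (\<phi> c x)"
  defines "B \<equiv> \<lambda>b c x. \<Sum>i\<in>I. \<Sum>j\<in>I. m b i j * hform h (f x) (w i x) (covd h f (w j) x c)"
  defines "D \<equiv> \<lambda>i x. \<Sum>b\<in>Basis. \<Sum>j\<in>I. m b i j *\<^sub>R covd h f (w j) x b"
  defines "C \<equiv> \<lambda>i x X. \<Sum>j\<in>I. \<Sum>p\<in>I. \<Sum>q\<in>I. k i j p q * Rform h (f x) X (w j x) (w p x) (w q x)"
  assumes w: "\<And>i. smooth_on S (w i)"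
    and m: "\<And>b i j. m b j i = - m b i j"
    and k: "\<And>i j p q. k j i q p = k i j p q" "\<And>i j p q. k p q i j = k i j p q"
    and dirac: "\<And>x i X. x \<in> S \<Longrightarrow> i \<in> I \<Longrightarrow> hform h (f x) X (D i x) = 1/3 * C i x X"
    and tens: "\<And>x X. x \<in> S \<Longrightarrow> hform h (f x) (\<tau> x) X =
      1/2 * (\<Sum>b\<in>Basis. \<Sum>i\<in>I. \<Sum>j\<in>I. m b i j * hform h (f x) (Rop h (f x) (w i x) (w j x) (\<phi> b x)) X)
      - 1/12 * (\<Sum>i\<in>I. \<Sum>j\<in>I. \<Sum>p\<in>I. \<Sum>q\<in>I. k i j p q * nabla_Rform h (f x) X (w i x) (w j x) (w p x) (w q x))"
    and x: "x \<in> S"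
  shows "(\<Sum>b\<in>Basis. fderiv (\<lambda>x. 2 * P b c x + B b c x) x b) =
     fderiv (\<lambda>x. (\<Sum>b\<in>Basis. P b b x) + 1/2 * (\<Sum>b\<in>Basis. B b b x)) x c"
proof -
  note fx = f_in[OF x]
  have sm: "smooth_on S (\<phi> v)" for v unfolding \<phi>_def by (rule smooth_df)
  have sw: "smooth_on S (\<lambda>x. covd h f (w j) x c)" for j c by (rule smooth_covd[OF w])
  let ?H = "hform h (f x)"
  let ?n = "\<lambda>V v. covd h f V x v"
  have dP: "(P b c has_derivative (\<lambda>v. ?H (?n (\<phi> b) v) (\<phi> c x) + ?H (\<phi> b x) (?n (\<phi> c) v))) (at x)" for b c
    unfolding P_def by (rule hform_pull_derivative[OF x sm sm])
  define dBv where "dBv b c v = (\<Sum>i\<in>I. \<Sum>j\<in>I. m b i j * (?H (?n (w i) v) (?n (w j) c)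
      + ?H (w i x) (?n (\<lambda>x. covd h f (w j) x c) v)))" for b c v
  have dB: "(B b c has_derivative dBv b c) (at x)" for b c
    unfolding B_def dBv_def
    by (intro has_derivative_sum has_derivative_mult_right hform_pull_derivative[OF x w sw])
  \<comment> \<open>The claim is a linear relation among four numbers: \<open>nE\<close>, the
    derivative of <psi, D psi> in direction c; \<open>Z\<close> and \<open>NR\<close>, the parts of
    the derivative of the quartic term falling on one spinor slot and on the curvature tensor; and
    \<open>RT\<close>, the curvature from interchanging covariant derivatives.\<close>
  define nE where "nE = (\<Sum>b\<in>Basis. dBv b b c)"
  define Z where "Z = (\<Sum>i\<in>I. C i x (?n (w i) c))"
  define NR where "NR = (\<Sum>i\<in>I. \<Sum>j\<in>I. \<Sum>p\<in>I. \<Sum>q\<in>I.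
      k i j p q * nabla_Rform h (f x) (\<phi> c x) (w i x) (w j x) (w p x) (w q x))"
  define RT where "RT = (\<Sum>b\<in>Basis. \<Sum>i\<in>I. \<Sum>j\<in>I.
      m b i j * ?H (w i x) (Rop h (f x) (\<phi> b x) (\<phi> c x) (w j x)))"
  have Dsum: "(\<Sum>b\<in>Basis. \<Sum>j\<in>I. m b i j * ?H X (?n (w j) b)) = 1/3 * C i x X" if "i \<in> I" for i X
    using dirac[OF x that, of X]
    by (simp add: D_def linear_sum[OF linear_hform(1)] hform_linear)

  \<comment> \<open>This is <nabla_c psi, D psi>, evaluated by the Dirac equation.\<close>
  have Zc: "(\<Sum>b\<in>Basis. \<Sum>i\<in>I. \<Sum>j\<in>I. m b i j * ?H (?n (w i) c) (?n (w j) b)) = 1/3 * Z"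
    unfolding Z_def sum_distrib_left
    by (subst sum.swap) (intro sum.cong refl, simp add: Dsum)
  \<comment> \<open>Exchanging i and j and using skewness of m moves the Clifford factor onto the
    other entry, which produces minus the previous sum.\<close>
  have "(\<Sum>b\<in>Basis. \<Sum>i\<in>I. \<Sum>j\<in>I. m b i j * ?H (?n (w i) b) (?n (w j) c)) =
     (\<Sum>b\<in>Basis. \<Sum>i\<in>I. \<Sum>j\<in>I. - (m b i j * ?H (?n (w i) c) (?n (w j) b)))"
  proof (rule sum.cong[OF refl])
    fix b :: 'x
    have "m b j i * ?H (?n (w j) b) (?n (w i) c) = - (m b i j * ?H (?n (w i) c) (?n (w j) b))" for i j
      by (subst m, subst hform_sym[OF fx]) simp
    then show "(\<Sum>i\<in>I. \<Sum>j\<in>I. m b i j * ?H (?n (w i) b) (?n (w j) c)) =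
      (\<Sum>i\<in>I. \<Sum>j\<in>I. - (m b i j * ?H (?n (w i) c) (?n (w j) b)))"
      by (subst sum.swap) (intro sum.cong refl)
  qed
  then have Zb: "(\<Sum>b\<in>Basis. \<Sum>i\<in>I. \<Sum>j\<in>I. m b i j * ?H (?n (w i) b) (?n (w j) c)) = - (1/3 * Z)"
    unfolding sum_negf Zc .
  have nE1: "nE = 1/3 * Z + (\<Sum>b\<in>Basis. \<Sum>i\<in>I. \<Sum>j\<in>I. m b i j * ?H (w i x) (?n (\<lambda>x. covd h f (w j) x b) c))"
    unfolding nE_def dBv_def distrib_left sum.distrib Zc ..
  have comm: "?H X (?n (\<lambda>x. covd h f (w j) x c) b) = ?H X (?n (\<lambda>x. covd h f (w j) x b) c)
      + ?H X (Rop h (f x) (\<phi> b x) (\<phi> c x) (w j x))" for X j b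
    by (subst covd_commutator[OF x w]) (simp only: hform_linear \<phi>_def)
  \<comment> \<open>One third of \<open>Z\<close> is lost through \<open>Zb\<close>, another when
    \<open>nE1\<close> is solved for the second derivatives; hence the coefficient 2/3.\<close>
  have divB: "(\<Sum>b\<in>Basis. dBv b c b) = nE - 2/3 * Z + RT"
    unfolding dBv_def distrib_left sum.distrib Zb comm RT_def[symmetric] nE1 by simp

  \<comment> \<open>On all of S, not just at x, the trace of B is one third of the quartic term. It
    may therefore be differentiated, giving a second evaluation of \<open>nE\<close>.\<close>
  have "(\<Sum>b\<in>Basis. B b b y) = 1/3 * (\<Sum>i\<in>I. C i y (w i y))" if "y \<in> S" for y
  proof -
    have "(\<Sum>b\<in>Basis. B b b y) = (\<Sum>i\<in>I. hform h (f y) (w i y) (D i y))"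
      unfolding B_def D_def linear_sum[OF linear_hform(1)] hform_linear
      by (subst sum.swap) simp
    then show ?thesis
      by (simp add: dirac[OF that] sum_distrib_left)
  qed
  then have Beq: "(\<Sum>b\<in>Basis. B b b y) = 1/3 * (\<Sum>i\<in>I. \<Sum>j\<in>I. \<Sum>p\<in>I. \<Sum>q\<in>I. k i j p q * Rform h (f y) (w i y) (w j y) (w p y) (w q y))"
    if "y \<in> S" for y using that by (simp add: C_def)
  have R1: "((\<lambda>y. Rform h (f y) (w i y) (w j y) (w p y) (w q y)) has_derivative
     (\<lambda>v. nabla_Rform h (f x) (\<phi> v x) (w i x) (w j x) (w p x) (w q x)
      + Rform h (f x) (?n (w i) v) (w j x) (w p x) (w q x) + Rform h (f x) (w i x) (?n (w j) v) (w p x) (w q x)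
      + Rform h (f x) (w i x) (w j x) (?n (w p) v) (w q x) + Rform h (f x) (w i x) (w j x) (w p x) (?n (w q) v))) (at x)" for i j p q
    unfolding \<phi>_def by (rule Rform_pull_derivative[OF x w w w w])
  have "nE = fderiv (\<lambda>y. \<Sum>b\<in>Basis. B b b y) x c"
    unfolding nE_def fderiv_eqI[OF has_derivative_sum[OF dB]] ..
  also have "\<dots> = fderiv (\<lambda>y. 1/3 * (\<Sum>i\<in>I. \<Sum>j\<in>I. \<Sum>p\<in>I. \<Sum>q\<in>I.
      k i j p q * Rform h (f y) (w i y) (w j y) (w p y) (w q y))) x c"
    by (subst fderiv_cong_open[OF open_S x Beq]) auto
  also have "\<dots> = 1/3 * (\<Sum>i\<in>I. \<Sum>j\<in>I. \<Sum>p\<in>I. \<Sum>q\<in>I. k i j p q *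
      (nabla_Rform h (f x) (\<phi> c x) (w i x) (w j x) (w p x) (w q x)
      + Rform h (f x) (?n (w i) c) (w j x) (w p x) (w q x) + Rform h (f x) (w i x) (?n (w j) c) (w p x) (w q x)
      + Rform h (f x) (w i x) (w j x) (?n (w p) c) (w q x) + Rform h (f x) (w i x) (w j x) (w p x) (?n (w q) c)))"
    unfolding fderiv_eqI[OF has_derivative_mult_right[OF has_derivative_sum[OF has_derivative_sum[OF
      has_derivative_sum[OF has_derivative_sum[OF has_derivative_mult_right[OF R1]]]]]]] ..
  also have "\<dots> = 1/3 * (NR + 4 * Z)"
  proof -
    \<comment> \<open>The derivative falls on one of four slots. The symmetries of k and R identify
      the contributions of the other three with that of the first.\<close>
    have s1: "Rform h (f x) Q2 Q1 Q4 Q3 = Rform h (f x) Q1 Q2 Q3 Q4" for Q1 Q2 Q3 Q4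
      using Rform_antisym12 Rform_antisym34[OF fx] by (metis minus_minus)
    have Z1: "(\<Sum>i\<in>I. \<Sum>j\<in>I. \<Sum>p\<in>I. \<Sum>q\<in>I. k i j p q * Rform h (f x) (?n (w i) c) (w j x) (w p x) (w q x)) = Z"
      unfolding Z_def C_def ..
    have Z2: "(\<Sum>i\<in>I. \<Sum>j\<in>I. \<Sum>p\<in>I. \<Sum>q\<in>I. k i j p q * Rform h (f x) (w i x) (?n (w j) c) (w p x) (w q x)) = Z"
      by (subst sum4_swap(1), subst Z1[symmetric]) (intro sum.cong refl, subst k(1), subst s1, rule refl)
    have Z3: "(\<Sum>i\<in>I. \<Sum>j\<in>I. \<Sum>p\<in>I. \<Sum>q\<in>I. k i j p q * Rform h (f x) (w i x) (w j x) (?n (w p) c) (w q x)) = Z"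
      by (subst sum4_swap(2), subst Z1[symmetric]) (intro sum.cong refl, subst k(2), subst Rform_pair_sym[OF fx], rule refl)
    have Z4: "(\<Sum>i\<in>I. \<Sum>j\<in>I. \<Sum>p\<in>I. \<Sum>q\<in>I. k i j p q * Rform h (f x) (w i x) (w j x) (w p x) (?n (w q) c)) = Z"
      by (subst sum4_swap(1), subst Z3[symmetric]) (intro sum.cong refl, subst k(1), subst s1, rule refl)
    show ?thesis
      unfolding distrib_left sum.distrib Z1 Z2 Z3 Z4 NR_def[symmetric] by simp
  qed
  finally have nE: "3 * nE = NR + 4 * Z" by simp

  \<comment> \<open>Pair symmetry exchanges the two spinors with the two images of
    \<open>\<phi>\<close>, so the curvature term of the tension equation becomes the commutator term
    with opposite sign.\<close>
  have "?H (Rop h (f x) (w i x) (w j x) (\<phi> b x)) (\<phi> c x) = - ?H (w i x) (Rop h (f x) (\<phi> b x) (\<phi> c x) (w j x))" for b i j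
    using Rform_pair_sym[OF fx, of "w i x" "w j x" "\<phi> c x" "\<phi> b x"]
      Rform_antisym12[of "f x" "\<phi> c x" "\<phi> b x" "w i x" "w j x"]
      hform_sym[OF fx, of "\<phi> c x" "Rop h (f x) (w i x) (w j x) (\<phi> b x)"]
    by (simp add: Rform_def)
  then have tau: "2 * ?H (\<tau> x) (\<phi> c x) = - RT - 1/6 * NR"
    unfolding tens[OF x] RT_def NR_def[symmetric] by (simp add: sum_negf)

  have divP: "(\<Sum>b\<in>Basis. ?H (?n (\<phi> b) b) (\<phi> c x) + ?H (\<phi> b x) (?n (\<phi> c) b)) =
      ?H (\<tau> x) (\<phi> c x) + (\<Sum>b\<in>Basis. ?H (\<phi> b x) (?n (\<phi> b) c))"
    unfolding \<tau>_def linear_sum[OF linear_hform(2)] sum.distrib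
    using covd_torsion_free[OF x, of c] by (simp add: \<phi>_def)
  have "(\<Sum>b\<in>Basis. fderiv (\<lambda>x. 2 * P b c x + B b c x) x b) =
      2 * (\<Sum>b\<in>Basis. ?H (?n (\<phi> b) b) (\<phi> c x) + ?H (\<phi> b x) (?n (\<phi> c) b)) + (\<Sum>b\<in>Basis. dBv b c b)"
    unfolding fderiv_eqI[OF has_derivative_add[OF has_derivative_mult_right[OF dP] dB]]
    by (simp add: sum.distrib sum_distrib_left)
  moreover have "fderiv (\<lambda>x. (\<Sum>b\<in>Basis. P b b x) + 1/2 * (\<Sum>b\<in>Basis. B b b x)) x c =
      2 * (\<Sum>b\<in>Basis. ?H (\<phi> b x) (?n (\<phi> b) c)) + 1/2 * nE"
    unfolding fderiv_eqI[OF has_derivative_add[OF has_derivative_sum[OF dP]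
      has_derivative_mult_right[OF has_derivative_sum[OF dB]]]] nE_def
    by (simp add: hform_sym[OF fx, of "?n (\<phi> _) c"] sum_distrib_left)
  \<comment> \<open>Here \<open>RT\<close> cancels, and half of \<open>nE\<close> equals 1/6 of
    \<open>NR\<close> plus 2/3 of \<open>Z\<close>; this is the point at which the coefficients of
    the system must fit together.\<close>
  ultimately show ?thesis
    unfolding divP divB using tau nE by simp
qed

end

section \<open>Components of spinors and curvature terms\<close>

definition form4 :: "('m \<Rightarrow> 'm \<Rightarrow> 'm \<Rightarrow> 'm \<Rightarrow> real) \<Rightarrow> real^'m \<Rightarrow> real^'m \<Rightarrow> real^'m \<Rightarrow> real^'m::finite \<Rightarrow> real" where
  "form4 T A B C D = (\<Sum>a\<in>UNIV. \<Sum>b\<in>UNIV. \<Sum>d\<in>UNIV. \<Sum>e\<in>UNIV. A $ a * (B $ b * (C $ d * (D $ e * T a b d e))))"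

lemma form4_eqI:
  fixes F :: "real^'m::finite \<Rightarrow> real^'m \<Rightarrow> real^'m \<Rightarrow> real^'m \<Rightarrow> real"
  assumes "\<And>B C D. linear (\<lambda>A. F A B C D)" "\<And>A C D. linear (\<lambda>B. F A B C D)"
    "\<And>A B D. linear (\<lambda>C. F A B C D)" "\<And>A B C. linear (\<lambda>D. F A B C D)"
  shows "F A B C D = form4 (\<lambda>a b d e. F (axis a 1) (axis b 1) (axis d 1) (axis e 1)) A B C D"
proof -
  have "F A B C D = (\<Sum>a\<in>UNIV. A $ a *\<^sub>R F (axis a 1) B C D)"
    by (rule linear_axis_sum[OF assms(1)])
  also have "\<dots> = (\<Sum>a\<in>UNIV. A $ a *\<^sub>R (\<Sum>b\<in>UNIV. B $ b *\<^sub>R F (axis a 1) (axis b 1) C D))"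
    by (intro sum.cong refl arg_cong2[where f = scaleR] linear_axis_sum[OF assms(2)])
  also have "\<dots> = (\<Sum>a\<in>UNIV. A $ a *\<^sub>R (\<Sum>b\<in>UNIV. B $ b *\<^sub>R (\<Sum>d\<in>UNIV. C $ d *\<^sub>R F (axis a 1) (axis b 1) (axis d 1) D)))"
    by (intro sum.cong refl arg_cong2[where f = scaleR] linear_axis_sum[OF assms(3)])
  also have "\<dots> = (\<Sum>a\<in>UNIV. A $ a *\<^sub>R (\<Sum>b\<in>UNIV. B $ b *\<^sub>R (\<Sum>d\<in>UNIV. C $ d *\<^sub>R
      (\<Sum>e\<in>UNIV. D $ e *\<^sub>R F (axis a 1) (axis b 1) (axis d 1) (axis e 1)))))"
    by (intro sum.cong refl arg_cong2[where f = scaleR] linear_axis_sum[OF assms(4)])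
  finally show ?thesis by (simp add: form4_def sum_distrib_left)
qed

lemma sum_pair: "(\<Sum>a\<in>A. \<Sum>b\<in>B. g a b) = (\<Sum>p\<in>A \<times> B. g (fst p) (snd p))"
  by (simp add: sum.cartesian_product split_def)

lemma sum_quad:
  "(\<Sum>a\<in>A. \<Sum>b\<in>B. \<Sum>c\<in>C. \<Sum>d\<in>D. g a b c d) =
   (\<Sum>p\<in>A \<times> B \<times> C \<times> D. g (fst p) (fst (snd p)) (fst (snd (snd p))) (snd (snd (snd p))))"
  by (simp add: sum.cartesian_product split_def)

lemma sum2_swap2:
  "(\<Sum>a\<in>A. \<Sum>b\<in>B. \<Sum>s\<in>S. \<Sum>t\<in>T. g a b s t) = (\<Sum>s\<in>S. \<Sum>t\<in>T. \<Sum>a\<in>A. \<Sum>b\<in>B. g a b s t)"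
  unfolding sum_pair[where A = A and B = B] sum_pair[where A = S and B = T] by (rule sum.swap)

text \<open>Bundling four indices into one index over a product set turns the eightfold exchange
  into a single \<open>sum.swap\<close>.\<close>

lemma sum4_swap4:
  "(\<Sum>a\<in>A. \<Sum>b\<in>B. \<Sum>c\<in>C. \<Sum>d\<in>D. \<Sum>s\<in>S. \<Sum>t\<in>T. \<Sum>u\<in>U. \<Sum>v\<in>V. g a b c d s t u v) =
   (\<Sum>s\<in>S. \<Sum>t\<in>T. \<Sum>u\<in>U. \<Sum>v\<in>V. \<Sum>a\<in>A. \<Sum>b\<in>B. \<Sum>c\<in>C. \<Sum>d\<in>D. g a b c d s t u v)"
  unfolding sum_quad[where A = A and B = B and C = C and D = D] sum_quad[where A = S and B = T and C = U and D = V]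
  by (rule sum.swap)

lemma sum_Basis_axis: "(\<Sum>b\<in>(Basis :: (real^'n::finite) set). g b) = (\<Sum>i\<in>UNIV. g (axis i (1::real)))"
proof -
  have "(Basis :: (real^'n) set) = range (\<lambda>i. axis i 1)" by (auto simp: Basis_vec_def)
  moreover have "inj (\<lambda>i::'n. axis i (1::real))" by (auto simp: inj_on_def axis_eq_axis)
  ultimately show ?thesis
    using sum.reindex[of "\<lambda>i. axis i (1::real)" UNIV g] by (simp only: o_def)
qed

lemma Re_herm: "Re (herm u v) = u \<bullet> v"
  by (simp add: herm_def inner_vec_def inner_complex_def)

lemma cnj_herm: "cnj (herm u v) = herm v u"
  by (simp add: herm_def mult.commute)

lemma linear_herm: "linear (herm u)" "linear (\<lambda>u. herm u v)"
  by (auto intro!: linearI simp: herm_def algebra_simps sum.distrib scaleR_sum_right)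

lemma herm_smult: "herm u (z *s v) = z * herm u v"
  by (simp add: herm_def sum_distrib_left mult.left_commute)

lemma herm_sum: "herm u (\<Sum>i\<in>I. g i) = (\<Sum>i\<in>I. herm u (g i))"
  by (rule linear_sum[OF linear_herm(1)])

text \<open>Here \<sigma> is meant to run through the real basis \<open>Basis\<close> of the spinor
  space, which contains the imaginary multiples too; the resulting real tangent vectors determine
  the vector spinor.\<close>

definition spin_comp :: "complex^'s::finite \<Rightarrow> complex^'s^'m::finite \<Rightarrow> real^'m" where
  "spin_comp \<sigma> \<xi> = (\<chi> a. \<xi> $ a \<bullet> \<sigma>)"

text \<open>The curvature components are real, so the real part carries all of the quartic
  expression. Serves as the array k of \<open>stress_divergence\<close>.\<close>

definition quartic_coeff :: "complex^'s::finite \<Rightarrow> complex^'s \<Rightarrow> complex^'s \<Rightarrow> complex^'s \<Rightarrow> real" where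
  "quartic_coeff i j p q = Re (herm i p * herm j q)"

lemma quartic_coeff_sym:
  "quartic_coeff j i q p = quartic_coeff i j p q" "quartic_coeff p q i j = quartic_coeff i j p q"
proof -
  show "quartic_coeff j i q p = quartic_coeff i j p q"
    by (simp add: quartic_coeff_def mult.commute)
  have "herm p i * herm q j = cnj (herm i p * herm j q)" by (simp add: cnj_herm)
  then show "quartic_coeff p q i j = quartic_coeff i j p q"
    unfolding quartic_coeff_def by (metis complex_cnj(1) complex.sel(1) cnj.simps(1))
qed

text \<open>Over the reals the conjugate-linear entries of \<open>herm\<close> are linear as well,
  so the expression is real multilinear in a, b, d, e.\<close>

lemma quartic_coeff_expand:
  "Re (herm a d * herm b e) = (\<Sum>\<sigma>\<in>Basis. \<Sum>\<tau>\<in>Basis. \<Sum>\<rho>\<in>Basis. \<Sum>\<kappa>\<in>Basis.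
     (a \<bullet> \<sigma>) * ((b \<bullet> \<tau>) * ((d \<bullet> \<rho>) * ((e \<bullet> \<kappa>) * quartic_coeff \<sigma> \<tau> \<rho> \<kappa>))))"
proof -
  note lin = linear_add[OF linear_herm(1)] linear_add[OF linear_herm(2)] linear_cmul[OF linear_herm(1)]
    linear_cmul[OF linear_herm(2)]
  have l: "linear (\<lambda>a. Re (herm a d * herm b e))" "linear (\<lambda>b. Re (herm a d * herm b e))"
    "linear (\<lambda>d. Re (herm a d * herm b e))" "linear (\<lambda>e. Re (herm a d * herm b e))" for a b d e
    by (auto intro!: linearI simp: lin algebra_simps)
  have "Re (herm a d * herm b e) = (\<Sum>\<sigma>\<in>Basis. (a \<bullet> \<sigma>) *\<^sub>R Re (herm \<sigma> d * herm b e))"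
    by (rule linear_eq_sum_Basis[OF l(1)])
  also have "\<dots> = (\<Sum>\<sigma>\<in>Basis. (a \<bullet> \<sigma>) *\<^sub>R (\<Sum>\<tau>\<in>Basis. (b \<bullet> \<tau>) *\<^sub>R Re (herm \<sigma> d * herm \<tau> e)))"
    by (intro sum.cong refl arg_cong2[where f = scaleR] linear_eq_sum_Basis[OF l(2)])
  also have "\<dots> = (\<Sum>\<sigma>\<in>Basis. (a \<bullet> \<sigma>) *\<^sub>R (\<Sum>\<tau>\<in>Basis. (b \<bullet> \<tau>) *\<^sub>R (\<Sum>\<rho>\<in>Basis. (d \<bullet> \<rho>) *\<^sub>R Re (herm \<sigma> \<rho> * herm \<tau> e))))"
    by (intro sum.cong refl arg_cong2[where f = scaleR] linear_eq_sum_Basis[OF l(3)])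
  also have "\<dots> = (\<Sum>\<sigma>\<in>Basis. (a \<bullet> \<sigma>) *\<^sub>R (\<Sum>\<tau>\<in>Basis. (b \<bullet> \<tau>) *\<^sub>R (\<Sum>\<rho>\<in>Basis. (d \<bullet> \<rho>) *\<^sub>R
      (\<Sum>\<kappa>\<in>Basis. (e \<bullet> \<kappa>) *\<^sub>R Re (herm \<sigma> \<rho> * herm \<tau> \<kappa>)))))"
    by (intro sum.cong refl arg_cong2[where f = scaleR] linear_eq_sum_Basis[OF l(4)])
  finally show ?thesis by (simp add: quartic_coeff_def sum_distrib_left)
qed

lemma quartic_components:
  "Re (\<Sum>a\<in>UNIV. \<Sum>b\<in>UNIV. \<Sum>d\<in>UNIV. \<Sum>e\<in>UNIV. of_real (T a b d e) * herm (\<alpha> $ a) (\<delta> $ d) * herm (\<beta> $ b) (\<epsilon> $ e))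
   = (\<Sum>\<sigma>\<in>Basis. \<Sum>\<tau>\<in>Basis. \<Sum>\<rho>\<in>Basis. \<Sum>\<kappa>\<in>Basis. quartic_coeff \<sigma> \<tau> \<rho> \<kappa> *
      form4 T (spin_comp \<sigma> \<alpha>) (spin_comp \<tau> \<beta>) (spin_comp \<rho> \<delta>) (spin_comp \<kappa> \<epsilon>))"
proof -
  have "Re (of_real (T a b d e) * herm (\<alpha> $ a) (\<delta> $ d) * herm (\<beta> $ b) (\<epsilon> $ e)) =
    (\<Sum>\<sigma>\<in>Basis. \<Sum>\<tau>\<in>Basis. \<Sum>\<rho>\<in>Basis. \<Sum>\<kappa>\<in>Basis. quartic_coeff \<sigma> \<tau> \<rho> \<kappa> *
     (spin_comp \<sigma> \<alpha> $ a * (spin_comp \<tau> \<beta> $ b * (spin_comp \<rho> \<delta> $ d * (spin_comp \<kappa> \<epsilon> $ e * T a b d e)))))" for a b d e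
  proof -
    have "Re (of_real (T a b d e) * herm (\<alpha> $ a) (\<delta> $ d) * herm (\<beta> $ b) (\<epsilon> $ e)) =
        T a b d e * Re (herm (\<alpha> $ a) (\<delta> $ d) * herm (\<beta> $ b) (\<epsilon> $ e))"
      by (simp only: mult.assoc Re_complex_of_real times_complex.sel Im_complex_of_real)
    then show ?thesis
      unfolding quartic_coeff_expand by (simp add: spin_comp_def sum_distrib_left mult_ac)
  qed
  then show ?thesis
    unfolding form4_def sum_distrib_left Re_sum by (simp only: sum4_swap4[where A = UNIV])
qed

lemma smooth_spin_comp: "open S \<Longrightarrow> smooth_on S \<xi> \<Longrightarrow> smooth_on S (\<lambda>x. spin_comp \<sigma> (\<xi> x))"
  unfolding spin_comp_def
  by (intro smooth_on_vec_lambda smooth_on_inner smooth_on_nth smooth_on_const)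

lemma linear_spin_comp: "linear (spin_comp \<sigma>)"
  by (auto intro!: linearI simp: spin_comp_def vec_eq_iff inner_add_left)

context chart_metric
begin

lemma chr_axis_left: "chr h y (axis a 1) W $ e = (\<Sum>m\<in>UNIV. christoffel h y e a m * W $ m)"
  by (subst linear_axis_sum[OF linear_chr(1)]) (simp add: chr_axis mult.commute)

lemma curv_op_eq:
  assumes y: "y \<in> U"
  shows "curv_op h y e d a b = Rop h y (axis a 1) (axis b 1) (axis d 1) $ e"
proof -
  have "pderiv_at v (\<lambda>z. christoffel h z e b d) y = dchr h y (axis v 1) (axis b 1) (axis d 1) $ e" for v b d
  proof -
    have "fderiv (\<lambda>z. chr h z (axis b 1) (axis d 1) $ e) y (axis v 1) =
        fderiv (\<lambda>z. chr h z (axis b 1) (axis d 1)) y (axis v 1) $ e"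
      by (rule fderiv_linear[OF bounded_linear_vec_nth smooth_on_differentiable[OF smooth_chr y]])
    then show ?thesis
      by (simp add: pderiv_at_def dchr_def chr_axis)
  qed
  moreover have "chr h y (axis a 1) (chr h y (axis b 1) (axis d 1)) $ e =
      (\<Sum>m\<in>UNIV. christoffel h y e a m * christoffel h y m b d)" for a b
    by (subst chr_axis_left) (simp add: chr_axis)
  ultimately show ?thesis
    unfolding curv_op_def Rop_def by (simp add: sum_subtractf)
qed

lemma riem_eq:
  assumes y: "y \<in> U"
  shows "riem h y a b c d = Rform h y (axis a 1) (axis b 1) (axis c 1) (axis d 1)"
  unfolding riem_def Rform_def hform_axis curv_op_eq[OF y] ..

lemma Rform_form4: "y \<in> U \<Longrightarrow> Rform h y A B C D = form4 (riem h y) A B C D"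
  by (subst form4_eqI[of "Rform h y"]) (auto intro: linear_Rform simp: riem_eq[symmetric])

lemma linear_nabla_Rform:
  assumes y: "y \<in> U"
  shows "linear (\<lambda>u. nabla_Rform h y u A B C D)"
    "linear (\<lambda>A. nabla_Rform h y u A B C D)" "linear (\<lambda>B. nabla_Rform h y u A B C D)"
    "linear (\<lambda>C. nabla_Rform h y u A B C D)" "linear (\<lambda>D. nabla_Rform h y u A B C D)"
proof -
  note R = linear_Rform[OF y]
  note d = smooth_on_differentiable[OF smooth_Rform y]
  note lin = linear_add[OF R(1)] linear_add[OF R(2)] linear_add[OF R(3)] linear_add[OF R(4)]
    linear_cmul[OF R(1)] linear_cmul[OF R(2)] linear_cmul[OF R(3)] linear_cmul[OF R(4)] chr_linear
  have l0: "linear (\<lambda>u. fderiv (\<lambda>z. Rform h z A B C D) y u)" for A B C D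
    by (rule linear_frechet_derivative[OF d])
  have l1: "linear (\<lambda>A. fderiv (\<lambda>z. Rform h z A B C D) y u)" for B C D u
    by (rule fderiv_linear_family[OF open_U y linear_Rform(1) d])
  have l2: "linear (\<lambda>B. fderiv (\<lambda>z. Rform h z A B C D) y u)" for A C D u
    by (rule fderiv_linear_family[OF open_U y linear_Rform(2) d])
  have l3: "linear (\<lambda>C. fderiv (\<lambda>z. Rform h z A B C D) y u)" for A B D u
    by (rule fderiv_linear_family[OF open_U y linear_Rform(3) d])
  have l4: "linear (\<lambda>D. fderiv (\<lambda>z. Rform h z A B C D) y u)" for A B C u
    by (rule fderiv_linear_family[OF open_U y linear_Rform(4) d])
  note l = l0 l1 l2 l3 l4
  show "linear (\<lambda>u. nabla_Rform h y u A B C D)"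
    "linear (\<lambda>A. nabla_Rform h y u A B C D)" "linear (\<lambda>B. nabla_Rform h y u A B C D)"
    "linear (\<lambda>C. nabla_Rform h y u A B C D)" "linear (\<lambda>D. nabla_Rform h y u A B C D)"
    unfolding nabla_Rform_def
    by (rule linearI; simp add: l[THEN linear_add] l[THEN linear_cmul] lin algebra_simps)+
qed

lemma nabla_riem_eq:
  assumes y: "y \<in> U"
  shows "nabla_riem h y v a b c d =
    nabla_Rform h y (axis v 1) (axis a 1) (axis b 1) (axis c 1) (axis d 1)"
proof -
  have 1: "pderiv_at v (\<lambda>z. riem h z a b c d) y =
      fderiv (\<lambda>z. Rform h z (axis a 1) (axis b 1) (axis c 1) (axis d 1)) y (axis v 1)"
    unfolding pderiv_at_def
    by (subst fderiv_cong_open[OF open_U y riem_eq]) auto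
  note R = linear_Rform[OF y]
  have "Rform h y (chr h y (axis v 1) (axis e 1)) B C D = (\<Sum>m\<in>UNIV. christoffel h y m v e * Rform h y (axis m 1) B C D)"
    "Rform h y A (chr h y (axis v 1) (axis e 1)) C D = (\<Sum>m\<in>UNIV. christoffel h y m v e * Rform h y A (axis m 1) C D)"
    "Rform h y A B (chr h y (axis v 1) (axis e 1)) D = (\<Sum>m\<in>UNIV. christoffel h y m v e * Rform h y A B (axis m 1) D)"
    "Rform h y A B C (chr h y (axis v 1) (axis e 1)) = (\<Sum>m\<in>UNIV. christoffel h y m v e * Rform h y A B C (axis m 1))"
    for A B C D e
    by (subst linear_axis_sum[OF R(1)], simp add: chr_axis, subst linear_axis_sum[OF R(2)], simp add: chr_axis,
      subst linear_axis_sum[OF R(3)], simp add: chr_axis, subst linear_axis_sum[OF R(4)], simp add: chr_axis)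
  then show ?thesis
    unfolding nabla_riem_def nabla_Rform_def 1 sum.distrib by (simp add: riem_eq[OF y])
qed

lemma nabla_Rform_form4:
  "y \<in> U \<Longrightarrow> nabla_Rform h y (axis v 1) A B C D = form4 (nabla_riem h y v) A B C D"
  by (subst form4_eqI[of "nabla_Rform h y (axis v 1)"]) (auto intro: linear_nabla_Rform simp: nabla_riem_eq[symmetric])

end

lemma sum1_swap3:
  "(\<Sum>f\<in>F. \<Sum>b\<in>B. \<Sum>d\<in>D. \<Sum>e\<in>E. g f b d e) = (\<Sum>b\<in>B. \<Sum>d\<in>D. \<Sum>e\<in>E. \<Sum>f\<in>F. g f b d e)"
  by (simp only: sum.swap[where A = F and B = B] sum.swap[where A = F and B = D] sum.swap[where A = F and B = E])

context chart_metric
begin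

lemma curvature_quartic_components:
  assumes y: "y \<in> U"
  shows "Re (\<Sum>a\<in>UNIV. \<Sum>b\<in>UNIV. \<Sum>d\<in>UNIV. \<Sum>e\<in>UNIV.
      of_real (riem h y a b d e) * herm (\<xi> $ a) (\<xi> $ d) * herm (\<xi> $ b) (\<xi> $ e)) =
    (\<Sum>\<sigma>\<in>Basis. \<Sum>\<tau>\<in>Basis. \<Sum>\<rho>\<in>Basis. \<Sum>\<kappa>\<in>Basis. quartic_coeff \<sigma> \<tau> \<rho> \<kappa> *
      Rform h y (spin_comp \<sigma> \<xi>) (spin_comp \<tau> \<xi>) (spin_comp \<rho> \<xi>) (spin_comp \<kappa> \<xi>))"
  unfolding quartic_components Rform_form4[OF y] ..

text \<open>Pairing with X by means of h cancels the inverse metric in \<open>riem_up\<close>. What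
  remains is the quartic expression with the vector spinor X tensor \<sigma> in its first slot,
  whose real component is X at \<sigma> and 0 at every other basis vector.\<close>

lemma curvature_cubic_components:
  fixes \<xi> :: "complex^'s::finite^'m"
  assumes y: "y \<in> U" and \<sigma>: "\<sigma> \<in> Basis"
  shows "hform h y X (spin_comp \<sigma> (\<chi> a. \<Sum>b\<in>UNIV. \<Sum>d\<in>UNIV. \<Sum>e\<in>UNIV.
      (of_real (riem_up h y a b d e) * herm (\<xi> $ b) (\<xi> $ e)) *s (\<xi> $ d))) =
    (\<Sum>\<tau>\<in>Basis. \<Sum>\<rho>\<in>Basis. \<Sum>\<kappa>\<in>Basis. quartic_coeff \<sigma> \<tau> \<rho> \<kappa> *
      Rform h y X (spin_comp \<tau> \<xi>) (spin_comp \<rho> \<xi>) (spin_comp \<kappa> \<xi>))"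
    (is "hform h y X ?C = ?R")
proof -
  define V where "V = (\<chi> a. \<Sum>b\<in>UNIV. \<Sum>d\<in>UNIV. \<Sum>e\<in>UNIV.
     riem h y a b d e * Re (herm \<sigma> (\<xi> $ d) * herm (\<xi> $ b) (\<xi> $ e)))"
  have "?C $ a = (matrix_inv (h y) *v V) $ a" for a
  proof -
    have i: "u \<bullet> \<sigma> = Re (herm \<sigma> u)" for u by (simp add: Re_herm inner_commute)
    have "Re (herm \<sigma> ((of_real r * z) *s u)) = r * Re (herm \<sigma> u * z)" for r :: real and z u
      by (simp add: herm_smult algebra_simps)
    then have "?C $ a = (\<Sum>b\<in>UNIV. \<Sum>d\<in>UNIV. \<Sum>e\<in>UNIV. riem_up h y a b d e * Re (herm \<sigma> (\<xi> $ d) * herm (\<xi> $ b) (\<xi> $ e)))"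
      by (simp add: spin_comp_def i herm_sum del: times_complex.sel)
    also have "\<dots> = (\<Sum>b\<in>UNIV. \<Sum>d\<in>UNIV. \<Sum>e\<in>UNIV. \<Sum>f\<in>UNIV. matrix_inv (h y) $ a $ f *
        (riem h y f b d e * Re (herm \<sigma> (\<xi> $ d) * herm (\<xi> $ b) (\<xi> $ e))))"
      by (simp only: riem_up_def sum_distrib_right mult.assoc)
    also have "\<dots> = (matrix_inv (h y) *v V) $ a"
      by (subst sum1_swap3[symmetric]) (simp only: matrix_vector_mult_def V_def sum_distrib_left vec_lambda_beta)
    finally show ?thesis .
  qed
  then have "?C = matrix_inv (h y) *v V" by (simp add: vec_eq_iff)
  then have "hform h y X ?C = X \<bullet> V"
    by (simp add: hform_def matrix_vector_mul_assoc matrix_mult_matrix_inv[OF det_metric[OF y]])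
  also have "\<dots> = Re (\<Sum>a\<in>UNIV. \<Sum>b\<in>UNIV. \<Sum>d\<in>UNIV. \<Sum>e\<in>UNIV.
      of_real (riem h y a b d e) * herm ((\<chi> a. X $ a *\<^sub>R \<sigma>) $ a) (\<xi> $ d) * herm (\<xi> $ b) (\<xi> $ e))"
  proof -
    have "Re (of_real r * herm (s *\<^sub>R \<sigma>) u * z) = s * (r * Re (herm \<sigma> u * z))" for r s :: real and u z
      by (simp add: linear_cmul[OF linear_herm(2)] algebra_simps)
    then show ?thesis
      by (simp add: V_def inner_vec_def sum_distrib_left)
  qed
  also have "\<dots> = (\<Sum>\<sigma>'\<in>Basis. if \<sigma>' = \<sigma> then ?R else 0)"
    unfolding quartic_components Rform_form4[OF y, symmetric]
  proof (rule sum.cong[OF refl])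
    fix \<sigma>' :: "complex^'s" assume \<sigma>': "\<sigma>' \<in> Basis"
    have "spin_comp \<sigma>' (\<chi> a. X $ a *\<^sub>R \<sigma>) = (if \<sigma>' = \<sigma> then X else 0)"
      using \<sigma> \<sigma>' by (auto simp: spin_comp_def vec_eq_iff inner_Basis)
    then show "(\<Sum>\<tau>\<in>Basis. \<Sum>\<rho>\<in>Basis. \<Sum>\<kappa>\<in>Basis. quartic_coeff \<sigma>' \<tau> \<rho> \<kappa> *
      Rform h y (spin_comp \<sigma>' (\<chi> a. X $ a *\<^sub>R \<sigma>)) (spin_comp \<tau> \<xi>) (spin_comp \<rho> \<xi>) (spin_comp \<kappa> \<xi>)) =
      (if \<sigma>' = \<sigma> then ?R else 0)"
      by (simp add: linear_0[OF linear_Rform(1)[OF y]])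
  qed
  also have "\<dots> = ?R" using \<sigma> by simp
  finally show ?thesis .
qed

text \<open>The metric undoes the sharp, and both sides are linear in X, so coordinate vectors
  suffice; there the left side is a single component of the derivative of R.\<close>

lemma nabla_curvature_components:
  fixes \<xi> :: "complex^'s::finite^'m"
  assumes y: "y \<in> U"
  shows "hform h y (matrix_inv (h y) *v (\<chi> v. Re (\<Sum>a\<in>UNIV. \<Sum>b\<in>UNIV. \<Sum>d\<in>UNIV. \<Sum>e\<in>UNIV.
        of_real (nabla_riem h y v a b d e) * herm (\<xi> $ a) (\<xi> $ d) * herm (\<xi> $ b) (\<xi> $ e)))) X =
    (\<Sum>\<sigma>\<in>Basis. \<Sum>\<tau>\<in>Basis. \<Sum>\<rho>\<in>Basis. \<Sum>\<kappa>\<in>Basis. quartic_coeff \<sigma> \<tau> \<rho> \<kappa> *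
      nabla_Rform h y X (spin_comp \<sigma> \<xi>) (spin_comp \<tau> \<xi>) (spin_comp \<rho> \<xi>) (spin_comp \<kappa> \<xi>))"
    (is "hform h y (_ *v ?V) X = ?R X")
proof -
  have "hform h y (matrix_inv (h y) *v ?V) X = X \<bullet> ?V"
    unfolding hform_sym[OF y, of _ X]
    by (simp add: hform_def matrix_vector_mul_assoc matrix_mult_matrix_inv[OF det_metric[OF y]])
  also have "\<dots> = ?R X"
  proof (rule linear_eq_axis[of "\<lambda>X. X \<bullet> ?V"])
    show "linear (\<lambda>X. X \<bullet> ?V)" by (auto intro!: linearI simp: inner_add_left)
    show "linear ?R"
      by (auto intro!: linearI simp: linear_add[OF linear_nabla_Rform(1)[OF y]]
          linear_cmul[OF linear_nabla_Rform(1)[OF y]] sum.distrib sum_distrib_left algebra_simps)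
    show "axis v 1 \<bullet> ?V = ?R (axis v 1)" for v
      unfolding inner_axis' nabla_Rform_form4[OF y]
      by (simp only: vec_lambda_beta quartic_components inner_real_def mult_1_left)
  qed
  finally show ?thesis .
qed

lemma Rop_component:
  assumes y: "y \<in> U"
  shows "Rop h y A B Z $ e = (\<Sum>a\<in>UNIV. \<Sum>b\<in>UNIV. A $ a * (B $ b * (\<Sum>d\<in>UNIV. curv_op h y e d a b * Z $ d)))"
proof -
  have "Rop h y A B Z = (\<Sum>a\<in>UNIV. A $ a *\<^sub>R Rop h y (axis a 1) B Z)"
    by (rule linear_axis_sum[OF linear_Rop(1)[OF y]])
  also have "\<dots> = (\<Sum>a\<in>UNIV. A $ a *\<^sub>R (\<Sum>b\<in>UNIV. B $ b *\<^sub>R Rop h y (axis a 1) (axis b 1) Z))"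
    by (intro sum.cong refl arg_cong2[where f = scaleR] linear_axis_sum[OF linear_Rop(2)[OF y]])
  also have "\<dots> = (\<Sum>a\<in>UNIV. A $ a *\<^sub>R (\<Sum>b\<in>UNIV. B $ b *\<^sub>R (\<Sum>d\<in>UNIV. Z $ d *\<^sub>R Rop h y (axis a 1) (axis b 1) (axis d 1))))"
    by (intro sum.cong refl arg_cong2[where f = scaleR] linear_axis_sum[OF linear_Rop(3)[OF y]])
  finally show ?thesis
    by (simp add: curv_op_eq[OF y] sum_distrib_left mult_ac)
qed

end

text \<open>The real matrix of Clifford multiplication by X, with row \<sigma> and column \<tau>. It
  is constant in space because the spinor bundle is trivialised by parallel spinors.\<close>

definition cliff_coeff :: "('x \<Rightarrow> complex^'s::finite \<Rightarrow> complex^'s) \<Rightarrow> 'x \<Rightarrow> complex^'s \<Rightarrow> complex^'s \<Rightarrow> real" where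
  "cliff_coeff cl X \<sigma> \<tau> = cl X \<tau> \<bullet> \<sigma>"

context
  fixes cl :: "real^'n::finite \<Rightarrow> complex^'s::finite \<Rightarrow> complex^'s"
  assumes cl: "spinor_module cl"
begin

lemma linear_cliff: "linear (cl X)" "linear (\<lambda>X. cl X u)"
proof -
  have *: "Vector_Spaces.linear (*s) (*s) (cl X)" using cl by (simp add: spinor_module_def)
  have "r *\<^sub>R v = complex_of_real r *s v" for r and v :: "complex^'s"
    by (simp add: vec_eq_iff complex_eq_iff)
  then show "linear (cl X)"
    by (auto intro!: linearI simp: vec.linear_add[OF *] vec.linear_scale[OF *])
  show "linear (\<lambda>X. cl X u)" using cl by (simp add: spinor_module_def)
qed

lemma cliff_skew: "cl X u \<bullet> v = - (u \<bullet> cl X v)"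
proof -
  have "herm (cl X u) v = - herm u (cl X v)" using cl by (simp add: spinor_module_def)
  then show ?thesis by (simp add: Re_herm[symmetric])
qed

lemma cliff_coeff_antisym: "cliff_coeff cl X \<tau> \<sigma> = - cliff_coeff cl X \<sigma> \<tau>"
  unfolding cliff_coeff_def by (subst cliff_skew, subst inner_commute, rule refl)

lemma spin_comp_cliff:
  "spin_comp \<sigma> (vs_cliff cl X \<xi>) = (\<Sum>\<tau>\<in>Basis. cliff_coeff cl X \<sigma> \<tau> *\<^sub>R spin_comp \<tau> \<xi>)"
proof -
  have lin: "linear (\<lambda>u. cl X u \<bullet> \<sigma>)"
    by (auto intro!: linearI simp: linear_add[OF linear_cliff(1)] linear_cmul[OF linear_cliff(1)] inner_add_left)
  have "(\<Sum>\<tau>\<in>Basis. (cl X \<tau> \<bullet> \<sigma>) * (u \<bullet> \<tau>)) = cl X u \<bullet> \<sigma>" for u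
    by (subst linear_eq_sum_Basis[OF lin, of u]) (simp add: mult.commute)
  then show ?thesis
    by (simp add: vec_eq_iff spin_comp_def vs_cliff_def cliff_coeff_def)
qed

lemma cliff_bilinear_expand:
  "u \<bullet> cl X v = (\<Sum>\<sigma>\<in>Basis. \<Sum>\<tau>\<in>Basis. (u \<bullet> \<sigma>) * ((v \<bullet> \<tau>) * cliff_coeff cl X \<sigma> \<tau>))"
proof -
  have "u \<bullet> cl X v = (\<Sum>\<sigma>\<in>Basis. (u \<bullet> \<sigma>) *\<^sub>R (\<sigma> \<bullet> cl X v))"
    by (rule linear_eq_sum_Basis) (auto intro!: linearI simp: inner_add_left)
  also have "\<dots> = (\<Sum>\<sigma>\<in>Basis. (u \<bullet> \<sigma>) *\<^sub>R (\<Sum>\<tau>\<in>Basis. (v \<bullet> \<tau>) *\<^sub>R (\<sigma> \<bullet> cl X \<tau>)))"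
    by (intro sum.cong refl arg_cong2[where f = scaleR] linear_eq_sum_Basis)
       (auto intro!: linearI simp: linear_add[OF linear_cliff(1)] linear_cmul[OF linear_cliff(1)] inner_add_right)
  finally show ?thesis
    by (simp add: cliff_coeff_def sum_distrib_left inner_commute)
qed

end

lemma (in chart_metric) curvature_cliff_components:
  fixes \<xi> :: "complex^'s::finite^'m" and df :: "'n::finite \<Rightarrow> real^'m"
  assumes cl: "spinor_module cl" and y: "y \<in> U"
  shows "(\<chi> e. Re (\<Sum>i\<in>UNIV. \<Sum>a\<in>UNIV. \<Sum>b\<in>UNIV. herm (\<xi> $ a) (cl (axis i 1) (\<xi> $ b)) *
        of_real (\<Sum>d\<in>UNIV. curv_op h y e d a b * df i $ d))) =
    (\<Sum>i\<in>UNIV. \<Sum>\<sigma>\<in>Basis. \<Sum>\<tau>\<in>Basis. cliff_coeff cl (axis i 1) \<sigma> \<tau> *\<^sub>R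
       Rop h y (spin_comp \<sigma> \<xi>) (spin_comp \<tau> \<xi>) (df i))"
proof -
  have "Re (herm (\<xi> $ a) (cl X (\<xi> $ b)) * of_real g) = (\<Sum>\<sigma>\<in>Basis. \<Sum>\<tau>\<in>Basis.
     cliff_coeff cl X \<sigma> \<tau> * (spin_comp \<sigma> \<xi> $ a * (spin_comp \<tau> \<xi> $ b * g)))" for a b g X
  proof -
    have "Re (herm (\<xi> $ a) (cl X (\<xi> $ b)) * of_real g) = (\<xi> $ a \<bullet> cl X (\<xi> $ b)) * g"
      by (simp add: Re_herm)
    also have "\<dots> = (\<Sum>\<sigma>\<in>Basis. \<Sum>\<tau>\<in>Basis. ((\<xi> $ a \<bullet> \<sigma>) * ((\<xi> $ b \<bullet> \<tau>) * cliff_coeff cl X \<sigma> \<tau>)) * g)"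
      by (simp only: cliff_bilinear_expand[OF cl] sum_distrib_right)
    finally show ?thesis
      by (simp add: spin_comp_def mult_ac)
  qed
  note e = this
  have "(\<Sum>a\<in>UNIV. \<Sum>b\<in>UNIV. Re (herm (\<xi> $ a) (cl (axis i 1) (\<xi> $ b)) *
        of_real (\<Sum>d\<in>UNIV. curv_op h y e d a b * df i $ d))) =
      (\<Sum>\<sigma>\<in>Basis. \<Sum>\<tau>\<in>Basis. cliff_coeff cl (axis i 1) \<sigma> \<tau> *
       Rop h y (spin_comp \<sigma> \<xi>) (spin_comp \<tau> \<xi>) (df i) $ e)" for i e
    unfolding e Rop_component[OF y] by (subst sum2_swap2) (simp only: sum_distrib_left)
  then show ?thesis
    by (simp only: vec_eq_iff vec_lambda_beta Re_sum sum_component vector_scaleR_component) simp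
qed

section \<open>Change of charts\<close>

lemma covd_cong_open:
  assumes "open S" "x \<in> S" "\<And>y. y \<in> S \<Longrightarrow> f y = g y" "\<And>y. y \<in> S \<Longrightarrow> V y = W y"
  shows "covd h f V x v = covd h g W x v"
  using fderiv_cong_open[of S x f g] fderiv_cong_open[of S x V W] assms
  by (simp add: covd_def)

text \<open>The Koszul formula needs only first derivatives of g, that is, of the pulled-back
  metric. The connection along T is metric and torsion free, so the same combination collapses to
  the right side. Pairing with Z avoids inverting the differential of T.\<close>

lemma isometry_chr:
  assumes g: "chart_metric W g" and T: "chart_map U h V T" and VW: "V \<subseteq> W" and y: "y \<in> V"
    and iso: "\<And>z X Y. z \<in> V \<Longrightarrow> hform g z X Y = hform h (T z) (fderiv T z X) (fderiv T z Y)"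
  shows "hform g y Z (chr g y X Y) =
    hform h (T y) (fderiv T y Z) (covd h T (\<lambda>z. fderiv T z Y) y X)"
proof -
  interpret g: chart_metric W g by fact
  interpret T: chart_map U h V T by fact
  have yW: "y \<in> W" using y VW by auto
  let ?D = "\<lambda>X z. fderiv T z X"
  let ?E = "\<lambda>u X. covd h T (?D X) y u"
  have sym: "?E u X = ?E X u" for u X
    by (rule T.covd_torsion_free[OF y])
  have d: "dform g y u X Y = hform h (T y) (?E u X) (?D Y y) + hform h (T y) (?D X y) (?E u Y)" for u X Y
  proof -
    have "dform g y u X Y = fderiv (\<lambda>z. hform h (T z) (?D X z) (?D Y z)) y u"
      unfolding g.dform_eq[OF yW, symmetric]
      by (subst fderiv_cong_open[OF T.open_S y iso]) auto
    then show ?thesis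
      by (simp add: fderiv_eqI[OF T.hform_pull_derivative[OF y T.smooth_df T.smooth_df]])
  qed
  show ?thesis
    unfolding g.koszul[OF yW] d sym[of Y X] sym[of Z X] sym[of Z Y]
      T.hform_sym[OF T.f_in[OF y], of "?E Y X"] T.hform_sym[OF T.f_in[OF y], of "?E Z X"]
    by simp
qed

text \<open>Chain rule for the field w pushed forward by T. The last summand holds the second
  derivatives of T and is the one that \<open>isometry_chr\<close> matches with the Christoffel term
  of the source chart.\<close>

lemma covd_isometry:
  fixes f :: "'x::euclidean_space \<Rightarrow> real^'m::finite"
  assumes T: "chart_map U h V T" and S: "open S" "x \<in> S" and f: "smooth_on S f" "f ` S \<subseteq> V"
    and w: "smooth_on S w"
  shows "covd h (\<lambda>x. T (f x)) (\<lambda>x. fderiv T (f x) (w x)) x v =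
    fderiv T (f x) (fderiv w x v)
    + covd h T (\<lambda>z. fderiv T z (w x)) (f x) (fderiv f x v)"
proof -
  interpret T: chart_map U h V T by fact
  have fx: "f x \<in> V" using S f by auto
  note df = smooth_on_has_derivative[OF f(1) S(2)]
  have "fderiv (\<lambda>x. T (f x)) x v = fderiv T (f x) (fderiv f x v)"
    using has_derivative_compose[OF df smooth_on_has_derivative[OF T.smooth_f fx]]
    by (simp add: fderiv_eqI)
  moreover have "linear (fderiv T z)" if "z \<in> V" for z
    by (rule linear_frechet_derivative[OF smooth_on_differentiable[OF T.smooth_f that]])
  from has_derivative_linear_field[OF df smooth_on_has_derivative[OF w S(2)],
      where T = "\<lambda>z. fderiv T z", OF this T.open_S fx smooth_on_differentiable[OF T.smooth_df fx]]
  have "fderiv (\<lambda>x. fderiv T (f x) (w x)) x v =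
     fderiv (\<lambda>z. fderiv T z (w x)) (f x) (fderiv f x v)
     + fderiv T (f x) (fderiv w x v)"
    by (simp add: fderiv_eqI)
  ultimately show ?thesis
    by (simp add: covd_def)
qed

section \<open>Quadratic forms of a map and a vector spinor, and their invariance\<close>

locale spinor_map =
  fixes N :: "('p, 'c, 'm::finite) riem_data"
    and cl :: "real^'n::finite \<Rightarrow> complex^'s::finite \<Rightarrow> complex^'s"
    and \<phi> :: "real^'n \<Rightarrow> 'p"
    and \<psi> :: "'c \<Rightarrow> real^'n \<Rightarrow> complex^'s^'m"
  assumes N: "riemannian_manifold N" and cl: "spinor_module cl"
    and \<phi>: "smooth_map N \<phi>" and \<psi>: "smooth_vector_spinor N \<phi> \<psi>"
begin

lemma chart_metric: "c \<in> charts N \<Longrightarrow> chart_metric (cmap N c ` cdom N c) (metric N c)"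
  using N by unfold_locales (auto simp: riemannian_manifold_def)

lemma open_chart_preimage: "c \<in> charts N \<Longrightarrow> open (\<phi> -` cdom N c)"
  using N \<phi> unfolding riemannian_manifold_def smooth_map_def
  by (auto simp: continuous_map_def vimage_def)

lemma chart_map:
  assumes c: "c \<in> charts N"
  shows "chart_map (cmap N c ` cdom N c) (metric N c) (\<phi> -` cdom N c) (cmap N c \<circ> \<phi>)"
proof -
  interpret chart_metric "cmap N c ` cdom N c" "metric N c" by (rule chart_metric[OF c])
  show ?thesis
    using open_chart_preimage[OF c] \<phi> c by unfold_locales (auto simp: smooth_map_def)
qed

lemma smooth_spinor: "c \<in> charts N \<Longrightarrow> smooth_on (\<phi> -` cdom N c) (\<psi> c)"
  using \<psi> by (simp add: smooth_vector_spinor_def)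

lemma smooth_spinor_comp:
  "c \<in> charts N \<Longrightarrow> smooth_on (\<phi> -` cdom N c) (\<lambda>x. spin_comp \<sigma> (\<psi> c x))"
  by (rule smooth_spin_comp[OF open_chart_preimage smooth_spinor])

lemma cov_deriv_real: "cov_deriv N \<phi> c V x v = covd (metric N c) (cmap N c \<circ> \<phi>) V x v"
  by (simp add: cov_deriv_def covd_def chr_def dmap_def vec_eq_iff)

lemma spin_comp_cov_deriv:
  fixes W :: "real^'n \<Rightarrow> complex^'s^'m"
  assumes "W differentiable (at x)"
  shows "spin_comp \<sigma> (cov_deriv N \<phi> c W x v) =
    covd (metric N c) (cmap N c \<circ> \<phi>) (\<lambda>x. spin_comp \<sigma> (W x)) x v"
proof -
  have "bounded_linear (spin_comp \<sigma> :: complex^'s^'m \<Rightarrow> real^'m)"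
    using linear_spin_comp linear_conv_bounded_linear by blast
  then show ?thesis
    by (simp add: cov_deriv_def covd_def linear_add[OF linear_spin_comp] fderiv_linear[OF _ assms])
       (simp add: chr_def dmap_def vec_eq_iff spin_comp_def inner_sum_left)
qed

lemma tinner_eq: "tinner N \<phi> c x V W = hform (metric N c) (cmap N c (\<phi> x)) V W"
  by (simp add: tinner_def met_def hform_def inner_vec_def matrix_vector_mult_def sum_distrib_left mult_ac)

lemma vsinner_eq:
  fixes \<xi> \<eta> :: "complex^'s^'m"
  shows "vsinner N \<phi> c x \<xi> \<eta> = (\<Sum>\<sigma>\<in>Basis. hform (metric N c) (cmap N c (\<phi> x)) (spin_comp \<sigma> \<xi>) (spin_comp \<sigma> \<eta>))"
proof -
  have "Re (of_real r * herm u v) = (\<Sum>\<sigma>\<in>Basis. (u \<bullet> \<sigma>) * (r * (v \<bullet> \<sigma>)))" for r and u v :: "complex^'s"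
    by (simp add: Re_herm euclidean_inner[of u v] sum_distrib_left mult_ac)
  then have "vsinner N \<phi> c x \<xi> \<eta> = (\<Sum>a\<in>UNIV. \<Sum>b\<in>UNIV. \<Sum>\<sigma>\<in>Basis.
      (\<xi> $ a \<bullet> \<sigma>) * (met N \<phi> c x $ a $ b * (\<eta> $ b \<bullet> \<sigma>)))"
    by (simp add: vsinner_def)
  also have "\<dots> = (\<Sum>a\<in>UNIV. \<Sum>\<sigma>\<in>Basis. \<Sum>b\<in>UNIV.
      (\<xi> $ a \<bullet> \<sigma>) * (met N \<phi> c x $ a $ b * (\<eta> $ b \<bullet> \<sigma>)))"
    by (rule sum.cong[OF refl], rule sum.swap)
  also have "\<dots> = (\<Sum>\<sigma>\<in>Basis. \<Sum>a\<in>UNIV. \<Sum>b\<in>UNIV.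
      (\<xi> $ a \<bullet> \<sigma>) * (met N \<phi> c x $ a $ b * (\<eta> $ b \<bullet> \<sigma>)))"
    by (rule sum.swap)
  finally show ?thesis
    by (simp add: met_def hform_def inner_vec_def matrix_vector_mult_def sum_distrib_left spin_comp_def)
qed

definition dphi_form :: "'c \<Rightarrow> real^'n \<Rightarrow> real^'n \<Rightarrow> real^'n \<Rightarrow> real" where
  "dphi_form c u v x = tinner N \<phi> c x (dmap N \<phi> c x u) (dmap N \<phi> c x v)"

definition spinor_form :: "'c \<Rightarrow> real^'n \<Rightarrow> real^'n \<Rightarrow> real^'n \<Rightarrow> real" where
  "spinor_form c u v x = vsinner N \<phi> c x (\<psi> c x) (vs_cliff cl u (cov_deriv N \<phi> c (\<psi> c) x v))"

lemma dphi_form_eq: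
  "dphi_form c u v x = hform (metric N c) ((cmap N c \<circ> \<phi>) x)
     (fderiv (cmap N c \<circ> \<phi>) x u) (fderiv (cmap N c \<circ> \<phi>) x v)"
  by (simp add: dphi_form_def tinner_eq dmap_def)

lemma spinor_form_eq:
  assumes "c \<in> charts N" "\<phi> x \<in> cdom N c"
  shows "spinor_form c u v x = (\<Sum>\<sigma>\<in>Basis. \<Sum>\<tau>\<in>Basis. cliff_coeff cl u \<sigma> \<tau> *
     hform (metric N c) ((cmap N c \<circ> \<phi>) x) (spin_comp \<sigma> (\<psi> c x))
       (covd (metric N c) (cmap N c \<circ> \<phi>) (\<lambda>x. spin_comp \<tau> (\<psi> c x)) x v))"
proof -
  have "\<psi> c differentiable (at x)"
    using smooth_on_differentiable[OF smooth_spinor[OF assms(1)]] assms(2) by auto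
  then show ?thesis
    by (simp add: spinor_form_def vsinner_eq spin_comp_cliff[OF cl] spin_comp_cov_deriv
        linear_sum[OF linear_hform(1)] hform_linear)
qed

lemma smooth_dphi_form:
  assumes c: "c \<in> charts N" shows "smooth_on (\<phi> -` cdom N c) (dphi_form c u v)"
proof -
  interpret chart_map "cmap N c ` cdom N c" "metric N c" "\<phi> -` cdom N c" "cmap N c \<circ> \<phi>"
    by (rule chart_map[OF c])
  show ?thesis
    unfolding dphi_form_eq[abs_def]
    by (intro smooth_on_hform open_S smooth_f f_image smooth_df)
qed

lemma smooth_spinor_form:
  assumes c: "c \<in> charts N" shows "smooth_on (\<phi> -` cdom N c) (spinor_form c u v)"
proof -
  interpret chart_map "cmap N c ` cdom N c" "metric N c" "\<phi> -` cdom N c" "cmap N c \<circ> \<phi>"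
    by (rule chart_map[OF c])
  show ?thesis
    by (subst smooth_on_cong[OF open_S spinor_form_eq[OF c]], simp)
       (intro smooth_on_sum smooth_on_mult smooth_on_const smooth_on_hform open_S smooth_f f_image
         smooth_covd smooth_spinor_comp c)
qed

lemma cmap_inj: "c \<in> charts N \<Longrightarrow> inj_on (cmap N c) (cdom N c)"
proof -
  assume c: "c \<in> charts N"
  then have "homeomorphic_map (subtopology (mtop N) (cdom N c))
      (subtopology euclidean (cmap N c ` cdom N c)) (cmap N c)" and sub: "cdom N c \<subseteq> topspace (mtop N)"
    using N by (auto simp: riemannian_manifold_def)
  then show ?thesis
    using homeomorphic_imp_injective_map[of "subtopology (mtop N) (cdom N c)"]
    by (metis inf.absorb_iff2 topspace_subtopology)
qed

lemma open_overlap: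
  assumes "c \<in> charts N" "c' \<in> charts N"
  shows "open (cmap N c ` (cdom N c \<inter> cdom N c'))"
proof -
  have hm: "homeomorphic_map (subtopology (mtop N) (cdom N c))
      (subtopology euclidean (cmap N c ` cdom N c)) (cmap N c)"
    and o: "open (cmap N c ` cdom N c)" and c': "openin (mtop N) (cdom N c')"
    using N assms by (auto simp: riemannian_manifold_def)
  have "openin (subtopology (mtop N) (cdom N c)) (cdom N c \<inter> cdom N c')"
    using openin_subtopology_Int2[OF c'] .
  then have "openin (subtopology euclidean (cmap N c ` cdom N c)) (cmap N c ` (cdom N c \<inter> cdom N c'))"
    using homeomorphic_imp_open_map[OF hm] by (auto simp: open_map_def)
  then show ?thesis
    using openin_open_eq[OF o] by blast
qed

lemma transition_cmap:
  "c \<in> charts N \<Longrightarrow> p \<in> cdom N c \<Longrightarrow> transition N c c' (cmap N c p) = cmap N c' p"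
  by (simp add: transition_def inv_into_f_f[OF cmap_inj])

lemma transition_chart_map:
  assumes c: "c \<in> charts N" "c' \<in> charts N"
  shows "chart_map (cmap N c' ` cdom N c') (metric N c') (cmap N c ` (cdom N c \<inter> cdom N c')) (transition N c c')"
proof -
  interpret chart_metric "cmap N c' ` cdom N c'" "metric N c'" by (rule chart_metric[OF c(2)])
  show ?thesis
    using open_overlap[OF c] N c transition_cmap[OF c(1)]
    by unfold_locales (auto simp: riemannian_manifold_def)
qed

lemma transition_isometry:
  assumes c: "c \<in> charts N" "c' \<in> charts N" and y: "y \<in> cmap N c ` (cdom N c \<inter> cdom N c')"
  shows "hform (metric N c) y X Y = hform (metric N c') (transition N c c' y)
    (fderiv (transition N c c') y X) (fderiv (transition N c c') y Y)"
    and "jacobian (transition N c c') (at y) *v X = fderiv (transition N c c') y X"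
proof -
  let ?J = "jacobian (transition N c c') (at y)"
  interpret T: chart_map "cmap N c' ` cdom N c'" "metric N c'" "cmap N c ` (cdom N c \<inter> cdom N c')" "transition N c c'"
    by (rule transition_chart_map[OF c])
  have J: "?J *v X = fderiv (transition N c c') y X" for X
    using linear_frechet_derivative[OF smooth_on_differentiable[OF T.smooth_f y]]
    by (simp add: jacobian_def matrix_works)
  then show "?J *v X = fderiv (transition N c c') y X" .
  have tr: "u \<bullet> (transpose ?J *v v) = (?J *v u) \<bullet> v" for u v
    by (metis dot_lmul_matrix vector_transpose_matrix)
  have "metric N c y = transpose ?J ** metric N c' (transition N c c' y) ** ?J"
    using N c y unfolding riemannian_manifold_def by blast
  then show "hform (metric N c) y X Y = hform (metric N c') (transition N c c' y)
    (fderiv (transition N c c') y X) (fderiv (transition N c c') y Y)"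
    unfolding J[symmetric] hform_def by (simp only: matrix_vector_mul_assoc[symmetric] tr)
qed

text \<open>On the overlap the coordinates of \<open>\<phi>\<close> and the components of the spinor
  change by T and its differential. The second derivatives of T that enter the covariant derivative
  are absorbed by the Christoffel symbols. Clifford multiplication acts on the spinor index alone,
  so its coefficients are the same in both charts.\<close>

lemma forms_chart_invariant:
  assumes c: "c \<in> charts N" "c' \<in> charts N" and x: "\<phi> x \<in> cdom N c" "\<phi> x \<in> cdom N c'"
  shows "dphi_form c u v x = dphi_form c' u v x" and "spinor_form c u v x = spinor_form c' u v x"
proof -
  let ?T = "transition N c c'" and ?f = "cmap N c \<circ> \<phi>" and ?f' = "cmap N c' \<circ> \<phi>"
  let ?h = "metric N c" and ?h' = "metric N c'" and ?V = "cmap N c ` (cdom N c \<inter> cdom N c')"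
  let ?DT = "\<lambda>y X. fderiv ?T y X"
  interpret f: chart_map "cmap N c ` cdom N c" ?h "\<phi> -` cdom N c" ?f by (rule chart_map[OF c(1)])
  interpret T: chart_map "cmap N c' ` cdom N c'" ?h' ?V ?T by (rule transition_chart_map[OF c])
  define S where "S = \<phi> -` cdom N c \<inter> \<phi> -` cdom N c'"
  have S: "open S" "x \<in> S" "S \<subseteq> \<phi> -` cdom N c" "?f ` S \<subseteq> ?V"
    using x by (auto simp: S_def intro!: open_Int open_chart_preimage c)
  have sf: "smooth_on S ?f" by (rule smooth_on_subset[OF f.smooth_f S(3)])
  have fx: "?f x \<in> ?V" using S by blast
  have f': "?f' z = ?T (?f z)" if "z \<in> S" for z
    using that transition_cmap[OF c(1)] by (auto simp: S_def)
  have df': "fderiv ?f' x v = ?DT (?f x) (fderiv ?f x v)" for v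
  proof -
    have "((\<lambda>z. ?T (?f z)) has_derivative (\<lambda>v. ?DT (?f x) (fderiv ?f x v))) (at x)"
      using has_derivative_compose[OF smooth_on_has_derivative[OF sf S(2)] smooth_on_has_derivative[OF T.smooth_f fx]] .
    then show ?thesis
      using fderiv_cong_open[OF S(1,2), of ?f' "\<lambda>z. ?T (?f z)"] f' fderiv_eqI by metis
  qed
  have iso: "hform ?h (?f x) X Y = hform ?h' (?f' x) (?DT (?f x) X) (?DT (?f x) Y)" for X Y
    unfolding f'[OF S(2)] by (rule transition_isometry(1)[OF c fx])
  show "dphi_form c u v x = dphi_form c' u v x"
    unfolding dphi_form_eq iso df' ..
  let ?w = "\<lambda>\<sigma> x. spin_comp \<sigma> (\<psi> c x)" and ?w' = "\<lambda>\<sigma> x. spin_comp \<sigma> (\<psi> c' x)"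
  have sw: "smooth_on S (?w \<sigma>)" for \<sigma>
    by (rule smooth_on_subset[OF smooth_spinor_comp[OF c(1)] S(3)])
  have w': "?w' \<sigma> z = ?DT (?f z) (?w \<sigma> z)" if z: "z \<in> S" for \<sigma> z
  proof -
    have fz: "?f z \<in> ?V" using S z by blast
    have "\<psi> c' z $ a = (\<Sum>b\<in>UNIV. jacobian ?T (at (?f z)) $ a $ b *\<^sub>R \<psi> c z $ b)" for a
      using \<psi> c z by (auto simp: smooth_vector_spinor_def S_def)
    then have "?w' \<sigma> z $ a = (jacobian ?T (at (?f z)) *v ?w \<sigma> z) $ a" for a
      by (simp add: spin_comp_def matrix_vector_mult_def inner_sum_left)
    then have "?w' \<sigma> z = jacobian ?T (at (?f z)) *v ?w \<sigma> z"
      unfolding vec_eq_iff by blast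
    then show ?thesis
      using transition_isometry(2)[OF c fz] by simp
  qed
  have "hform ?h' (?f' x) (?w' \<sigma> x) (covd ?h' ?f' (?w' \<tau>) x v) =
      hform ?h (?f x) (?w \<sigma> x) (covd ?h ?f (?w \<tau>) x v)" for \<sigma> \<tau>
  proof -
    have "covd ?h' ?f' (?w' \<tau>) x v = covd ?h' (\<lambda>z. ?T (?f z)) (\<lambda>z. ?DT (?f z) (?w \<tau> z)) x v"
      by (rule covd_cong_open[OF S(1,2)]) (use f' w' in auto)
    also have "\<dots> = ?DT (?f x) (fderiv (?w \<tau>) x v) +
       covd ?h' ?T (\<lambda>z. ?DT z (?w \<tau> x)) (?f x) (fderiv ?f x v)"
      by (rule covd_isometry[OF T.chart_map_axioms S(1,2) sf S(4) sw])
    finally have eq: "covd ?h' ?f' (?w' \<tau>) x v = \<dots>" .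
    have chr: "hform ?h (?f x) (?w \<sigma> x) (chr ?h (?f x) X (?w \<tau> x)) =
       hform ?h' (?f' x) (?w' \<sigma> x) (covd ?h' ?T (\<lambda>z. ?DT z (?w \<tau> x)) (?f x) X)" for X
      unfolding f'[OF S(2)] w'[OF S(2)]
      by (rule isometry_chr[OF f.chart_metric_axioms T.chart_map_axioms _ fx transition_isometry(1)[OF c]]) auto
    show ?thesis
      unfolding eq hform_linear covd_def[of ?h] iso[of "?w \<sigma> x" "frechet_derivative _ _ _"]
      by (simp only: chr w'[OF S(2)])
  qed
  then show "spinor_form c u v x = spinor_form c' u v x"
    using spinor_form_eq[OF c(1) x(1)] spinor_form_eq[OF c(2) x(2)] by simp
qed

end

section \<open>The stress tensor of a Dirac-harmonic map\<close>

lemma Ck_on_local: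
  assumes "\<And>x. x \<in> S \<Longrightarrow> \<exists>T. open T \<and> x \<in> T \<and> Ck_on k f T"
  shows "Ck_on k f S"
  using assms
proof (induction k arbitrary: f)
  case 0
  then show ?case
    by (auto intro!: continuous_at_imp_continuous_on) (metis continuous_on_eq_continuous_at)
next
  case (Suc k)
  have "f differentiable (at x)" if "x \<in> S" for x
    using Suc.prems[OF that] by (metis Ck_on.simps(2))
  moreover have "Ck_on k (\<lambda>x. fderiv f x v) S" for v
  proof (rule Suc.IH)
    fix x assume "x \<in> S"
    then obtain T where "open T" "x \<in> T" "Ck_on (Suc k) f T"
      using Suc.prems by blast
    then show "\<exists>T. open T \<and> x \<in> T \<and> Ck_on k (\<lambda>x. fderiv f x v) T"
      by (intro exI[of _ T]) simp
  qed
  ultimately show ?case by simp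
qed

lemma smooth_on_local:
  assumes "\<And>x. x \<in> S \<Longrightarrow> \<exists>T. open T \<and> x \<in> T \<and> smooth_on T f"
  shows "smooth_on S f"
  unfolding smooth_on_def
proof
  show "Ck_on k f S" for k
    by (rule Ck_on_local) (metis assms smooth_on_def)
qed

locale dirac_harmonic = spinor_map N cl \<phi> \<psi>
  for N :: "('p, 'c, 'm::finite) riem_data"
    and cl :: "real^'n::finite \<Rightarrow> complex^'s::finite \<Rightarrow> complex^'s"
    and \<phi> :: "real^'n \<Rightarrow> 'p"
    and \<psi> :: "'c \<Rightarrow> real^'n \<Rightarrow> complex^'s^'m" +
  assumes dh: "dirac_harmonic_curv cl N \<phi> \<psi>"
begin

text \<open>The Dirac equation in the shape of the hypothesis \<open>dirac\<close> of
  \<open>stress_divergence\<close>.\<close>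

lemma dirac_component:
  assumes c: "c \<in> charts N" and x: "\<phi> x \<in> cdom N c" and \<sigma>: "\<sigma> \<in> Basis"
  shows "hform (metric N c) ((cmap N c \<circ> \<phi>) x) X (\<Sum>b\<in>Basis. \<Sum>\<tau>\<in>Basis. cliff_coeff cl b \<sigma> \<tau> *\<^sub>R
      covd (metric N c) (cmap N c \<circ> \<phi>) (\<lambda>x. spin_comp \<tau> (\<psi> c x)) x b) =
    1/3 * (\<Sum>\<tau>\<in>Basis. \<Sum>\<rho>\<in>Basis. \<Sum>\<kappa>\<in>Basis. quartic_coeff \<sigma> \<tau> \<rho> \<kappa> *
      Rform (metric N c) ((cmap N c \<circ> \<phi>) x) X (spin_comp \<tau> (\<psi> c x)) (spin_comp \<rho> (\<psi> c x)) (spin_comp \<kappa> (\<psi> c x)))"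
proof -
  interpret chart_metric "cmap N c ` cdom N c" "metric N c" by (rule chart_metric[OF c])
  have fx: "cmap N c (\<phi> x) \<in> cmap N c ` cdom N c" using x by auto
  have d: "\<psi> c differentiable (at x)"
    using smooth_on_differentiable[OF smooth_spinor[OF c]] x by auto
  have "(\<Sum>b\<in>Basis. \<Sum>\<tau>\<in>Basis. cliff_coeff cl b \<sigma> \<tau> *\<^sub>R
      covd (metric N c) (cmap N c \<circ> \<phi>) (\<lambda>x. spin_comp \<tau> (\<psi> c x)) x b) = spin_comp \<sigma> (dirac cl N \<phi> c (\<psi> c) x)"
    by (simp add: dirac_def linear_sum[OF linear_spin_comp] spin_comp_cliff[OF cl] spin_comp_cov_deriv[OF d]
        sum_Basis_axis)
  also have "dirac cl N \<phi> c (\<psi> c) x = (1/3) *\<^sub>R curv_cubic N \<phi> c x (\<psi> c x)"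
    using dh c x by (simp add: dirac_harmonic_curv_def)
  finally have eq: "(\<Sum>b\<in>Basis. \<Sum>\<tau>\<in>Basis. cliff_coeff cl b \<sigma> \<tau> *\<^sub>R
      covd (metric N c) (cmap N c \<circ> \<phi>) (\<lambda>x. spin_comp \<tau> (\<psi> c x)) x b) = spin_comp \<sigma> \<dots>" .
  show ?thesis
    unfolding eq curv_cubic_def linear_cmul[OF linear_spin_comp] hform_linear o_apply
      curvature_cubic_components[OF fx \<sigma>] ..
qed

text \<open>The Dirac equation paired with the spinor itself; 3 is the inverse of its coefficient
  1/3. Multiplied by the 1/6 of the energy density this yields half the trace of
  \<open>spinor_form\<close>.\<close>

lemma curv_quartic_eq:
  assumes c: "c \<in> charts N" and x: "\<phi> x \<in> cdom N c"
  shows "curv_quartic N \<phi> c x (\<psi> c x) = 3 * (\<Sum>i\<in>UNIV. spinor_form c (axis i 1) (axis i 1) x)"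
proof -
  interpret chart_metric "cmap N c ` cdom N c" "metric N c" by (rule chart_metric[OF c])
  let ?h = "metric N c" and ?f = "cmap N c \<circ> \<phi>" and ?w = "\<lambda>\<sigma>. spin_comp \<sigma> (\<psi> c x)"
  let ?n = "\<lambda>\<tau> b. covd ?h ?f (\<lambda>x. spin_comp \<tau> (\<psi> c x)) x b"
  have fx: "?f x \<in> cmap N c ` cdom N c" using x by auto
  have "curv_quartic N \<phi> c x (\<psi> c x) = (\<Sum>\<sigma>\<in>Basis. \<Sum>\<tau>\<in>Basis. \<Sum>\<rho>\<in>Basis. \<Sum>\<kappa>\<in>Basis.
      quartic_coeff \<sigma> \<tau> \<rho> \<kappa> * Rform ?h (?f x) (?w \<sigma>) (?w \<tau>) (?w \<rho>) (?w \<kappa>))"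
    using curvature_quartic_components[OF fx] by (simp add: curv_quartic_def)
  also have "\<dots> = (\<Sum>\<sigma>\<in>Basis. 3 * hform ?h (?f x) (?w \<sigma>) (\<Sum>b\<in>Basis. \<Sum>\<tau>\<in>Basis. cliff_coeff cl b \<sigma> \<tau> *\<^sub>R ?n \<tau> b))"
    by (intro sum.cong refl, subst dirac_component[OF c x], assumption) simp
  also have "\<dots> = 3 * (\<Sum>b\<in>Basis. \<Sum>\<sigma>\<in>Basis. \<Sum>\<tau>\<in>Basis. cliff_coeff cl b \<sigma> \<tau> * hform ?h (?f x) (?w \<sigma>) (?n \<tau> b))"
    unfolding linear_sum[OF linear_hform(1)] hform_linear sum_distrib_left by (rule sum.swap)
  finally show ?thesis
    by (simp add: sum_Basis_axis spinor_form_eq[OF c x])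
qed

text \<open>The tension equation in the shape of the hypothesis \<open>tens\<close> of
  \<open>stress_divergence\<close>.\<close>

lemma tension_component:
  assumes c: "c \<in> charts N" and x: "\<phi> x \<in> cdom N c"
  shows "hform (metric N c) ((cmap N c \<circ> \<phi>) x)
      (\<Sum>b\<in>Basis. covd (metric N c) (cmap N c \<circ> \<phi>) (\<lambda>y. fderiv (cmap N c \<circ> \<phi>) y b) x b) X =
    1/2 * (\<Sum>b\<in>Basis. \<Sum>\<sigma>\<in>Basis. \<Sum>\<tau>\<in>Basis. cliff_coeff cl b \<sigma> \<tau> *
      hform (metric N c) ((cmap N c \<circ> \<phi>) x) (Rop (metric N c) ((cmap N c \<circ> \<phi>) x) (spin_comp \<sigma> (\<psi> c x))
        (spin_comp \<tau> (\<psi> c x)) (fderiv (cmap N c \<circ> \<phi>) x b)) X)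
    - 1/12 * (\<Sum>\<sigma>\<in>Basis. \<Sum>\<tau>\<in>Basis. \<Sum>\<rho>\<in>Basis. \<Sum>\<kappa>\<in>Basis. quartic_coeff \<sigma> \<tau> \<rho> \<kappa> *
      nabla_Rform (metric N c) ((cmap N c \<circ> \<phi>) x) X (spin_comp \<sigma> (\<psi> c x)) (spin_comp \<tau> (\<psi> c x))
        (spin_comp \<rho> (\<psi> c x)) (spin_comp \<kappa> (\<psi> c x)))"
proof -
  interpret chart_metric "cmap N c ` cdom N c" "metric N c" by (rule chart_metric[OF c])
  let ?h = "metric N c" and ?f = "cmap N c \<circ> \<phi>"
  have fx: "?f x \<in> cmap N c ` cdom N c" using x by auto
  have t0: "(\<Sum>b\<in>Basis. covd ?h ?f (\<lambda>y. fderiv ?f y b) x b) = tension N \<phi> c x"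
    by (simp add: tension_def cov_deriv_real sum_Basis_axis dmap_def[abs_def])
  have t1: "tension N \<phi> c x = (1/2) *\<^sub>R curv_dmap cl N \<phi> c x (\<psi> c x) - (1/12) *\<^sub>R nabla_curv_sharp N \<phi> c x (\<psi> c x)"
    using dh c x by (simp add: dirac_harmonic_curv_def)
  have t2: "curv_dmap cl N \<phi> c x (\<psi> c x) = (\<Sum>b\<in>Basis. \<Sum>\<sigma>\<in>Basis. \<Sum>\<tau>\<in>Basis. cliff_coeff cl b \<sigma> \<tau> *\<^sub>R
      Rop ?h (?f x) (spin_comp \<sigma> (\<psi> c x)) (spin_comp \<tau> (\<psi> c x)) (fderiv ?f x b))"
    using curvature_cliff_components[OF cl fx, of "\<psi> c x" "\<lambda>i. fderiv ?f x (axis i 1)"]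
    by (simp add: curv_dmap_def dmap_def sum_Basis_axis)
  have ns: "hform ?h (?f x) (nabla_curv_sharp N \<phi> c x (\<psi> c x)) X =
    (\<Sum>\<sigma>\<in>Basis. \<Sum>\<tau>\<in>Basis. \<Sum>\<rho>\<in>Basis. \<Sum>\<kappa>\<in>Basis. quartic_coeff \<sigma> \<tau> \<rho> \<kappa> *
      nabla_Rform ?h (?f x) X (spin_comp \<sigma> (\<psi> c x)) (spin_comp \<tau> (\<psi> c x))
        (spin_comp \<rho> (\<psi> c x)) (spin_comp \<kappa> (\<psi> c x)))"
    using nabla_curvature_components[OF fx, of "\<psi> c x" X] by (simp add: nabla_curv_sharp_def met_def)
  show ?thesis
    unfolding t0 t1 t2 hform_linear ns linear_sum[OF linear_hform(2)] ..
qed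

definition stress :: "'c \<Rightarrow> real^'n \<Rightarrow> real^'n \<Rightarrow> real^'n \<Rightarrow> real" where
  "stress c u v x = 2 * dphi_form c u v x + spinor_form c u v x"

lemma smooth_stress: "c \<in> charts N \<Longrightarrow> smooth_on (\<phi> -` cdom N c) (stress c u v)"
  unfolding stress_def
  by (intro smooth_on_add smooth_on_mult smooth_on_const smooth_dphi_form smooth_spinor_form open_chart_preimage)

lemma stress_chart_divergence:
  assumes c: "c \<in> charts N" and x: "\<phi> x \<in> cdom N c"
  shows "(\<Sum>i\<in>UNIV. fderiv (stress c (axis i 1) v) x (axis i 1)) =
    fderiv (\<lambda>x. 1/2 * (\<Sum>i\<in>UNIV. stress c (axis i 1) (axis i 1) x)) x v"
proof -
  interpret chart_map "cmap N c ` cdom N c" "metric N c" "\<phi> -` cdom N c" "cmap N c \<circ> \<phi>"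
    by (rule chart_map[OF c])
  let ?S = "\<phi> -` cdom N c"
  let ?h = "metric N c" and ?f = "cmap N c \<circ> \<phi>" and ?w = "\<lambda>\<sigma> x. spin_comp \<sigma> (\<psi> c x)"
  let ?P = "\<lambda>u v x. hform ?h (?f x) (fderiv ?f x u) (fderiv ?f x v)"
  let ?B = "\<lambda>u v x. \<Sum>\<sigma>\<in>Basis. \<Sum>\<tau>\<in>Basis. cliff_coeff cl u \<sigma> \<tau> * hform ?h (?f x) (?w \<sigma> x) (covd ?h ?f (?w \<tau>) x v)"
  have x': "x \<in> ?S" using x by simp
  have eq: "stress c u v y = 2 * ?P u v y + ?B u v y" if "y \<in> ?S" for u v y
    using that by (simp only: stress_def dphi_form_eq spinor_form_eq[OF c] vimage_eq)
  have "(\<Sum>i\<in>UNIV. fderiv (stress c (axis i 1) v) x (axis i 1)) =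
      (\<Sum>b\<in>Basis. fderiv (\<lambda>y. 2 * ?P b v y + ?B b v y) x b)"
    unfolding sum_Basis_axis
    by (intro sum.cong refl fun_cong[OF fderiv_cong_open[OF open_S x' eq]])
  also have "\<dots> = fderiv (\<lambda>y. (\<Sum>b\<in>Basis. ?P b b y) + 1/2 * (\<Sum>b\<in>Basis. ?B b b y)) x v"
    by (rule stress_divergence[where k = quartic_coeff and m = "cliff_coeff cl" and w = ?w and I = Basis],
        rule smooth_spinor_comp[OF c], rule cliff_coeff_antisym[OF cl], rule quartic_coeff_sym(1),
        rule quartic_coeff_sym(2), rule dirac_component[OF c], simp, assumption,
        rule tension_component[OF c], simp, rule x')
  also have "\<dots> = fderiv (\<lambda>x. 1/2 * (\<Sum>i\<in>UNIV. stress c (axis i 1) (axis i 1) x)) x v"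
    by (rule fun_cong[OF fderiv_cong_open[OF open_S x']])
       (simp only: eq sum.distrib sum_Basis_axis sum_distrib_left[symmetric], simp)
  finally show ?thesis .
qed

lemma chart_at: "chart_at N (\<phi> x) \<in> charts N" "\<phi> x \<in> cdom N (chart_at N (\<phi> x))"
proof -
  have "\<phi> x \<in> topspace (mtop N)"
    using \<phi> by (auto simp: smooth_map_def continuous_map_def)
  then have "\<exists>c. c \<in> charts N \<and> \<phi> x \<in> cdom N c"
    using N by (auto simp: riemannian_manifold_def)
  from someI_ex[OF this] show "chart_at N (\<phi> x) \<in> charts N" "\<phi> x \<in> cdom N (chart_at N (\<phi> x))"
    by (auto simp: chart_at_def)
qed

text \<open>The chart picked by \<open>chart_at\<close> may change abruptly with x. Invariance makes
  the value agree, on a whole chart preimage, with \<open>stress c\<close> for one fixed c, and this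
  is how smoothness and the divergence identity carry over.\<close>

definition gstress :: "real^'n \<Rightarrow> real^'n \<Rightarrow> real^'n \<Rightarrow> real" where
  "gstress u v x = stress (chart_at N (\<phi> x)) u v x"

lemma gstress_eq: "c \<in> charts N \<Longrightarrow> \<phi> x \<in> cdom N c \<Longrightarrow> gstress u v x = stress c u v x"
  unfolding gstress_def stress_def
  using forms_chart_invariant[OF chart_at(1) _ chart_at(2)] by metis

lemma smooth_gstress: "smooth_on UNIV (gstress u v)"
proof (rule smooth_on_local)
  fix x :: "real^'n"
  let ?c = "chart_at N (\<phi> x)"
  have "smooth_on (\<phi> -` cdom N ?c) (gstress u v)"
    using smooth_on_cong[OF open_chart_preimage[OF chart_at(1)], of x "gstress u v" "stress ?c u v"]
      gstress_eq[OF chart_at(1)] smooth_stress[OF chart_at(1)] by auto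
  then show "\<exists>T. open T \<and> x \<in> T \<and> smooth_on T (gstress u v)"
    using open_chart_preimage[OF chart_at(1)] chart_at(2) by blast
qed

lemma energy_density_eq: "energy_density N \<phi> \<psi> x = 1/2 * (\<Sum>i\<in>UNIV. gstress (axis i 1) (axis i 1) x)"
proof -
  let ?c = "chart_at N (\<phi> x)"
  have "energy_density N \<phi> \<psi> x =
    (\<Sum>i\<in>UNIV. dphi_form ?c (axis i 1) (axis i 1) x) + 1/2 * (\<Sum>i\<in>UNIV. spinor_form ?c (axis i 1) (axis i 1) x)"
    using curv_quartic_eq[OF chart_at] by (simp add: energy_density_def Let_def dphi_form_def)
  then show ?thesis
    by (simp add: gstress_def stress_def sum.distrib sum_distrib_left[symmetric])
qed

lemma directional_density_eq: "directional_density cl N \<phi> \<psi> x v = gstress v v x"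
  by (simp add: directional_density_def Let_def gstress_def stress_def dphi_form_def spinor_form_def)

lemma gstress_divergence:
  "(\<Sum>i\<in>UNIV. fderiv (gstress (axis i 1) v) x (axis i 1)) =
    fderiv (energy_density N \<phi> \<psi>) x v"
proof -
  let ?c = "chart_at N (\<phi> x)" and ?S = "\<phi> -` cdom N (chart_at N (\<phi> x))"
  have S: "open ?S" "x \<in> ?S" using open_chart_preimage[OF chart_at(1)] chart_at(2) by auto
  have eq: "gstress u v y = stress ?c u v y" if "y \<in> ?S" for u v y
    using gstress_eq[OF chart_at(1)] that by auto
  have "fderiv (energy_density N \<phi> \<psi>) x v =
      fderiv (\<lambda>x. 1/2 * (\<Sum>i\<in>UNIV. stress ?c (axis i 1) (axis i 1) x)) x v"
    by (rule fun_cong[OF fderiv_cong_open[OF S]]) (simp only: energy_density_eq eq)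
  moreover have "fderiv (gstress u v) x = fderiv (stress ?c u v) x" for u v
    by (rule fderiv_cong_open[OF S eq])
  ultimately show ?thesis
    using stress_chart_divergence[OF chart_at, of x v] by simp
qed

text \<open>Allows contraction with the radial field, which is not constant, while derivatives are
  only taken of components with constant u and v.\<close>

lemma linear_gstress: "linear (\<lambda>u. gstress u v x)" "linear (\<lambda>v. gstress u v x)"
proof -
  let ?c = "chart_at N (\<phi> x)"
  let ?h = "metric N ?c" and ?f = "cmap N ?c \<circ> \<phi>"
  interpret chart_map "cmap N ?c ` cdom N ?c" ?h "\<phi> -` cdom N ?c" ?f
    by (rule chart_map[OF chart_at(1)])
  have x: "x \<in> \<phi> -` cdom N ?c" using chart_at(2) by simp
  have f: "linear (fderiv ?f x)"
    by (rule linear_frechet_derivative[OF smooth_on_differentiable[OF smooth_f x]])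
  have w: "linear (fderiv (\<lambda>x. spin_comp \<tau> (\<psi> ?c x)) x)" for \<tau>
    by (rule linear_frechet_derivative[OF smooth_on_differentiable[OF smooth_spinor_comp[OF chart_at(1)] x]])
  have cl1: "cliff_coeff cl (u + v) \<sigma> \<tau> = cliff_coeff cl u \<sigma> \<tau> + cliff_coeff cl v \<sigma> \<tau>"
    "cliff_coeff cl (r *\<^sub>R u) \<sigma> \<tau> = r * cliff_coeff cl u \<sigma> \<tau>" for u v r \<sigma> \<tau>
    by (simp_all add: cliff_coeff_def linear_add[OF linear_cliff(2)[OF cl]] linear_cmul[OF linear_cliff(2)[OF cl]]
        inner_add_left)
  show "linear (\<lambda>u. gstress u v x)" "linear (\<lambda>v. gstress u v x)"
    unfolding gstress_def stress_def dphi_form_eq spinor_form_eq[OF chart_at] covd_def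
    by (rule linearI; simp add: linear_add[OF f] linear_cmul[OF f] linear_add[OF w] linear_cmul[OF w] cl1
        hform_linear chr_linear sum.distrib sum_distrib_left algebra_simps)+
qed

end

section \<open>The divergence theorem with a radial cutoff\<close>

lemma integrable_lborel_bounded_support:
  fixes g :: "'a::euclidean_space \<Rightarrow> real"
  assumes "g \<in> borel_measurable borel" "\<And>x. \<bar>g x\<bar> \<le> B" "\<And>x. x \<notin> cball a r \<Longrightarrow> g x = 0"
  shows "integrable lborel g"
  by (rule integrableI_bounded_set[where A = "cball a r" and B = B])
     (use assms emeasure_bounded_finite[OF bounded_cball] in \<open>auto simp: top.not_eq_extremum\<close>)

text \<open>By Fubini's theorem, the integral of \<open>g\<close> is that of \<open>x \<mapsto> f (x + e) - f x\<close>, which vanishes by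
  translation invariance.\<close>

lemma integral_directional_derivative_eq_0:
  fixes f g :: "'a::euclidean_space \<Rightarrow> real"
  assumes f: "integrable lborel f" "continuous_on UNIV f" and g: "integrable lborel g" "\<And>x. \<bar>g x\<bar> \<le> B"
    and der: "\<And>x. \<exists>T. finite T \<and> (\<forall>t. t \<notin> T \<longrightarrow>
      ((\<lambda>t. f (x + t *\<^sub>R e)) has_real_derivative g (x + t *\<^sub>R e)) (at t))"
  shows "(LINT x|lborel. g x) = 0"
proof -
  have gm [measurable]: "g \<in> borel_measurable borel" using g(1) by simp
  have fm [measurable]: "f \<in> borel_measurable borel" using f(1) by simp
  let ?I = "indicator {0..1::real} :: real \<Rightarrow> real"
  have shift: "integrable lborel (\<lambda>x. k (x + c))" "(LINT x|lborel. k (x + c)) = (LINT x|lborel. k x)"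
    if k: "integrable lborel k" for k :: "'a \<Rightarrow> real" and c
  proof -
    have km [measurable]: "k \<in> borel_measurable borel" using k by simp
    have "integrable (distr lborel borel ((+) c)) k" unfolding lborel_distr_plus by (rule k)
    then show "integrable lborel (\<lambda>x. k (x + c))"
      by (subst (asm) integrable_distr_eq) (simp_all add: add.commute)
    have "(LINT x|lborel. k x) = (LINT x|distr lborel borel ((+) c). k x)" by (simp add: lborel_distr_plus)
    also have "\<dots> = (LINT x|lborel. k (x + c))" by (subst integral_distr) (simp_all add: add.commute)
    finally show "(LINT x|lborel. k (x + c)) = (LINT x|lborel. k x)" ..
  qed
  \<comment> \<open>The fundamental theorem of calculus tolerates finitely many exceptional
    parameters, provided f is continuous along the line.\<close>
  have line: "(LINT t|lborel. ?I t * g (x + t *\<^sub>R e)) = f (x + e) - f x" for x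
  proof -
    have si: "set_integrable lborel {0..1} (\<lambda>t. g (x + t *\<^sub>R e))"
      unfolding set_integrable_def
      by (rule integrableI_bounded_set_indicator[where B = B]) (use g(2) in auto)
    obtain T where T: "finite T" "\<And>t. t \<notin> T \<Longrightarrow>
        ((\<lambda>t. f (x + t *\<^sub>R e)) has_real_derivative g (x + t *\<^sub>R e)) (at t)"
      using der by blast
    have "((\<lambda>t. g (x + t *\<^sub>R e)) has_integral (f (x + 1 *\<^sub>R e) - f (x + 0 *\<^sub>R e))) {0..1}"
      by (rule fundamental_theorem_of_calculus_interior_strong[OF T(1)])
         (auto intro!: T(2) continuous_on_compose2[OF f(2)] continuous_intros
           simp: has_real_derivative_iff_has_vector_derivative[symmetric])
    then show ?thesis
      using set_borel_integral_eq_integral(2)[OF si] by (simp add: integral_unique set_lebesgue_integral_def)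
  qed
  \<comment> \<open>The indicator of the unit interval makes the product integrable: each slice in x
    has the integral of the absolute value of g, by translation invariance.\<close>
  have int2: "integrable (lborel \<Otimes>\<^sub>M lborel) (\<lambda>(t, x). ?I t * g (x + t *\<^sub>R e))"
  proof (rule lborel_pair.Fubini_integrable)
    have "(LINT x|lborel. norm (?I t * g (x + t *\<^sub>R e))) = ?I t * (LINT x|lborel. \<bar>g x\<bar>)" for t
      using shift(2)[of "\<lambda>x. \<bar>g x\<bar>" "t *\<^sub>R e"] g(1) by (simp add: abs_mult)
    then show "integrable lborel (\<lambda>t. LINT x|lborel. norm (case (t, x) of (t, x) \<Rightarrow> ?I t * g (x + t *\<^sub>R e)))"
      by simp
    show "AE t in lborel. integrable lborel (\<lambda>x. case (t, x) of (t, x) \<Rightarrow> ?I t * g (x + t *\<^sub>R e))"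
      using shift(1)[OF g(1)] by auto
  qed measurable
  have "(LINT x|lborel. g x) = (LINT t|lborel. ?I t * (LINT x|lborel. g x))"
    by simp
  also have "\<dots> = (LINT t|lborel. LINT x|lborel. ?I t * g (x + t *\<^sub>R e))"
    using shift(2)[OF g(1)] by simp
  also have "\<dots> = (LINT x|lborel. LINT t|lborel. ?I t * g (x + t *\<^sub>R e))"
    using lborel_pair.Fubini_integral[OF int2] by simp
  also have "\<dots> = (LINT x|lborel. f (x + e)) - (LINT x|lborel. f x)"
    unfolding line using shift(1)[OF f(1)] f(1) by (rule Bochner_Integration.integral_diff)
  finally show ?thesis using shift(2)[OF f(1)] by simp
qed

text \<open>A quadratic equation in t. It controls the parameters at which the radial cutoff may
  fail to be differentiable.\<close>

lemma finite_line_sphere: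
  fixes z e :: "'a::real_inner"
  assumes "norm e = 1"
  shows "finite {t. norm (z + t *\<^sub>R e) = r}"
proof (rule finite_subset)
  define d where "d = (z \<bullet> e)\<^sup>2 - (norm z)\<^sup>2 + r\<^sup>2"
  show "{t. norm (z + t *\<^sub>R e) = r} \<subseteq> {- (z \<bullet> e) + sqrt d, - (z \<bullet> e) - sqrt d}"
  proof
    fix t assume "t \<in> {t. norm (z + t *\<^sub>R e) = r}"
    then have "r\<^sup>2 = (norm (z + t *\<^sub>R e))\<^sup>2" by simp
    also have "\<dots> = (norm z)\<^sup>2 + 2 * t * (z \<bullet> e) + t\<^sup>2"
      using assms unfolding power2_norm_eq_inner
      by (simp add: inner_add_left inner_add_right inner_commute norm_eq_1 power2_eq_square)
    finally have "(t + z \<bullet> e)\<^sup>2 = d" by (simp add: d_def power2_eq_square algebra_simps)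
    then have "\<bar>t + z \<bullet> e\<bar> = sqrt d" by (metis real_sqrt_abs)
    then show "t \<in> {- (z \<bullet> e) + sqrt d, - (z \<bullet> e) - sqrt d}" by (auto simp: abs_if split: if_splits)
  qed
qed simp

text \<open>Cutting off with this primitive of \<open>\<rho>\<^sup>1\<^sup>-\<^sup>n\<close> instead of
  \<open>\<rho>\<^sup>2\<^sup>-\<^sup>n - R2\<^sup>2\<^sup>-\<^sup>n\<close>, which is \<open>2 - n\<close> times as large, covers \<open>n = 2\<close> as well.\<close>

definition rad_prim :: "int \<Rightarrow> real \<Rightarrow> real" where
  "rad_prim n \<rho> = (if n = 2 then ln \<rho> else \<rho> powi (2 - n) / of_int (2 - n))"

lemma rad_prim_deriv:
  assumes "\<rho> > 0" shows "(rad_prim n has_real_derivative \<rho> powi (1 - n)) (at \<rho>)"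
proof (cases "n = 2")
  case True
  then show ?thesis
    using assms by (auto simp: rad_prim_def[abs_def] power_int_minus field_simps intro!: derivative_eq_intros)
next
  case False
  have "((\<lambda>\<rho>. \<rho> powi (2 - n) / of_int (2 - n)) has_real_derivative
      (of_int (2 - n) * \<rho> powi (2 - n - 1) * 1) / of_int (2 - n)) (at \<rho>)"
    by (intro DERIV_cdivide DERIV_power_int DERIV_ident) (use assms in auto)
  then show ?thesis
    using False by (simp add: rad_prim_def[abs_def])
qed

text \<open>For n = 2 both sides vanish, the right one because both exponents are 0.\<close>

lemma rad_prim_scaled: "of_int (2 - n) * (rad_prim n a - rad_prim n b) = a powi (2 - n) - b powi (2 - n)"
  by (simp add: rad_prim_def right_diff_distrib)

text \<open>For 0 < R1 < R2 this is a negative constant up to R1, increases on [R1, R2] and is 0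
  beyond. The sign makes the slope the positive power of \<open>rad_prim_deriv\<close>.\<close>

definition cutoff :: "int \<Rightarrow> real \<Rightarrow> real \<Rightarrow> real \<Rightarrow> real" where
  "cutoff n R1 R2 \<rho> = rad_prim n (max R1 (min \<rho> R2)) - rad_prim n R2"

context
  fixes x0 :: "'a::euclidean_space" and R1 R2 :: real and n :: int
  assumes R: "0 < R1" "R1 < R2"
begin

lemma continuous_cutoff: "continuous_on UNIV (\<lambda>x. cutoff n R1 R2 (norm (x - x0)))"
proof -
  have c: "continuous_on {R1..R2} (rad_prim n)"
    using R by (intro continuous_at_imp_continuous_on ballI DERIV_isCont[OF rad_prim_deriv]) auto
  have "continuous_on UNIV (\<lambda>x. max R1 (min (norm (x - x0)) R2))"
    by (intro continuous_intros)
  then have "continuous_on UNIV (\<lambda>x. rad_prim n (max R1 (min (norm (x - x0)) R2)))"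
    by (rule continuous_on_compose2[OF c]) (use R in auto)
  then show ?thesis
    unfolding cutoff_def by (rule continuous_on_diff[OF _ continuous_on_const])
qed

lemma cutoff_has_derivative:
  assumes x: "norm (x - x0) \<noteq> R1" "norm (x - x0) \<noteq> R2"
  shows "((\<lambda>x. cutoff n R1 R2 (norm (x - x0))) has_derivative
    (\<lambda>v. if R1 \<le> norm (x - x0) \<and> norm (x - x0) < R2
      then norm (x - x0) powi (1 - n) * ((x - x0) \<bullet> v / norm (x - x0)) else 0)) (at x)"
proof -
  have open1: "open {x. norm (x - x0) < r}" and open2: "open {x. r < norm (x - x0)}" for r
    by (intro open_Collect_less continuous_intros)+
  consider "norm (x - x0) < R1" | "R1 < norm (x - x0)" "norm (x - x0) < R2" | "R2 < norm (x - x0)"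
    using x by linarith
  then show ?thesis
  proof cases
    case 1
    have "((\<lambda>x. rad_prim n R1 - rad_prim n R2) has_derivative (\<lambda>v. 0)) (at x)" by simp
    then have "((\<lambda>x. cutoff n R1 R2 (norm (x - x0))) has_derivative (\<lambda>v. 0)) (at x)"
      by (rule has_derivative_transform_within_open[OF _ open1[of R1]])
         (use 1 R in \<open>auto simp: cutoff_def max_def\<close>)
    then show ?thesis using 1 by simp
  next
    case 2
    then have nz: "x - x0 \<noteq> 0" using R by auto
    then have pos: "norm (x - x0) > 0" by simp
    have "((\<lambda>x. x - x0) has_derivative (\<lambda>v. v)) (at x)" by (auto intro!: derivative_eq_intros)
    from has_derivative_compose[OF this has_derivative_norm[OF nz]]
    have "((\<lambda>x. norm (x - x0)) has_derivative (\<lambda>v. sgn (x - x0) \<bullet> v)) (at x)"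
      by (simp add: inner_commute)
    from has_derivative_compose[OF this has_field_derivative_imp_has_derivative[OF rad_prim_deriv[OF pos, of n]]]
    have "((\<lambda>x. rad_prim n (norm (x - x0)) - rad_prim n R2) has_derivative
      (\<lambda>v. norm (x - x0) powi (1 - n) * (sgn (x - x0) \<bullet> v) - 0)) (at x)"
      by (intro has_derivative_diff has_derivative_const)
    then have "((\<lambda>x. cutoff n R1 R2 (norm (x - x0))) has_derivative
      (\<lambda>v. norm (x - x0) powi (1 - n) * (sgn (x - x0) \<bullet> v) - 0)) (at x)"
      by (rule has_derivative_transform_within_open[OF _ open_Int[OF open1[of R2] open2[of R1]]])
         (use 2 R in \<open>auto simp: cutoff_def max_def min_def\<close>)
    then show ?thesis using 2 by (simp add: sgn_div_norm divide_inverse mult_ac)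
  next
    case 3
    have "((\<lambda>x. 0) has_derivative (\<lambda>v. 0)) (at x)" by simp
    then have "((\<lambda>x. cutoff n R1 R2 (norm (x - x0))) has_derivative (\<lambda>v. 0)) (at x)"
      by (rule has_derivative_transform_within_open[OF _ open2[of R2]])
         (use 3 R in \<open>auto simp: cutoff_def max_def min_def\<close>)
    then show ?thesis using 3 by simp
  qed
qed

lemma cutoff_eq_0: "norm (x - x0) \<ge> R2 \<Longrightarrow> cutoff n R1 R2 (norm (x - x0)) = 0"
  using R by (simp add: cutoff_def)

definition annulus :: "'a set" where "annulus = {x. R1 \<le> norm (x - x0) \<and> norm (x - x0) < R2}"

text \<open>Off the two spheres g is the derivative of cutoff times V in direction e. It is bounded
  with bounded support but need not be continuous on the spheres, so the vanishing of its integral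
  comes from the line-by-line argument.\<close>

lemma cutoff_divergence_component:
  fixes V :: "'a \<Rightarrow> real" and e :: 'a
  assumes V: "smooth_on UNIV V" and e: "norm e = 1"
  defines "g \<equiv> \<lambda>x. indicator annulus x * (norm (x - x0) powi (1 - n) * ((x - x0) \<bullet> e / norm (x - x0)) * V x)
    + cutoff n R1 R2 (norm (x - x0)) * fderiv V x e"
  shows "integrable lborel g" "(LINT x|lborel. g x) = 0"
proof -
  let ?\<eta> = "\<lambda>x. cutoff n R1 R2 (norm (x - x0))"
  let ?G = "\<lambda>x. norm (x - x0) powi (1 - n) * ((x - x0) \<bullet> e / norm (x - x0)) * V x"
  let ?C = "{x. R1 \<le> norm (x - x0) \<and> norm (x - x0) \<le> R2}"
  define f where "f x = ?\<eta> x * V x" for x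
  have cV: "continuous_on UNIV V" by (rule smooth_on_continuous[OF V])
  have cD: "continuous_on UNIV (\<lambda>x. fderiv V x e)"
    by (rule smooth_on_continuous[OF smooth_on_derivative[OF V]])
  have cG: "continuous_on ?C ?G"
    using R by (intro continuous_intros continuous_on_subset[OF cV]) auto
  have compact_C: "compact ?C"
  proof -
    have "closed ?C" by (intro closed_Collect_conj closed_Collect_le continuous_intros)
    moreover have "?C \<subseteq> cball x0 R2" by (auto simp: dist_norm norm_minus_commute)
    ultimately show ?thesis
      using compact_cball bounded_subset bounded_cball compact_eq_bounded_closed by blast
  qed
  have cf: "continuous_on UNIV f"
    unfolding f_def by (intro continuous_intros continuous_cutoff cV)
  have supp: "norm (x - x0) \<ge> R2" if "x \<notin> cball x0 R2" for x
    using that by (auto simp: dist_norm norm_minus_commute)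
  have bdd: "\<exists>B\<ge>0. \<forall>x\<in>K. \<bar>k x\<bar> \<le> B" if "compact K" "continuous_on K k" for k :: "'a \<Rightarrow> real" and K
    using compact_imp_bounded[OF compact_continuous_image[OF that(2,1)]]
    unfolding bounded_pos by (metis imageI less_imp_le real_norm_def)
  obtain B1 where B1: "B1 \<ge> 0" "\<And>x. x \<in> ?C \<Longrightarrow> \<bar>?G x\<bar> \<le> B1"
    using bdd[OF compact_C cG] by blast
  obtain B2 where B2: "B2 \<ge> 0" "\<And>x. x \<in> cball x0 R2 \<Longrightarrow> \<bar>?\<eta> x * fderiv V x e\<bar> \<le> B2"
    using bdd[OF compact_cball continuous_on_subset[OF continuous_on_mult[OF continuous_cutoff cD]]] by blast
  obtain B3 where B3: "B3 \<ge> 0" "\<And>x. x \<in> cball x0 R2 \<Longrightarrow> \<bar>f x\<bar> \<le> B3"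
    using bdd[OF compact_cball continuous_on_subset[OF cf]] by blast
  have f0: "f x = 0" if "x \<notin> cball x0 R2" for x
    using cutoff_eq_0[OF supp[OF that]] by (simp add: f_def)
  have intf: "integrable lborel f"
    by (rule integrable_lborel_bounded_support[where B = B3, OF borel_measurable_continuous_onI[OF cf] _ f0])
       (use B3 f0 in fastforce)
  have ann: "annulus \<in> sets borel"
    unfolding annulus_def by measurable
  have gm: "g \<in> borel_measurable borel"
  proof -
    have "(\<lambda>x. indicator annulus x *\<^sub>R ?G x) \<in> borel_measurable borel"
      by (rule borel_measurable_continuous_on_indicator[OF _ continuous_on_subset[OF cG]])
         (use ann in \<open>auto simp: annulus_def\<close>)
    then show ?thesis
      unfolding g_def real_scaleR_def
      by (rule borel_measurable_add[OF _ borel_measurable_times[OF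
            borel_measurable_continuous_onI[OF continuous_cutoff] borel_measurable_continuous_onI[OF cD]]])
  qed
  have g0: "g x = 0" if "x \<notin> cball x0 R2" for x
    using cutoff_eq_0[OF supp[OF that]] supp[OF that] by (simp add: g_def annulus_def indicator_def)
  have gB: "\<bar>g x\<bar> \<le> B1 + B2" for x
  proof (cases "x \<in> cball x0 R2")
    case True
    have "\<bar>indicator annulus x * ?G x\<bar> \<le> B1"
      using B1 by (cases "x \<in> annulus") (auto simp: annulus_def)
    then show ?thesis
      unfolding g_def using B2(2)[OF True] by linarith
  qed (use g0 B1 B2 in auto)
  show intg: "integrable lborel g"
    by (rule integrable_lborel_bounded_support[OF gm gB g0])
  show "(LINT x|lborel. g x) = 0"
  proof (rule integral_directional_derivative_eq_0[OF intf cf intg gB, where e = e])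
    fix x
    \<comment> \<open>The parameters at which the line through x hits one of the two spheres; no
      derivative is claimed there.\<close>
    let ?T = "{t. norm (x - x0 + t *\<^sub>R e) = R1} \<union> {t. norm (x - x0 + t *\<^sub>R e) = R2}"
    have "((\<lambda>t. f (x + t *\<^sub>R e)) has_real_derivative g (x + t *\<^sub>R e)) (at t)" if t: "t \<notin> ?T" for t
    proof -
      let ?p = "x + t *\<^sub>R e"
      have p: "norm (?p - x0) \<noteq> R1" "norm (?p - x0) \<noteq> R2" using t by (auto simp: algebra_simps)
      have line: "((\<lambda>t. x + t *\<^sub>R e) has_derivative (\<lambda>c. c *\<^sub>R e)) (at t)"
        by (auto intro!: derivative_eq_intros)
      have "(f has_derivative (\<lambda>v. ?\<eta> ?p * fderiv V ?p v +
          (if R1 \<le> norm (?p - x0) \<and> norm (?p - x0) < R2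
          then norm (?p - x0) powi (1 - n) * ((?p - x0) \<bullet> v / norm (?p - x0)) else 0) * V ?p)) (at ?p)"
        unfolding f_def
        by (intro has_derivative_mult cutoff_has_derivative p smooth_on_has_derivative[OF V]) simp
      from has_derivative_compose[OF line this]
      show ?thesis
        unfolding has_field_derivative_def
        by (rule has_derivative_eq_rhs)
           (auto simp: fun_eq_iff g_def annulus_def algebra_simps
             linear_cmul[OF linear_frechet_derivative[OF smooth_on_differentiable[OF V UNIV_I]]])
    qed
    then show "\<exists>T. finite T \<and> (\<forall>t. t \<notin> T \<longrightarrow>
        ((\<lambda>t. f (x + t *\<^sub>R e)) has_real_derivative g (x + t *\<^sub>R e)) (at t))"
      by (intro exI[of _ ?T]) (simp add: finite_line_sphere[OF e])
  qed
qed

end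

theorem integral_annulus_stress:
  fixes A :: "real^'n::finite \<Rightarrow> real^'n \<Rightarrow> real^'n \<Rightarrow> real" and e :: "real^'n \<Rightarrow> real" and x0 :: "real^'n"
  assumes R: "0 < R1" "R1 < R2"
    and A: "\<And>u v. smooth_on UNIV (A u v)" "\<And>v x. linear (\<lambda>u. A u v x)" "\<And>u x. linear (\<lambda>v. A u v x)"
    and e: "\<And>x. e x = 1/2 * (\<Sum>i\<in>UNIV. A (axis i 1) (axis i 1) x)"
    and div: "\<And>v x. (\<Sum>i\<in>UNIV. fderiv (A (axis i 1) v) x (axis i 1)) = fderiv e x v"
  defines "F \<equiv> \<lambda>x. indicator (annulus x0 R1 R2) x * (norm (x - x0) powi (2 - int CARD('n)) *
      A ((1 / norm (x - x0)) *\<^sub>R (x - x0)) ((1 / norm (x - x0)) *\<^sub>R (x - x0)) x)"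
  shows "integrable lborel F"
    and "(LINT x|lborel. F x) = R2 powi (2 - int CARD('n)) * (LBINT x:ball x0 R2. e x)
      - R1 powi (2 - int CARD('n)) * (LBINT x:ball x0 R1. e x)"
proof -
  let ?n = "int CARD('n)" and ?A = "\<lambda>i j. A (axis i 1) (axis j 1)"
  let ?D = "\<lambda>f x i. fderiv f x (axis i (1::real))"
  define V where "V i x = (\<Sum>j\<in>UNIV. ?A i j x * (x - x0) $ j) - e x * (x - x0) $ i" for i x
  have se: "smooth_on UNIV e"
    unfolding e[abs_def] by (intro smooth_on_mult smooth_on_sum smooth_on_const A open_UNIV)
  have sz: "smooth_on UNIV (\<lambda>x. (x - x0) $ j)" for j
    by (intro smooth_on_nth smooth_on_diff smooth_on_ident smooth_on_const open_UNIV)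
  have sV: "smooth_on UNIV (V i)" for i
    unfolding V_def by (intro smooth_on_diff smooth_on_sum smooth_on_mult A se sz open_UNIV)
  have dz: "((\<lambda>x. (x - x0) $ j) has_derivative (\<lambda>v. v $ j)) (at x)" for j x
    by (auto intro!: derivative_eq_intros bounded_linear_imp_has_derivative bounded_linear_vec_nth)
  have dV: "(V i has_derivative (\<lambda>v. (\<Sum>j\<in>UNIV. ?A i j x * v $ j + fderiv (?A i j) x v * (x - x0) $ j)
      - (e x * v $ i + fderiv e x v * (x - x0) $ i))) (at x)" for i x
    unfolding V_def
    by (intro has_derivative_diff has_derivative_sum has_derivative_mult dz
        smooth_on_has_derivative[OF A(1)] smooth_on_has_derivative[OF se]) auto
  have trace: "(\<Sum>i\<in>UNIV. \<Sum>j\<in>UNIV. ?A i j x * (axis i (1::real) :: real^'n) $ j) = 2 * e x" for x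
    by (simp add: e axis_def if_distrib cong: if_cong)
  have divz: "(\<Sum>i\<in>UNIV. \<Sum>j\<in>UNIV. ?D (?A i j) x i * (x - x0) $ j) = (\<Sum>j\<in>UNIV. ?D e x j * (x - x0) $ j)" for x
    by (subst sum.swap) (simp add: sum_distrib_right[symmetric] div)
  \<comment> \<open>The trace of A gives 2 e, and the divergence of e times the position vector
    takes away n e. The derivatives of A and of e cancel by the hypothesis on the
    divergence.\<close>
  have divV: "(\<Sum>i\<in>UNIV. ?D (V i) x i) = of_int (2 - ?n) * e x" for x
    unfolding fderiv_eqI[OF dV] sum_subtractf sum.distrib trace divz
    by (simp add: left_diff_distrib)
  have Azz: "(\<Sum>i\<in>UNIV. (x - x0) $ i * V i x) =
      A (x - x0) (x - x0) x - e x * (norm (x - x0))\<^sup>2" for x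
  proof -
    have 1: "A (axis i 1) (x - x0) x = (\<Sum>j\<in>UNIV. ?A i j x * (x - x0) $ j)" for i
      by (subst linear_axis_sum[OF A(3)]) (simp add: mult.commute)
    have "A (x - x0) (x - x0) x = (\<Sum>i\<in>UNIV. (x - x0) $ i * A (axis i 1) (x - x0) x)"
      by (subst linear_axis_sum[OF A(2)]) simp
    then have "A (x - x0) (x - x0) x = (\<Sum>i\<in>UNIV. (x - x0) $ i * (\<Sum>j\<in>UNIV. ?A i j x * (x - x0) $ j))"
      unfolding 1 .
    moreover have "(norm (x - x0))\<^sup>2 = (\<Sum>i\<in>UNIV. (x - x0) $ i * (x - x0) $ i)"
      by (simp add: power2_norm_eq_inner inner_vec_def)
    ultimately show ?thesis
      by (simp only: V_def right_diff_distrib sum_subtractf sum_distrib_left mult_ac)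
  qed
  define g where "g i x = indicator (annulus x0 R1 R2) x * (norm (x - x0) powi (1 - ?n) *
      ((x - x0) \<bullet> axis i 1 / norm (x - x0)) * V i x)
    + cutoff ?n R1 R2 (norm (x - x0)) * ?D (V i) x i" for i x
  have g: "integrable lborel (g i)" "(LINT x|lborel. g i x) = 0" for i
    unfolding g_def by (rule cutoff_divergence_component[OF R sV]; simp)+
  \<comment> \<open>On the annulus the clamped radius is |x - x0|, and the term it contributes
    cancels the e-part of the radial contraction \<open>Azz\<close>. Within radius R1 the clamped
    radius is R1, and the R2 term is present on the whole larger ball.\<close>
  have sum_g: "(\<Sum>i\<in>UNIV. g i x) = F x + R1 powi (2 - ?n) * (indicator (ball x0 R1) x * e x)
      - R2 powi (2 - ?n) * (indicator (ball x0 R2) x * e x)" for x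
  proof -
    let ?\<rho> = "norm (x - x0)"
    have "(\<Sum>i\<in>UNIV. g i x) = indicator (annulus x0 R1 R2) x * (?\<rho> powi (1 - ?n) / ?\<rho> * (\<Sum>i\<in>UNIV. (x - x0) $ i * V i x))
        + cutoff ?n R1 R2 ?\<rho> * (\<Sum>i\<in>UNIV. ?D (V i) x i)"
      by (simp add: g_def sum.distrib sum_distrib_left sum_divide_distrib inner_axis mult_ac)
    also have "cutoff ?n R1 R2 ?\<rho> * (\<Sum>i\<in>UNIV. ?D (V i) x i) =
        (max R1 (min ?\<rho> R2) powi (2 - ?n) - R2 powi (2 - ?n)) * e x"
      unfolding divV cutoff_def rad_prim_scaled[symmetric] by simp
    also have "indicator (annulus x0 R1 R2) x * (?\<rho> powi (1 - ?n) / ?\<rho> * (\<Sum>i\<in>UNIV. (x - x0) $ i * V i x)) =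
        F x - indicator (annulus x0 R1 R2) x * (?\<rho> powi (2 - ?n) * e x)"
    proof (cases "x \<in> annulus x0 R1 R2")
      case True
      then have \<rho>: "?\<rho> > 0" using R by (auto simp: annulus_def[OF R])
      have pn: "?\<rho> powi (2 - ?n) = ?\<rho> powi (1 - ?n) * ?\<rho>"
        using power_int_add_1[of ?\<rho> "1 - ?n"] \<rho> by simp
      have au: "A ((1 / ?\<rho>) *\<^sub>R (x - x0)) ((1 / ?\<rho>) *\<^sub>R (x - x0)) x = A (x - x0) (x - x0) x / ?\<rho>\<^sup>2"
        by (simp only: linear_cmul[OF A(2)] linear_cmul[OF A(3)]) (simp add: power2_eq_square)
      have "p / ?\<rho> * (q - s * ?\<rho>\<^sup>2) = p * ?\<rho> * (q / ?\<rho>\<^sup>2) - p * ?\<rho> * s" for p q s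
        using \<rho> by (simp add: field_simps power2_eq_square)
      then show ?thesis
        unfolding F_def Azz pn au using True by (simp only: indicator_simps mult_1_left)
    qed (simp add: F_def)
    finally show ?thesis
      using R by (auto simp: indicator_def annulus_def[OF R] dist_norm norm_minus_commute F_def left_diff_distrib)
  qed
  have ce: "integrable lborel (\<lambda>x. indicator (ball x0 r) x * e x)" for r
  proof -
    have "set_integrable lborel (cball x0 r) e"
      unfolding set_integrable_def
      by (rule borel_integrable_compact[OF compact_cball continuous_on_subset[OF smooth_on_continuous[OF se]]]) simp
    then have "set_integrable lborel (ball x0 r) e"
      by (rule set_integrable_subset) auto
    then show ?thesis by (simp add: set_integrable_def)
  qed
  have F: "F = (\<lambda>x. (\<Sum>i\<in>UNIV. g i x) - R1 powi (2 - ?n) * (indicator (ball x0 R1) x * e x)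
      + R2 powi (2 - ?n) * (indicator (ball x0 R2) x * e x))"
    by (simp add: fun_eq_iff sum_g)
  show "integrable lborel F"
    unfolding F
    by (intro Bochner_Integration.integrable_add Bochner_Integration.integrable_diff
        Bochner_Integration.integrable_sum integrable_mult_right g ce)
  show "(LINT x|lborel. F x) = R2 powi (2 - ?n) * (LBINT x:ball x0 R2. e x)
      - R1 powi (2 - ?n) * (LBINT x:ball x0 R1. e x)"
    unfolding F using g ce
    by (simp add: set_lebesgue_integral_def)
qed

section \<open>Polar coordinates\<close>

text \<open>Such an M is a finite sum of images of weighted measures. The formula for sets extends
  to nonnegative functions by the usual induction, so these image measures need not be
  constructed.\<close>

lemma nn_integral_sum_of_kernels:
  fixes M :: "'a measure" and W :: "'i \<Rightarrow> 'b \<Rightarrow> ennreal" and p :: "'i \<Rightarrow> 'b \<Rightarrow> 'a"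
  assumes I: "finite I" and W: "\<And>i. i \<in> I \<Longrightarrow> W i \<in> borel_measurable (L i)"
    and p: "\<And>i. i \<in> I \<Longrightarrow> p i \<in> measurable (L i) M"
    and M: "\<And>A. A \<in> sets M \<Longrightarrow> emeasure M A = (\<Sum>i\<in>I. \<integral>\<^sup>+y. W i y * indicator A (p i y) \<partial>L i)"
    and F: "F \<in> borel_measurable M"
  shows "(\<integral>\<^sup>+x. F x \<partial>M) = (\<Sum>i\<in>I. \<integral>\<^sup>+y. W i y * F (p i y) \<partial>L i)"
  using F
proof (induction rule: borel_measurable_induct)
  case (cong f g)
  have "(\<integral>\<^sup>+y. W i y * f (p i y) \<partial>L i) = (\<integral>\<^sup>+y. W i y * g (p i y) \<partial>L i)" if "i \<in> I" for i
    using cong.hyps(3) measurable_space[OF p[OF that]] by (intro nn_integral_cong) auto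
  then show ?case
    using cong.hyps(3) cong.IH by (simp cong: nn_integral_cong)
next
  case (set A)
  then show ?case using M by simp
next
  case (mult u c)
  have "(\<integral>\<^sup>+y. W i y * (c * u (p i y)) \<partial>L i) = c * (\<integral>\<^sup>+y. W i y * u (p i y) \<partial>L i)" if "i \<in> I" for i
    using W[OF that] measurable_compose[OF p[OF that] mult.hyps(2)]
    by (subst nn_integral_cmult[symmetric]) (auto simp: mult.left_commute)
  then show ?case
    using mult by (simp add: nn_integral_cmult sum_distrib_left)
next
  case (add u v)
  have "(\<integral>\<^sup>+y. W i y * (v (p i y) + u (p i y)) \<partial>L i) =
      (\<integral>\<^sup>+y. W i y * v (p i y) \<partial>L i) + (\<integral>\<^sup>+y. W i y * u (p i y) \<partial>L i)" if "i \<in> I" for i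
    using W[OF that] measurable_compose[OF p[OF that] add.hyps(1)] measurable_compose[OF p[OF that] add.hyps(3)]
    by (subst nn_integral_add[symmetric]) (auto simp: distrib_left)
  then show ?case
    using add by (simp add: nn_integral_add sum.distrib)
next
  case (seq U)
  have mono: "U i x \<le> U j x" if "i \<le> j" for i j x
    using incseqD[OF seq.hyps(3) that] by (simp add: le_fun_def)
  have "(\<integral>\<^sup>+y. W i y * (SUP j. U j) (p i y) \<partial>L i) = (SUP j. \<integral>\<^sup>+y. W i y * U j (p i y) \<partial>L i)" if "i \<in> I" for i
    unfolding SUP_apply SUP_mult_left_ennreal
    using W[OF that] measurable_compose[OF p[OF that] seq.hyps(1)]
    by (intro nn_integral_monotone_convergence_SUP)
       (auto simp: incseq_def le_fun_def intro!: mult_left_mono mono)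
  then have "(\<Sum>i\<in>I. \<integral>\<^sup>+y. W i y * (SUP j. U j) (p i y) \<partial>L i) = (\<Sum>i\<in>I. SUP j. \<integral>\<^sup>+y. W i y * U j (p i y) \<partial>L i)"
    by simp
  also have "\<dots> = (SUP j. \<Sum>i\<in>I. \<integral>\<^sup>+y. W i y * U j (p i y) \<partial>L i)"
    by (rule ennreal_SUP_sum[symmetric])
       (auto simp: incseq_def le_fun_def intro!: nn_integral_mono mult_left_mono mono)
  also have "\<dots> = (SUP j. \<integral>\<^sup>+x. U j x \<partial>M)"
    by (simp add: seq.IH)
  also have "\<dots> = (\<integral>\<^sup>+x. (SUP j. U j) x \<partial>M)"
    unfolding SUP_apply using seq by (intro nn_integral_monotone_convergence_SUP[symmetric]) auto
  finally show ?case ..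
qed

text \<open>Substitution r = sqrt (c + t^2). For c = 0 the derivative is discontinuous at t = 0, so
  the half line is exhausted by compact intervals that stay away from 0.\<close>

lemma nn_integral_sqrt_substitution:
  fixes f :: "real \<Rightarrow> ennreal"
  assumes f: "f \<in> borel_measurable borel" and o: "0 \<le> c"
  shows "(\<integral>\<^sup>+r. f r * indicator {sqrt c<..} r \<partial>lborel) =
    (\<integral>\<^sup>+t. f (sqrt (c + t\<^sup>2)) * ennreal (t / sqrt (c + t\<^sup>2)) * indicator {0<..} t \<partial>lborel)"
proof -
  define g where "g t = sqrt (c + t\<^sup>2)" for t
  define g' where "g' t = t / sqrt (c + t\<^sup>2)" for t
  \<comment> \<open>The shifts by 2 and 1 ensure \<open>a n < 1\<close> and
    \<open>1 \<le> b n\<close> for every n, so that no interval degenerates.\<close>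
  define a where "a n = 1 / real (n + 2)" for n
  define b where "b n = real (n + 1)" for n
  have gm: "g \<in> borel_measurable borel" "g' \<in> borel_measurable borel"
    unfolding g_def[abs_def] g'_def[abs_def] by measurable
  have ab: "0 < a n" "a n < b n" for n
  proof -
    have "a n < 1" "1 \<le> b n" by (simp_all add: a_def b_def)
    then show "a n < b n" by simp
  qed (simp add: a_def)
  have a_anti: "a j \<le> a i" "b i \<le> b j" if "i \<le> j" for i j
    using that by (auto simp: a_def b_def field_simps)
  have g_mono: "g s \<le> g t" if "0 \<le> s" "s \<le> t" for s t
    using that by (simp add: g_def power_mono)
  have sub: "(\<integral>\<^sup>+r. f r * indicator {g (a n)..g (b n)} r \<partial>lborel) =
     (\<integral>\<^sup>+t. f (g t) * g' t * indicator {a n..b n} t \<partial>lborel)" for n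
  proof (rule nn_integral_substitution_aux[OF f _ _ _ _ ab(2)])
    fix t assume t: "t \<in> {a n..b n}"
    then have "t > 0" using ab(1)[of n] by auto
    then have "c + t\<^sup>2 > 0" using o by (simp add: add_nonneg_pos)
    then show "(g has_real_derivative g' t) (at t)"
      unfolding g_def g'_def by (auto intro!: derivative_eq_intros simp: field_simps)
    show "g' t \<ge> 0" using \<open>t > 0\<close> o by (simp add: g'_def)
  next
    have "c + t\<^sup>2 \<noteq> 0" if "t \<in> {a n..b n}" for t
      using that ab(1)[of n] o by (auto simp: add_nonneg_eq_0_iff)
    then show "continuous_on {a n..b n} g'"
      unfolding g'_def by (intro continuous_intros) auto
  qed simp
  have U1: "(\<Union>n. {g (a n)..g (b n)}) = {sqrt c<..}"
  proof (intro set_eqI iffI)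
    fix r assume "r \<in> (\<Union>n. {g (a n)..g (b n)})"
    then obtain n where "g (a n) \<le> r" by auto
    moreover have "sqrt c < g (a n)" using ab(1)[of n] by (simp add: g_def)
    ultimately show "r \<in> {sqrt c<..}" by simp
  next
    fix r assume "r \<in> {sqrt c<..}"
    then have r1: "sqrt c < r" by simp
    then have "0 < r" using real_sqrt_ge_zero[OF o] by linarith
    note r = r1 this
    define t where "t = sqrt (r\<^sup>2 - c)"
    have "c < r\<^sup>2" using r o by (metis real_less_lsqrt not_le real_sqrt_le_iff real_sqrt_abs abs_of_pos linorder_not_less)
    then have t: "t > 0" "g t = r" using r by (auto simp: t_def g_def)
    obtain n1 where n1: "inverse (real (Suc n1)) < t" using reals_Archimedean[OF t(1)] by blast
    obtain n2 where n2: "t < real n2" using reals_Archimedean2 by blast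
    define n where "n = max n1 n2"
    have "a n \<le> inverse (real (Suc n1))" by (auto simp: a_def n_def field_simps)
    then have "a n \<le> t" using n1 by simp
    moreover have "t \<le> b n" using n2 by (simp add: b_def n_def)
    ultimately have "g (a n) \<le> r" "r \<le> g (b n)"
      using g_mono[of "a n" t] g_mono[of t "b n"] ab(1)[of n] t by auto
    then show "r \<in> (\<Union>n. {g (a n)..g (b n)})" by auto
  qed
  have U2: "(\<Union>n. {a n..b n}) = {0<..}"
  proof (intro set_eqI iffI)
    fix t assume "t \<in> (\<Union>n. {a n..b n})"
    then obtain n where "a n \<le> t" by auto
    with ab(1)[of n] show "t \<in> {0<..}" by simp
  next
    fix t :: real assume "t \<in> {0<..}"
    then have t: "t > 0" by simp
    obtain n1 where n1: "inverse (real (Suc n1)) < t" using reals_Archimedean[OF t(1)] by blast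
    obtain n2 where n2: "t < real n2" using reals_Archimedean2 by blast
    define n where "n = max n1 n2"
    have "a n \<le> inverse (real (Suc n1))" by (auto simp: a_def n_def field_simps)
    then have "a n \<le> t" using n1 by simp
    moreover have "t \<le> b n" using n2 by (simp add: b_def n_def)
    ultimately show "t \<in> (\<Union>n. {a n..b n})" by auto
  qed
  \<comment> \<open>With f2 the integrals are values of measures with a density, and continuity from
    below along the increasing intervals passes to the limit on both sides.\<close>
  have f2: "(\<lambda>t. f (g t) * ennreal (g' t)) \<in> borel_measurable lborel"
    using measurable_compose[OF gm(1) f] gm(2) by simp
  have "(\<integral>\<^sup>+r. f r * indicator {sqrt c<..} r \<partial>lborel) = emeasure (density lborel f) (\<Union>n. {g (a n)..g (b n)})"
    using f by (simp add: U1 emeasure_density)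
  also have "\<dots> = (SUP n. emeasure (density lborel f) {g (a n)..g (b n)})"
    using a_anti ab(1) by (intro SUP_emeasure_incseq[symmetric])
      (auto simp: incseq_def intro!: g_mono less_imp_le[OF ab(1)] order_trans[OF less_imp_le[OF ab(1)] less_imp_le[OF ab(2)]])
  also have "\<dots> = (SUP n. \<integral>\<^sup>+t. f (g t) * g' t * indicator {a n..b n} t \<partial>lborel)"
    using f by (simp add: emeasure_density sub)
  also have "\<dots> = (SUP n. emeasure (density lborel (\<lambda>t. f (g t) * g' t)) {a n..b n})"
    using f2 by (simp add: emeasure_density)
  also have "\<dots> = emeasure (density lborel (\<lambda>t. f (g t) * g' t)) (\<Union>n. {a n..b n})"
    using a_anti by (intro SUP_emeasure_incseq) (auto simp: incseq_def)
  also have "\<dots> = (\<integral>\<^sup>+t. f (g t) * g' t * indicator {0<..} t \<partial>lborel)"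
    using f2 by (simp add: U2 emeasure_density)
  finally show ?thesis by (simp add: g_def g'_def)
qed

definition insert_coord :: "'n \<Rightarrow> real \<Rightarrow> ('n \<Rightarrow> real) \<Rightarrow> real^'n::finite" where
  "insert_coord k u y = (\<chi> i. if i = k then u else y i)"

lemma measurable_vec_lambda:
  fixes f :: "'a \<Rightarrow> 'n::finite \<Rightarrow> real"
  assumes "\<And>i. (\<lambda>x. f x i) \<in> borel_measurable M"
  shows "(\<lambda>x. \<chi> i. f x i) \<in> borel_measurable M"
proof (rule borel_measurable_euclidean_space[THEN iffD2], intro ballI)
  fix b :: "real^'n" assume "b \<in> Basis"
  then obtain j where "b = axis j 1" by (auto simp: Basis_vec_def)
  then show "(\<lambda>x. (\<chi> i. f x i) \<bullet> b) \<in> borel_measurable M"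
    using assms by (simp add: inner_axis)
qed

text \<open>Both measures assign to a box the product of its side lengths. The coordinates thus
  become the index set of a product measure, from which one coordinate can be split off.\<close>

lemma lborel_vec_eq_distr:
  "(lborel :: (real^'n::finite) measure) = distr (\<Pi>\<^sub>M i\<in>UNIV. lborel) borel (\<lambda>f. \<chi> i. f i)"
proof (rule lborel_eqI)
  interpret product_sigma_finite "\<lambda>_::'n. lborel :: real measure" ..
  have m: "(\<lambda>f. \<chi> i. f i) \<in> borel_measurable (\<Pi>\<^sub>M i\<in>(UNIV::'n set). (lborel :: real measure))"
    by (rule measurable_vec_lambda[of "\<lambda>f i. f i"]) measurable
  fix l u :: "real^'n" assume le: "\<And>b. b \<in> Basis \<Longrightarrow> l \<bullet> b \<le> u \<bullet> b"
  have le': "l $ i \<le> u $ i" for i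
    using le[of "axis i 1"] by (simp add: inner_axis)
  have "(\<lambda>f. \<chi> i. f i) -` box l u \<inter> space (\<Pi>\<^sub>M i\<in>UNIV. lborel) = (\<Pi>\<^sub>E i\<in>UNIV. {l $ i<..<u $ i})"
    by (auto simp: box_def Basis_vec_def inner_axis space_PiM PiE_def)
  then have "emeasure (distr (\<Pi>\<^sub>M i\<in>UNIV. lborel) borel (\<lambda>f. \<chi> i. f i)) (box l u) =
      (\<Prod>i\<in>UNIV. ennreal (u $ i - l $ i))"
    using m by (simp add: emeasure_distr emeasure_PiM le')
  also have "\<dots> = ennreal (\<Prod>i\<in>UNIV. (u $ i - l $ i))"
    using le' by (simp add: prod_ennreal)
  also have "(\<Prod>i\<in>UNIV. (u $ i - l $ i)) = (\<Prod>b\<in>Basis. (u - l) \<bullet> b)"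
  proof -
    have B: "(Basis :: (real^'n) set) = range (\<lambda>i. axis i 1)" by (auto simp: Basis_vec_def)
    have inj: "inj (\<lambda>i::'n. axis i (1::real))" by (auto simp: inj_on_def axis_eq_axis)
    show ?thesis unfolding B by (subst prod.reindex[OF inj]) (simp add: inner_axis)
  qed
  finally show "emeasure (distr (\<Pi>\<^sub>M i\<in>UNIV. lborel) borel (\<lambda>f. \<chi> i. f i)) (box l u) = (\<Prod>b\<in>Basis. (u - l) \<bullet> b)" .
qed simp

lemma measurable_insert_coord:
  assumes "u \<in> borel_measurable M" "y \<in> measurable M (\<Pi>\<^sub>M i\<in>-{k}. lborel)"
  shows "(\<lambda>x. insert_coord k (u x) (y x)) \<in> borel_measurable M"
  unfolding insert_coord_def
proof (rule measurable_vec_lambda)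
  fix i
  show "(\<lambda>x. if i = k then u x else y x i) \<in> borel_measurable M"
    using assms(1) measurable_compose[OF assms(2) measurable_component_singleton[of i "-{k}" "\<lambda>_. lborel"]]
    by (cases "i = k") auto
qed

lemma nn_integral_lborel_insert_coord:
  fixes F :: "real^'n::finite \<Rightarrow> ennreal"
  assumes F: "F \<in> borel_measurable borel"
  shows "(\<integral>\<^sup>+x. F x \<partial>lborel) = (\<integral>\<^sup>+y. \<integral>\<^sup>+u. F (insert_coord k u y) \<partial>lborel \<partial>(\<Pi>\<^sub>M i\<in>-{k}. lborel))"
proof -
  interpret product_sigma_finite "\<lambda>_::'n. lborel :: real measure" ..
  have m: "(\<lambda>f. \<chi> i. f i) \<in> borel_measurable (\<Pi>\<^sub>M i\<in>(UNIV::'n set). (lborel :: real measure))"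
    by (rule measurable_vec_lambda[of "\<lambda>f i. f i"]) measurable
  have U: "insert k (-{k}) = UNIV" by auto
  have "(\<integral>\<^sup>+x. F x \<partial>lborel) = (\<integral>\<^sup>+f. F (\<chi> i. f i) \<partial>(\<Pi>\<^sub>M i\<in>insert k (-{k}). lborel))"
    unfolding U by (subst lborel_vec_eq_distr, subst nn_integral_distr) (use m F in auto)
  also have "\<dots> = (\<integral>\<^sup>+y. \<integral>\<^sup>+u. F (\<chi> i. (y(k := u)) i) \<partial>lborel \<partial>(\<Pi>\<^sub>M i\<in>-{k}. lborel))"
    by (rule product_nn_integral_insert) (use measurable_compose[OF m F] U in auto)
  finally show ?thesis
    by (simp add: insert_coord_def fun_upd_def)
qed

lemma off_sq_nonneg: "off_sq x0 k y \<ge> 0"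
  by (simp add: off_sq_def sum_nonneg)

lemma norm_insert_coord:
  "(norm (insert_coord k (x0 $ k + t) y - x0))\<^sup>2 = off_sq x0 k y + t\<^sup>2"
proof -
  have U: "UNIV = insert k (-{k})" by auto
  have "(norm (insert_coord k (x0 $ k + t) y - x0))\<^sup>2 = (\<Sum>i\<in>UNIV. ((insert_coord k (x0 $ k + t) y - x0) $ i)\<^sup>2)"
    unfolding power2_norm_eq_inner inner_vec_def by (simp add: power2_eq_square)
  then show ?thesis
    unfolding U by (simp add: off_sq_def insert_coord_def)
qed

lemma graph_pt_eq: "graph_pt x0 r k s y = insert_coord k (x0 $ k + s * sqrt (r\<^sup>2 - off_sq x0 k y)) y"
  by (simp add: graph_pt_def insert_coord_def)

text \<open>With T the height above the hyperplane, the area element is r/T and the partition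
  function is (T/r)^2. The product T/r no longer blows up at the equator.\<close>

lemma sphere_weight_eq:
  assumes "r > 0" "off_sq x0 k y < r\<^sup>2" "s \<in> {-1, 1}"
  shows "((graph_pt x0 r k s y - x0) $ k / r)\<^sup>2 * graph_area_element x0 r k y = sqrt (r\<^sup>2 - off_sq x0 k y) / r"
proof -
  define T where "T = sqrt (r\<^sup>2 - off_sq x0 k y)"
  have T: "T > 0" "T\<^sup>2 = r\<^sup>2 - off_sq x0 k y" using assms by (auto simp: T_def)
  have "(\<Sum>i\<in>-{k}. ((y i - x0 $ i) / T)\<^sup>2) = off_sq x0 k y / T\<^sup>2"
    by (simp add: off_sq_def power_divide sum_divide_distrib)
  moreover have "1 + off_sq x0 k y / T\<^sup>2 = (r / T)\<^sup>2"
    using assms(2) by (simp add: power_divide T(2) field_simps)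
  ultimately have "1 + (\<Sum>i\<in>-{k}. ((y i - x0 $ i) / T)\<^sup>2) = (r / T)\<^sup>2"
    by simp
  then have "graph_area_element x0 r k y = r / T"
    using T assms by (simp add: graph_area_element_def T_def[symmetric])
  moreover have "((graph_pt x0 r k s y - x0) $ k / r)\<^sup>2 = T\<^sup>2 / r\<^sup>2"
    using assms(3) by (auto simp: graph_pt_def T_def[symmetric] power_divide)
  ultimately show ?thesis
    using T(1) assms(1) unfolding T_def[symmetric] by (simp add: power2_eq_square)
qed

definition sphere_weight :: "real^'n::finite \<Rightarrow> real \<Rightarrow> 'n \<Rightarrow> real \<Rightarrow> ('n \<Rightarrow> real) \<Rightarrow> ennreal" where
  "sphere_weight x0 r k s y = indicator {y. off_sq x0 k y < r\<^sup>2} y *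
     ennreal (((graph_pt x0 r k s y - x0) $ k / r)\<^sup>2 * graph_area_element x0 r k y)"

lemma measurable_off_sq_comp [measurable (raw)]:
  assumes "y \<in> measurable M (\<Pi>\<^sub>M i\<in>-{k}. lborel)"
  shows "(\<lambda>x. off_sq x0 k (y x)) \<in> borel_measurable M"
  by (rule measurable_compose[OF assms off_sq_measurable])

lemma measurable_graph_pt_comp:
  assumes [measurable]: "r \<in> borel_measurable M" and y [measurable]: "y \<in> measurable M (\<Pi>\<^sub>M i\<in>-{k}. lborel)"
  shows "(\<lambda>x. graph_pt x0 (r x) k s (y x)) \<in> borel_measurable M"
  unfolding graph_pt_eq by (rule measurable_insert_coord[OF _ y]) measurable

text \<open>The radius is an argument as well, because the exchange of the integrals over r and y
  requires joint measurability.\<close>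

lemma measurable_sphere_weight:
  assumes r [measurable]: "r \<in> borel_measurable M" and y [measurable]: "y \<in> measurable M (\<Pi>\<^sub>M i\<in>-{k}. lborel)"
  shows "(\<lambda>x. sphere_weight x0 (r x) k s (y x)) \<in> borel_measurable M"
proof -
  have [measurable]: "(\<lambda>x. y x i) \<in> borel_measurable M" if "i \<in> -{k}" for i
    using measurable_compose[OF y measurable_component_singleton[of i "-{k}" "\<lambda>_. lborel"]] that by simp
  have "(\<lambda>x. ennreal (((graph_pt x0 (r x) k s (y x) - x0) $ k / r x)\<^sup>2 * graph_area_element x0 (r x) k (y x))) \<in> borel_measurable M"
    unfolding graph_pt_def graph_area_element_def by simp
  moreover have "(\<lambda>x. indicator {y. off_sq x0 k y < (r x)\<^sup>2} (y x) :: ennreal) \<in> borel_measurable M"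
  proof -
    have "(\<lambda>x. indicator {x \<in> space M. off_sq x0 k (y x) < (r x)\<^sup>2} x :: ennreal) \<in> borel_measurable M"
      by (intro borel_measurable_indicator) measurable
    then show ?thesis
      by (rule measurable_cong[THEN iffD1, rotated]) (auto simp: indicator_def)
  qed
  ultimately show ?thesis
    unfolding sphere_weight_def by (intro borel_measurable_times_ennreal)
qed

lemma nn_integral_sphere_measure:
  assumes F: "F \<in> borel_measurable borel"
  shows "(\<integral>\<^sup>+x. F x \<partial>sphere_measure x0 r) = (\<Sum>k\<in>UNIV. \<Sum>s\<in>{-1, 1}.
    \<integral>\<^sup>+y. sphere_weight x0 r k s y * F (graph_pt x0 r k s y) \<partial>(\<Pi>\<^sub>M i\<in>-{k}. lborel))"
proof -
  have id: "(\<lambda>y. y) \<in> measurable (\<Pi>\<^sub>M i\<in>-{k}. lborel) (\<Pi>\<^sub>M i\<in>-{k}. lborel)" for k :: 'a by simp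
  have "(\<integral>\<^sup>+x. F x \<partial>sphere_measure x0 r) = (\<Sum>i\<in>UNIV \<times> {-1, 1}.
    \<integral>\<^sup>+y. (case i of (k, s) \<Rightarrow> sphere_weight x0 r k s) y * F ((case i of (k, s) \<Rightarrow> graph_pt x0 r k s) y)
      \<partial>(\<Pi>\<^sub>M i\<in>-{fst i}. lborel))"
  proof (rule nn_integral_sum_of_kernels)
    fix A assume "A \<in> sets (sphere_measure x0 r)"
    then show "emeasure (sphere_measure x0 r) A = (\<Sum>i\<in>UNIV \<times> {-1, 1}.
    \<integral>\<^sup>+y. (case i of (k, s) \<Rightarrow> sphere_weight x0 r k s) y * indicator A ((case i of (k, s) \<Rightarrow> graph_pt x0 r k s) y)
      \<partial>(\<Pi>\<^sub>M i\<in>-{fst i}. lborel))"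
      by (simp add: emeasure_sphere_measure sum.cartesian_product' sphere_weight_def mult_ac)
  next
    fix i :: "'a \<times> real" assume "i \<in> UNIV \<times> {-1, 1}"
    show "(case i of (k, s) \<Rightarrow> sphere_weight x0 r k s) \<in> borel_measurable (\<Pi>\<^sub>M i\<in>-{fst i}. lborel)"
    proof -
      have "(\<lambda>y. sphere_weight x0 r (fst i) (snd i) y) \<in> borel_measurable (\<Pi>\<^sub>M i\<in>-{fst i}. lborel)"
        by (rule measurable_sphere_weight[OF _ id]) simp
      then show ?thesis by (simp add: split_def)
    qed
    show "(case i of (k, s) \<Rightarrow> graph_pt x0 r k s) \<in> measurable (\<Pi>\<^sub>M i\<in>-{fst i}. lborel) (sphere_measure x0 r)"
      using graph_pt_measurable[of x0 r "fst i" "snd i"] by (simp add: split_def measurable_cong_sets[OF refl sets_sphere_measure])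
  qed (use F in \<open>simp_all add: measurable_cong_sets[OF sets_sphere_measure refl]\<close>)
  then show ?thesis
    by (simp add: sum.cartesian_product')
qed

text \<open>Where the weight is nonzero, the graph points have distance r from the centre. Factors
  depending on |x - x0| only can thus be pulled out of sphere integrals.\<close>

lemma AE_sphere_measure:
  assumes "r > 0"
  shows "AE x in sphere_measure x0 r. norm (x - x0) = r"
proof -
  let ?A = "{x. norm (x - x0) \<noteq> r}"
  have A: "?A \<in> sets borel" by measurable
  have z: "sphere_weight x0 r k s y * indicator ?A (graph_pt x0 r k s y) = 0" if s: "s \<in> {-1, 1}" for k s y
  proof (cases "off_sq x0 k y < r\<^sup>2")
    case True
    then have "(norm (graph_pt x0 r k s y - x0))\<^sup>2 = r\<^sup>2"
      using s by (auto simp: graph_pt_eq norm_insert_coord)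
    then have "norm (graph_pt x0 r k s y - x0) = r"
      using assms by simp
    then show ?thesis by simp
  qed (simp add: sphere_weight_def)
  have "(\<integral>\<^sup>+x. indicator ?A x \<partial>sphere_measure x0 r) = 0"
    unfolding nn_integral_sphere_measure[OF borel_measurable_indicator[OF A]]
    by (intro sum.neutral ballI) (simp only: z nn_integral_const mult_zero_left)
  then have "emeasure (sphere_measure x0 r) ?A = 0"
    using A by simp
  then show ?thesis
    by (intro AE_I[of _ _ ?A]) (use A in auto)
qed

text \<open>Here c is the squared distance from the centre to a line parallel to a coordinate axis.
  With t = sqrt (r^2 - c) one has dr = (t/r) dt, and the weight contributes another factor t/r. The
  two signs cover the two half lines; at t = 0 the density vanishes.\<close>

lemma nn_integral_radial_sum:
  fixes G :: "real \<Rightarrow> ennreal"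
  assumes G: "G \<in> borel_measurable borel" and c: "c \<ge> 0"
  shows "(\<Sum>s\<in>{-1, 1::real}. \<integral>\<^sup>+r. indicator {0<..} r * (indicator {r. c < r\<^sup>2} r *
      ennreal (sqrt (r\<^sup>2 - c) / r) * G (s * sqrt (r\<^sup>2 - c))) \<partial>lborel) =
    (\<integral>\<^sup>+t. G t * ennreal (t\<^sup>2 / (c + t\<^sup>2)) \<partial>lborel)"
proof -
  note G [measurable]
  have half: "(\<integral>\<^sup>+r. indicator {0<..} r * (indicator {r. c < r\<^sup>2} r *
      ennreal (sqrt (r\<^sup>2 - c) / r) * G (s * sqrt (r\<^sup>2 - c))) \<partial>lborel) =
    (\<integral>\<^sup>+t. G (s * t) * ennreal (t\<^sup>2 / (c + t\<^sup>2)) * indicator {0<..} t \<partial>lborel)" for s :: real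
  proof -
    have eq: "0 < r \<and> c < r\<^sup>2 \<longleftrightarrow> sqrt c < r" for r
      using c real_sqrt_ge_zero[OF c] real_less_lsqrt[of c r] real_less_rsqrt[of c r]
      by (smt (verit) real_sqrt_less_iff real_sqrt_abs)
    have "(\<integral>\<^sup>+r. indicator {0<..} r * (indicator {r. c < r\<^sup>2} r *
      ennreal (sqrt (r\<^sup>2 - c) / r) * G (s * sqrt (r\<^sup>2 - c))) \<partial>lborel) =
      (\<integral>\<^sup>+r. (ennreal (sqrt (r\<^sup>2 - c) / r) * G (s * sqrt (r\<^sup>2 - c))) * indicator {sqrt c<..} r \<partial>lborel)"
      using eq by (intro nn_integral_cong) (auto simp: indicator_def)
    also have "\<dots> = (\<integral>\<^sup>+t. (ennreal (sqrt ((sqrt (c + t\<^sup>2))\<^sup>2 - c) / sqrt (c + t\<^sup>2)) * G (s * sqrt ((sqrt (c + t\<^sup>2))\<^sup>2 - c))) *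
        ennreal (t / sqrt (c + t\<^sup>2)) * indicator {0<..} t \<partial>lborel)"
      using G by (intro nn_integral_sqrt_substitution[OF _ c]) measurable
    also have "\<dots> = (\<integral>\<^sup>+t. G (s * t) * ennreal (t\<^sup>2 / (c + t\<^sup>2)) * indicator {0<..} t \<partial>lborel)"
    proof (rule nn_integral_cong)
      fix t :: real
      show "(ennreal (sqrt ((sqrt (c + t\<^sup>2))\<^sup>2 - c) / sqrt (c + t\<^sup>2)) * G (s * sqrt ((sqrt (c + t\<^sup>2))\<^sup>2 - c))) *
        ennreal (t / sqrt (c + t\<^sup>2)) * indicator {0<..} t = G (s * t) * ennreal (t\<^sup>2 / (c + t\<^sup>2)) * indicator {0<..} t"
      proof (cases "t > 0")
        case True
        have "ennreal (t / sqrt (c + t\<^sup>2)) * ennreal (t / sqrt (c + t\<^sup>2)) = ennreal (t\<^sup>2 / (c + t\<^sup>2))"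
          using True c by (simp add: ennreal_mult[symmetric] power2_eq_square)
        then show ?thesis
          using True c by (simp add: mult_ac)
      qed simp
    qed
    finally show ?thesis .
  qed
  have [measurable]: "(\<lambda>t. G t * ennreal (t\<^sup>2 / (c + t\<^sup>2))) \<in> borel_measurable borel"
    using G by measurable
  have "(\<integral>\<^sup>+t. G t * ennreal (t\<^sup>2 / (c + t\<^sup>2)) \<partial>lborel) =
     (\<integral>\<^sup>+t. G t * ennreal (t\<^sup>2 / (c + t\<^sup>2)) * indicator {0<..} t + G t * ennreal (t\<^sup>2 / (c + t\<^sup>2)) * indicator {..<0} t \<partial>lborel)"
  proof (rule nn_integral_cong)
    fix t :: real
    show "G t * ennreal (t\<^sup>2 / (c + t\<^sup>2)) =
      G t * ennreal (t\<^sup>2 / (c + t\<^sup>2)) * indicator {0<..} t + G t * ennreal (t\<^sup>2 / (c + t\<^sup>2)) * indicator {..<0} t"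
      by (cases t "0::real" rule: linorder_cases) auto
  qed
  also have "\<dots> = (\<integral>\<^sup>+t. G t * ennreal (t\<^sup>2 / (c + t\<^sup>2)) * indicator {0<..} t \<partial>lborel)
     + (\<integral>\<^sup>+t. G t * ennreal (t\<^sup>2 / (c + t\<^sup>2)) * indicator {..<0} t \<partial>lborel)"
    by (rule nn_integral_add) measurable
  also have "(\<integral>\<^sup>+t. G t * ennreal (t\<^sup>2 / (c + t\<^sup>2)) * indicator {..<0} t \<partial>lborel) =
      (\<integral>\<^sup>+t. G (- 1 * t) * ennreal (t\<^sup>2 / (c + t\<^sup>2)) * indicator {0<..} t \<partial>lborel)"
    by (subst nn_integral_real_affine[where c = "-1" and t = 0])
       (measurable, auto intro!: nn_integral_cong simp: indicator_def)
  finally show ?thesis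
    unfolding half by (simp add: add.commute)
qed

lemma sigma_finite_PiM_lborel: "sigma_finite_measure (\<Pi>\<^sub>M i\<in>(A::'n::finite set). (lborel :: real measure))"
proof -
  interpret product_sigma_finite "\<lambda>_::'n. lborel :: real measure" ..
  interpret finite_product_sigma_finite "\<lambda>_::'n. lborel :: real measure" A by standard simp
  show ?thesis by (rule sigma_finite_measure_axioms)
qed

lemma measurable_nn_integral_sphere:
  assumes F [measurable]: "F \<in> borel_measurable borel"
  shows "(\<lambda>(r, y). sphere_weight x0 r k s y * F (graph_pt x0 r k s y)) \<in>
      borel_measurable (lborel \<Otimes>\<^sub>M (\<Pi>\<^sub>M i\<in>-{k}. lborel))"
    and "(\<lambda>r. \<integral>\<^sup>+x. F x \<partial>sphere_measure x0 r) \<in> borel_measurable borel"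
proof -
  have 1: "(\<lambda>(r, y). sphere_weight x0 r k s y * F (graph_pt x0 r k s y)) \<in>
      borel_measurable (lborel \<Otimes>\<^sub>M (\<Pi>\<^sub>M i\<in>-{k}. lborel))" for k s
    unfolding split_def
    by (intro borel_measurable_times_ennreal measurable_sphere_weight
        measurable_compose[OF measurable_graph_pt_comp F]) measurable
  then show "(\<lambda>(r, y). sphere_weight x0 r k s y * F (graph_pt x0 r k s y)) \<in>
      borel_measurable (lborel \<Otimes>\<^sub>M (\<Pi>\<^sub>M i\<in>-{k}. lborel))" .
  have "(\<lambda>r. \<integral>\<^sup>+y. sphere_weight x0 r k s y * F (graph_pt x0 r k s y) \<partial>(\<Pi>\<^sub>M i\<in>-{k}. lborel)) \<in> borel_measurable lborel" for k s
    by (rule sigma_finite_measure.borel_measurable_nn_integral[OF sigma_finite_PiM_lborel 1])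
  then show "(\<lambda>r. \<integral>\<^sup>+x. F x \<partial>sphere_measure x0 r) \<in> borel_measurable borel"
    unfolding nn_integral_sphere_measure[OF F] by (intro borel_measurable_sum) simp
qed

text \<open>After Fubini the radial integral over each family of graphs becomes an integral along
  lines in direction k, where the partition functions reappear as densities with sum 1 away from the
  centre. The formula for \<open>sphere_measure\<close> depends on r through r^2 only, so without
  the indicator everything would be counted twice.\<close>

theorem nn_integral_polar:
  fixes F :: "real^'n::finite \<Rightarrow> ennreal"
  assumes F [measurable]: "F \<in> borel_measurable borel"
  shows "(\<integral>\<^sup>+r. indicator {0<..} r * (\<integral>\<^sup>+x. F x \<partial>sphere_measure x0 r) \<partial>lborel) = (\<integral>\<^sup>+x. F x \<partial>lborel)"
proof -
  let ?L = "\<lambda>k. \<Pi>\<^sub>M i\<in>-{k::'n}. (lborel :: real measure)"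
  let ?f = "\<lambda>k s r y. sphere_weight x0 r k s y * F (graph_pt x0 r k s y)"
  have pair: "pair_sigma_finite (lborel :: real measure) (?L k)" for k
    unfolding pair_sigma_finite_def
    by (intro conjI sigma_finite_PiM_lborel lborel.sigma_finite_measure_axioms)
  note fm = measurable_nn_integral_sphere(1)[OF F, of x0]
  have fm': "(\<lambda>(r, y). indicator {0<..} r * ?f k s r y) \<in> borel_measurable (lborel \<Otimes>\<^sub>M ?L k)" for k s
  proof -
    have "(\<lambda>p. indicator {0::real<..} (fst p) :: ennreal) \<in> borel_measurable (lborel \<Otimes>\<^sub>M ?L k)"
      by (rule measurable_compose[OF measurable_fst]) simp
    from borel_measurable_times_ennreal[OF this fm[of k s]] show ?thesis
      by (simp add: split_def)
  qed
  have fm2: "(\<lambda>r. \<integral>\<^sup>+y. indicator {0<..} r * ?f k s r y \<partial>?L k) \<in> borel_measurable lborel" for k s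
    by (rule sigma_finite_measure.borel_measurable_nn_integral[OF sigma_finite_PiM_lborel fm'])
  have fr: "?f k s r \<in> borel_measurable (?L k)" for k s r
    using measurable_compose[OF measurable_Pair1' fm, of r k s] by simp
  have fm3: "(\<lambda>y. \<integral>\<^sup>+r. indicator {0<..} r * ?f k s r y \<partial>lborel) \<in> borel_measurable (?L k)" for k s
  proof -
    have "(\<lambda>(y, r). indicator {0<..} r * ?f k s r y) \<in> borel_measurable (?L k \<Otimes>\<^sub>M lborel)"
      using measurable_compose[OF measurable_pair_swap' fm'[of k s]] by (simp add: split_def)
    then show ?thesis
      by (rule sigma_finite_measure.borel_measurable_nn_integral[OF lborel.sigma_finite_measure_axioms])
  qed
  \<comment> \<open>F weighted by the k-th function of the partition of unity, now as a function on
    the whole space.\<close>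
  define H where "H k x = F x * ennreal (((x - x0) $ k)\<^sup>2 / (norm (x - x0))\<^sup>2)" for k x
  have H: "H k \<in> borel_measurable borel" for k
  proof -
    have [measurable]: "(\<lambda>x. (x - x0) $ k) \<in> borel_measurable borel"
      "(\<lambda>x. (norm (x - x0))\<^sup>2) \<in> borel_measurable borel"
      by (intro borel_measurable_continuous_onI continuous_intros)+
    show ?thesis unfolding H_def by measurable
  qed
  have inner: "(\<Sum>s\<in>{-1, 1}. \<integral>\<^sup>+r. indicator {0<..} r * ?f k s r y \<partial>lborel) =
      (\<integral>\<^sup>+u. H k (insert_coord k u y) \<partial>lborel)" if y: "y \<in> space (?L k)" for k y
  proof -
    let ?c = "off_sq x0 k y"
    define G where "G t = F (insert_coord k (x0 $ k + t) y)" for t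
    have ic: "(\<lambda>u. insert_coord k u y) \<in> borel_measurable borel"
      by (rule measurable_insert_coord) (use y in simp_all)
    have G: "G \<in> borel_measurable borel"
      unfolding G_def using measurable_compose[OF ic F] by measurable
    have "indicator {0<..} r * ?f k s r y = indicator {0<..} r * (indicator {r. ?c < r\<^sup>2} r *
        ennreal (sqrt (r\<^sup>2 - ?c) / r) * G (s * sqrt (r\<^sup>2 - ?c)))" if s: "s \<in> {-1, 1}" for r s
      using sphere_weight_eq[OF _ _ s, of r x0 k y]
      by (cases "r > 0 \<and> ?c < r\<^sup>2") (auto simp: sphere_weight_def G_def graph_pt_eq)
    then have "(\<Sum>s\<in>{-1, 1}. \<integral>\<^sup>+r. indicator {0<..} r * ?f k s r y \<partial>lborel) =
      (\<Sum>s\<in>{-1, 1::real}. \<integral>\<^sup>+r. indicator {0<..} r * (indicator {r. ?c < r\<^sup>2} r *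
        ennreal (sqrt (r\<^sup>2 - ?c) / r) * G (s * sqrt (r\<^sup>2 - ?c))) \<partial>lborel)"
      by (intro sum.cong refl nn_integral_cong)
    also have "\<dots> = (\<integral>\<^sup>+t. G t * ennreal (t\<^sup>2 / (?c + t\<^sup>2)) \<partial>lborel)"
      by (rule nn_integral_radial_sum[OF G off_sq_nonneg])
    also have "\<dots> = (\<integral>\<^sup>+t. H k (insert_coord k (x0 $ k + 1 * t) y) \<partial>lborel)"
    proof -
      have "(insert_coord k (x0 $ k + t) y - x0) $ k = t" for t by (simp add: insert_coord_def)
      then show ?thesis by (simp add: H_def norm_insert_coord G_def)
    qed
    also have "\<dots> = (\<integral>\<^sup>+u. H k (insert_coord k u y) \<partial>lborel)"
      using nn_integral_real_affine[of "\<lambda>u. H k (insert_coord k u y)" 1 "x0 $ k"] measurable_compose[OF ic H]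
      by simp
    finally show ?thesis .
  qed
  have "(\<integral>\<^sup>+r. indicator {0<..} r * (\<integral>\<^sup>+x. F x \<partial>sphere_measure x0 r) \<partial>lborel) =
      (\<integral>\<^sup>+r. (\<Sum>k\<in>UNIV. \<Sum>s\<in>{-1, 1}. \<integral>\<^sup>+y. indicator {0<..} r * ?f k s r y \<partial>?L k) \<partial>lborel)"
    unfolding nn_integral_sphere_measure[OF F] sum_distrib_left
    by (intro nn_integral_cong sum.cong refl nn_integral_cmult[symmetric] fr)
  also have "\<dots> = (\<Sum>k\<in>UNIV. \<Sum>s\<in>{-1, 1}. \<integral>\<^sup>+r. \<integral>\<^sup>+y. indicator {0<..} r * ?f k s r y \<partial>?L k \<partial>lborel)"
    using fm2 by (subst nn_integral_sum) (auto intro!: borel_measurable_sum simp: nn_integral_sum simp del: sum.insert)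
  also have "\<dots> = (\<Sum>k\<in>UNIV. \<Sum>s\<in>{-1, 1}. \<integral>\<^sup>+y. \<integral>\<^sup>+r. indicator {0<..} r * ?f k s r y \<partial>lborel \<partial>?L k)"
    by (intro sum.cong refl pair_sigma_finite.Fubini'[OF pair fm', symmetric])
  also have "\<dots> = (\<Sum>k\<in>UNIV. \<integral>\<^sup>+y. (\<Sum>s\<in>{-1, 1}. \<integral>\<^sup>+r. indicator {0<..} r * ?f k s r y \<partial>lborel) \<partial>?L k)"
    by (intro sum.cong refl nn_integral_sum[symmetric] fm3)
  also have "\<dots> = (\<Sum>k\<in>UNIV. \<integral>\<^sup>+y. \<integral>\<^sup>+u. H k (insert_coord k u y) \<partial>lborel \<partial>?L k)"
    by (intro sum.cong refl nn_integral_cong inner)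
  also have "\<dots> = (\<integral>\<^sup>+x. (\<Sum>k\<in>UNIV. H k x) \<partial>lborel)"
    using H by (simp add: nn_integral_lborel_insert_coord[symmetric] nn_integral_sum)
  also have "\<dots> = (\<integral>\<^sup>+x. F x \<partial>lborel)"
  proof (rule nn_integral_cong_AE)
    show "AE x in lborel. (\<Sum>k\<in>UNIV. H k x) = F x"
    proof (rule AE_mp[OF AE_lborel_singleton[of x0] AE_I2], rule impI)
      fix x assume "x \<noteq> x0"
      moreover have "(\<Sum>k\<in>UNIV. ((x - x0) $ k)\<^sup>2) = (norm (x - x0))\<^sup>2"
        unfolding power2_norm_eq_inner inner_vec_def by (simp add: power2_eq_square)
      ultimately have "(\<Sum>k\<in>UNIV. ((x - x0) $ k)\<^sup>2 / (norm (x - x0))\<^sup>2) = 1"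
        by (simp only: sum_divide_distrib[symmetric]) simp
      then show "(\<Sum>k\<in>UNIV. H k x) = F x"
        by (simp add: H_def sum_distrib_left[symmetric] sum_ennreal)
    qed
  qed
  finally show ?thesis .
qed

text \<open>Writes the Bochner integral, with its default value 0 in the nonintegrable case, through
  two nonnegative integrals. This makes its dependence on a parameter of M visibly
  measurable.\<close>

lemma integral_eq_enn2real:
  fixes f :: "'a \<Rightarrow> real"
  assumes f: "f \<in> borel_measurable M"
  shows "(LINT x|M. f x) = (if (\<integral>\<^sup>+x. ennreal (f x) \<partial>M) < \<infinity> \<and> (\<integral>\<^sup>+x. ennreal (- f x) \<partial>M) < \<infinity>
    then enn2real (\<integral>\<^sup>+x. ennreal (f x) \<partial>M) - enn2real (\<integral>\<^sup>+x. ennreal (- f x) \<partial>M) else 0)"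
proof (cases "integrable M f")
  case True
  then show ?thesis
    using real_lebesgue_integral_def[OF True] real_integrable_def[of M f] by (simp add: top.not_eq_extremum)
next
  case False
  then show ?thesis
    using real_integrable_def[of M f] f by (auto simp: not_integrable_integral_eq top.not_eq_extremum)
qed

lemma measurable_sphere_integral:
  fixes F :: "real^'n::finite \<Rightarrow> real"
  assumes F: "F \<in> borel_measurable borel"
  shows "(\<lambda>r. LINT x|sphere_measure x0 r. F x) \<in> borel_measurable borel"
proof -
  have Fs: "F \<in> borel_measurable (sphere_measure x0 r)" for r
    using F by (simp add: measurable_cong_sets[OF sets_sphere_measure refl])
  have [measurable]: "(\<lambda>r. \<integral>\<^sup>+x. ennreal (F x) \<partial>sphere_measure x0 r) \<in> borel_measurable borel"
    "(\<lambda>r. \<integral>\<^sup>+x. ennreal (- F x) \<partial>sphere_measure x0 r) \<in> borel_measurable borel"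
    by (intro measurable_nn_integral_sphere(2); use F in measurable)+
  show ?thesis
    unfolding integral_eq_enn2real[OF Fs] by measurable
qed

text \<open>Applied to the positive and the negative part, the nonnegative formula gives finite
  totals. So for almost every radius both sphere integrals are finite and their difference is the
  Bochner integral; the default value occurs on a null set of radii only.\<close>

theorem integral_polar:
  fixes F :: "real^'n::finite \<Rightarrow> real"
  assumes F: "integrable lborel F"
  shows "(LINT x|lborel. F x) = (LINT r|lborel. indicator {0<..} r * (LINT x|sphere_measure x0 r. F x))"
proof -
  have Fm [measurable]: "F \<in> borel_measurable borel" using F by simp
  have Fs: "F \<in> borel_measurable (sphere_measure x0 r)" for r
    using Fm by (simp add: measurable_cong_sets[OF sets_sphere_measure refl])
  define P where "P G r = indicator {0<..} r * (\<integral>\<^sup>+x. ennreal (G x) \<partial>sphere_measure x0 r)" for G :: "real^'n \<Rightarrow> real" and r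
  have P: "P G \<in> borel_measurable borel" "(\<integral>\<^sup>+r. P G r \<partial>lborel) = (\<integral>\<^sup>+x. ennreal (G x) \<partial>lborel)"
    if [measurable]: "G \<in> borel_measurable borel" for G
    unfolding P_def
    by (intro borel_measurable_times_ennreal measurable_nn_integral_sphere(2); measurable)
       (rule nn_integral_polar; measurable)
  have fin: "(\<integral>\<^sup>+r. P F r \<partial>lborel) < \<infinity>" "(\<integral>\<^sup>+r. P (\<lambda>x. - F x) r \<partial>lborel) < \<infinity>"
    using F by (auto simp: P real_integrable_def top.not_eq_extremum)
  have int: "integrable lborel (\<lambda>r. enn2real (P G r))" "(LINT r|lborel. enn2real (P G r)) = enn2real (\<integral>\<^sup>+x. ennreal (G x) \<partial>lborel)"
    "AE r in lborel. P G r < \<infinity>"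
    if G [measurable]: "G \<in> borel_measurable borel" and G_fin: "(\<integral>\<^sup>+r. P G r \<partial>lborel) < \<infinity>" for G
  proof -
    have PG [measurable]: "P G \<in> borel_measurable borel" by (rule P(1)[OF G])
    show ae: "AE r in lborel. P G r < \<infinity>"
      using nn_integral_PInf_AE[of "P G" lborel] G_fin by (auto simp: top.not_eq_extremum)
    have eq: "(\<integral>\<^sup>+r. ennreal (enn2real (P G r)) \<partial>lborel) = (\<integral>\<^sup>+r. P G r \<partial>lborel)"
      by (rule nn_integral_cong_AE) (use ae in \<open>auto elim!: AE_mp simp: less_top\<close>)
    show "integrable lborel (\<lambda>r. enn2real (P G r))"
      by (rule integrableI_nonneg) (use eq G_fin in auto)
    show "(LINT r|lborel. enn2real (P G r)) = enn2real (\<integral>\<^sup>+x. ennreal (G x) \<partial>lborel)"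
      by (subst integral_eq_nn_integral) (use eq P(2)[OF G] in auto)
  qed
  note intF = int[OF Fm fin(1)]
  note intN = int[OF borel_measurable_uminus[OF Fm] fin(2)]
  have "(LINT x|lborel. F x) = (LINT r|lborel. enn2real (P F r)) - (LINT r|lborel. enn2real (P (\<lambda>x. - F x) r))"
    using real_lebesgue_integral_def[OF F] intF(2) intN(2) by simp
  also have "\<dots> = (LINT r|lborel. enn2real (P F r) - enn2real (P (\<lambda>x. - F x) r))"
    using intF(1) intN(1) by simp
  also have "\<dots> = (LINT r|lborel. indicator {0<..} r * (LINT x|sphere_measure x0 r. F x))"
  proof (rule integral_cong_AE)
    show "(\<lambda>r. indicator {0<..} r * (LINT x|sphere_measure x0 r. F x)) \<in> borel_measurable lborel"
      using measurable_sphere_integral[OF Fm] by measurable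
    show "(\<lambda>r. enn2real (P F r) - enn2real (P (\<lambda>x. - F x) r)) \<in> borel_measurable lborel"
      using intF(1) intN(1) by simp
    show "AE r in lborel. enn2real (P F r) - enn2real (P (\<lambda>x. - F x) r) =
        indicator {0<..} r * (LINT x|sphere_measure x0 r. F x)"
      using intF(3) intN(3)
    proof eventually_elim
      case (elim r)
      then show ?case
        unfolding integral_eq_enn2real[OF Fs] by (cases "r > 0") (auto simp: P_def)
    qed
  qed
  finally show ?thesis .
qed

section \<open>From the annulus to iterated integrals over spheres\<close>

lemma (in dirac_harmonic) monotonicity_formula:
  assumes R: "0 < R1" "R1 < R2"
  shows "R2 powi (2 - int CARD('n)) * (LBINT x:ball x0 R2. energy_density N \<phi> \<psi> x)
      - R1 powi (2 - int CARD('n)) * (LBINT x:ball x0 R1. energy_density N \<phi> \<psi> x)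
    = (LBINT r:{R1..R2}. r powi (2 - int CARD('n)) *
        (LINT x|sphere_measure x0 r. directional_density cl N \<phi> \<psi> x (radial x0 x)))"
proof -
  let ?n = "int CARD('n)"
  define d where "d = (\<lambda>x. gstress (radial x0 x) (radial x0 x) x)"
  define F where "F = (\<lambda>x. indicator (annulus x0 R1 R2) x * (norm (x - x0) powi (2 - ?n) * d x))"
  note stress = integral_annulus_stress[OF R smooth_gstress linear_gstress energy_density_eq gstress_divergence,
      of x0, folded radial_def]
  have stress: "integrable lborel F"
    "(LINT x|lborel. F x) = R2 powi (2 - ?n) * (LBINT x:ball x0 R2. energy_density N \<phi> \<psi> x)
      - R1 powi (2 - ?n) * (LBINT x:ball x0 R1. energy_density N \<phi> \<psi> x)"
    using stress unfolding F_def d_def by auto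
  have Fm: "F \<in> borel_measurable borel" using stress(1) by simp
  \<comment> \<open>The field \<open>radial\<close> need not extend continuously to the centre, so
    measurability comes from expanding d bilinearly into measurable coefficients and smooth
    components.\<close>
  have dm: "d \<in> borel_measurable borel"
  proof -
    have "d = (\<lambda>x. \<Sum>i\<in>UNIV. \<Sum>j\<in>UNIV. radial x0 x $ i * (radial x0 x $ j * gstress (axis i 1) (axis j 1) x))"
    proof
      fix x
      have "d x = (\<Sum>i\<in>UNIV. radial x0 x $ i *\<^sub>R gstress (axis i 1) (radial x0 x) x)"
        unfolding d_def by (rule linear_axis_sum[OF linear_gstress(1)])
      also have "\<dots> = (\<Sum>i\<in>UNIV. radial x0 x $ i *\<^sub>R (\<Sum>j\<in>UNIV. radial x0 x $ j *\<^sub>R gstress (axis i 1) (axis j 1) x))"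
        by (intro sum.cong refl arg_cong2[where f = scaleR] linear_axis_sum[OF linear_gstress(2)])
      finally show "d x = (\<Sum>i\<in>UNIV. \<Sum>j\<in>UNIV. radial x0 x $ i * (radial x0 x $ j * gstress (axis i 1) (axis j 1) x))"
        by (simp add: sum_distrib_left)
    qed
    moreover have "(\<lambda>x. radial x0 x $ i) \<in> borel_measurable borel" for i
    proof -
      have [measurable]: "(\<lambda>x. (x - x0) $ i) \<in> borel_measurable borel" "(\<lambda>x. norm (x - x0)) \<in> borel_measurable borel"
        by (intro borel_measurable_continuous_onI continuous_intros)+
      show ?thesis unfolding radial_def vector_scaleR_component by measurable
    qed
    moreover have "gstress u v \<in> borel_measurable borel" for u v
      by (rule borel_measurable_continuous_onI[OF smooth_on_continuous[OF smooth_gstress]])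
    ultimately show ?thesis
      by (simp only:) (intro borel_measurable_sum borel_measurable_times)
  qed
  have ms: "k \<in> borel_measurable (sphere_measure x0 r)" if "k \<in> borel_measurable borel" for k :: "real^'n \<Rightarrow> real" and r
    using that by (simp add: measurable_cong_sets[OF sets_sphere_measure refl])
  \<comment> \<open>On the sphere of radius r the indicator of the annulus and the power of |x - x0|
    are almost everywhere constants, which leave the integral.\<close>
  have sphere: "(LINT x|sphere_measure x0 r. F x) =
      indicator {R1..<R2} r * (r powi (2 - ?n) * (LINT x|sphere_measure x0 r. d x))" if "r > 0" for r
  proof -
    have "(LINT x|sphere_measure x0 r. F x) =
        (LINT x|sphere_measure x0 r. indicator {R1..<R2} r * (r powi (2 - ?n) * d x))"
    proof (rule integral_cong_AE)
      show "AE x in sphere_measure x0 r. F x = indicator {R1..<R2} r * (r powi (2 - ?n) * d x)"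
        using AE_sphere_measure[OF that, of x0]
        by eventually_elim (auto simp: F_def annulus_def[OF R] indicator_def)
    qed (use ms[OF Fm] ms[OF dm] in auto)
    then show ?thesis by simp
  qed
  have "(LINT x|lborel. F x) = (LINT r|lborel. indicator {0<..} r * (LINT x|sphere_measure x0 r. F x))"
    by (rule integral_polar[OF stress(1)])
  also have "\<dots> = (LINT r|lborel. indicator {R1..R2} r *\<^sub>R (r powi (2 - ?n) * (LINT x|sphere_measure x0 r. d x)))"
  proof (rule integral_cong_AE)
    show "(\<lambda>r. indicator {0<..} r * (LINT x|sphere_measure x0 r. F x)) \<in> borel_measurable lborel"
      using measurable_sphere_integral[OF Fm] by measurable
    have "(\<lambda>r. indicator {R1..R2} r *\<^sub>R r powi (2 - ?n)) \<in> borel_measurable borel"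
      by (rule borel_measurable_continuous_on_indicator) (use R in \<open>auto intro!: continuous_intros\<close>)
    from borel_measurable_times[OF this measurable_sphere_integral[OF dm]]
    show "(\<lambda>r. indicator {R1..R2} r *\<^sub>R (r powi (2 - ?n) * (LINT x|sphere_measure x0 r. d x))) \<in> borel_measurable lborel"
      by (simp add: mult.assoc)
    \<comment> \<open>The annulus is half open and the interval closed; they differ at the single
      radius R2.\<close>
    show "AE r in lborel. indicator {0<..} r * (LINT x|sphere_measure x0 r. F x) =
        indicator {R1..R2} r *\<^sub>R (r powi (2 - ?n) * (LINT x|sphere_measure x0 r. d x))"
      using AE_lborel_singleton[of R2]
      by eventually_elim (use R sphere in \<open>auto simp: indicator_def\<close>)
  qed
  finally show ?thesis
    unfolding stress(2) directional_density_eq d_def set_lebesgue_integral_def .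
qed

theorem proposition5p7:
  fixes N :: "('p, 'c, 'm::finite) riem_data"
    and cl :: "real^'n::finite \<Rightarrow> complex^'s::finite \<Rightarrow> complex^'s"
    and \<phi> :: "real^'n \<Rightarrow> 'p"
    and \<psi> :: "'c \<Rightarrow> real^'n \<Rightarrow> complex^'s^'m"
    and x0 :: "real^'n" and R R1 R2 :: real
  assumes "riemannian_manifold N"
    and "spinor_module cl"
    and "dirac_harmonic_curv cl N \<phi> \<psi>"
    and "0 < R1" and "R1 < R2" and "R2 \<le> R"
  shows "R1 powi (2 - int CARD('n)) * (LBINT x:ball x0 R1. energy_density N \<phi> \<psi> x) =
         R2 powi (2 - int CARD('n)) * (LBINT x:ball x0 R2. energy_density N \<phi> \<psi> x)
         - (LBINT r:{R1..R2}. r powi (2 - int CARD('n)) *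
              (LINT x|sphere_measure x0 r. directional_density cl N \<phi> \<psi> x (radial x0 x)))"
proof -
  interpret dirac_harmonic N cl \<phi> \<psi>
    using assms(1-3) by unfold_locales (auto simp: dirac_harmonic_curv_def)
  show ?thesis
    using monotonicity_formula[OF assms(4,5), of x0] by simp
qed

end
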